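(* Let $G=(V,E,w)$ be a connected graph with $n=|V|$ nodes and positive integer edge weights $w:E\to\mathbb{Z}^+$, let $s\in V$ be a designated sink, let $D$ be the diameter of $G$, and suppose $G$ has doubling dimension $\rho$. Then one can compute deterministically, in polynomial time, a spanning tree $\overline{T}$ of $G$ rooted at $s$ that is $\sigma$-oblivious with $\sigma=O(2^{10\rho}\log^3 D\cdot\log n)$; that is, there is an absolute constant $c>0$ such that for every set of sources $A\subseteq V$ and every canonical fusion function $f$, $$\mathrm{cost}_f(\overline{T},A)\le c\cdot 2^{10\rho}\log^3 D\cdot \log n\cdot C^*_f(A,G).$$
   Context: For $u,v\in V$, $\mathrm{dist}_G(u,v)$ is the total weight of a shortest $u$–$v$ path, and $D=\max_{u,v}\mathrm{dist}_G(u,v)$. For $u\in V$ and $r\ge 0$, $N_G(u,r)=\{v:\mathrm{dist}_G(u,v)\le r\}$. $G$ has doubling dimension $\rho$ if $\rho$ is the smallest number such that every $N_G(u,R)$ can be covered by at most $2^\rho$ sets of the form $N_G(v,R/2)$. A canonical fusion function is a function $f:\mathbb{Z}_{\ge0}\to\mathbb{R}_{\ge0}$ that is concave, non-decreasing, and satisfies $f(0)=0$. Data fusion toward $s$: each source in $A$ produces one unit-size data item; when data from $k$ sources is fused and transmitted over an edge, it has size $f(k)$, and the cost of sending it over an edge $e$ is $w(e)\cdot f(k)$. For a tree $T$ rooted at $s$ and $A\subseteq V$, $\mathrm{cost}_f(T,A)=\sum_{e\in T} w(e)\, f(|A\cap T_e|)$, where $T_e$ is the set of nodes in the subtree of $T$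 hanging below edge $e$ (on the side away from $s$). $C^*_f(A,G)$ denotes the optimal (minimum) communication cost of fusing the data of all sources in $A$ to $s$ in $G$ under $f$. A spanning tree $T$ rooted at $s$ is $k$-oblivious ($k$-OST) if it gives a $k$-factor approximation to the optimal cost for every set of sources and every canonical fusion function.
   Formalization: The factor log D is read as max(1, log D) (base 2): at D = 1 (unit-weight complete graphs with n ≥ 2) the stated bound is 0 while the cost is positive, and at D = 0 log D is undefined; for D ≥ 2 the bound is unchanged. *)

theory Defs
  imports
    Complex_Main
    "HOL-Library.Discrete_Functions"
    "HOL-Computational_Algebra.Polynomial"
begin

section \<open>Weighted graphs\<close>

record 'a wgraph =
  verts :: "'a set"
  edges :: "'a set set"
  weight :: "'a set \<Rightarrow> nat"

definition weighted_graph :: "'a wgraph \<Rightarrow> bool" where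
  "weighted_graph G \<longleftrightarrow>
     finite (verts G) \<and>
     (\<forall>e \<in> edges G. \<exists>u \<in> verts G. \<exists>v \<in> verts G. u \<noteq> v \<and> e = {u, v}) \<and>
     (\<forall>e \<in> edges G. weight G e > 0)"

definition gpath :: "'a wgraph \<Rightarrow> 'a \<Rightarrow> 'a list \<Rightarrow> 'a \<Rightarrow> bool" where
  "gpath G u p v \<longleftrightarrow>
     p \<noteq> [] \<and> hd p = u \<and> last p = v \<and> distinct p \<and> set p \<subseteq> verts G \<and>
     (\<forall>i. Suc i < length p \<longrightarrow> {p ! i, p ! Suc i} \<in> edges G)"

definition path_edges :: "'a list \<Rightarrow> 'a set set" where
  "path_edges p = {{p ! i, p ! Suc i} | i. Suc i < length p}"

definition connected_graph :: "'a wgraph \<Rightarrow> bool" where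
  "connected_graph G \<longleftrightarrow> (\<forall>u \<in> verts G. \<forall>v \<in> verts G. \<exists>p. gpath G u p v)"

definition gdist :: "'a wgraph \<Rightarrow> 'a \<Rightarrow> 'a \<Rightarrow> nat" where
  "gdist G u v = Inf {(\<Sum>e \<in> path_edges p. weight G e) | p. gpath G u p v}"

definition gdiameter :: "'a wgraph \<Rightarrow> nat" where
  "gdiameter G = Max {gdist G u v | u v. u \<in> verts G \<and> v \<in> verts G}"

definition nbhd :: "'a wgraph \<Rightarrow> 'a \<Rightarrow> real \<Rightarrow> 'a set" where
  "nbhd G u r = {v \<in> verts G. real (gdist G u v) \<le> r}"

definition doubling_bound :: "'a wgraph \<Rightarrow> real \<Rightarrow> bool" where
  "doubling_bound G \<rho> \<longleftrightarrow>
     (\<forall>u \<in> verts G. \<forall>R \<ge> 0. \<exists>C \<subseteq> verts G.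
        real (card C) \<le> 2 powr \<rho> \<and> nbhd G u R \<subseteq> (\<Union>v \<in> C. nbhd G v (R / 2)))"

definition has_doubling_dimension :: "'a wgraph \<Rightarrow> real \<Rightarrow> bool" where
  "has_doubling_dimension G \<rho> \<longleftrightarrow>
     doubling_bound G \<rho> \<and> (\<forall>\<rho>'. doubling_bound G \<rho>' \<longrightarrow> \<rho> \<le> \<rho>')"


section \<open>Spanning trees, data fusion and obliviousness\<close>

definition has_cycle :: "'a wgraph \<Rightarrow> bool" where
  "has_cycle G \<longleftrightarrow> (\<exists>u p v. gpath G u p v \<and> length p \<ge> 3 \<and> {v, u} \<in> edges G)"

definition spanning_tree :: "'a wgraph \<Rightarrow> 'a set set \<Rightarrow> bool" where
  "spanning_tree G T \<longleftrightarrow>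
     T \<subseteq> edges G \<and> connected_graph (G\<lparr>edges := T\<rparr>) \<and> \<not> has_cycle (G\<lparr>edges := T\<rparr>)"

definition canonical_fusion :: "(nat \<Rightarrow> real) \<Rightarrow> bool" where
  "canonical_fusion f \<longleftrightarrow>
     (\<forall>k. f k \<ge> 0) \<and> f 0 = 0 \<and> mono f \<and>
     (\<forall>k. f (Suc (Suc k)) - f (Suc k) \<le> f (Suc k) - f k)"

text \<open>
  Deleting \<open>e\<close> from a tree leaves two components; the nodes below \<open>e\<close> are those cut off from
  the root \<open>s\<close>.
\<close>
definition below :: "'a wgraph \<Rightarrow> 'a \<Rightarrow> 'a set set \<Rightarrow> 'a set \<Rightarrow> 'a set" where
  "below G s T e = {v \<in> verts G. \<not> (\<exists>p. gpath (G\<lparr>edges := T - {e}\<rparr>) v p s)}"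

definition tree_cost ::
  "'a wgraph \<Rightarrow> 'a \<Rightarrow> (nat \<Rightarrow> real) \<Rightarrow> 'a set set \<Rightarrow> 'a set \<Rightarrow> real" where
  "tree_cost G s f T A = (\<Sum>e \<in> T. real (weight G e) * f (card (A \<inter> below G s T e)))"

text \<open>
  A fusion scheme need not be a tree: it sends the item of each source \<open>a\<close> along a path \<open>P a\<close>
  to the sink, and all items crossing the same edge are fused there. The optimum ranges over
  all such schemes.
\<close>
definition routing :: "'a wgraph \<Rightarrow> 'a \<Rightarrow> 'a set \<Rightarrow> ('a \<Rightarrow> 'a list) \<Rightarrow> bool" where
  "routing G s A P \<longleftrightarrow> (\<forall>a \<in> A. gpath G a (P a) s)"

definition routing_cost ::
  "'a wgraph \<Rightarrow> (nat \<Rightarrow> real) \<Rightarrow> 'a set \<Rightarrow> ('a \<Rightarrow> 'a list) \<Rightarrow> real" where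
  "routing_cost G f A P =
     (\<Sum>e \<in> edges G. real (weight G e) * f (card {a \<in> A. e \<in> path_edges (P a)}))"

definition opt_cost :: "'a wgraph \<Rightarrow> 'a \<Rightarrow> (nat \<Rightarrow> real) \<Rightarrow> 'a set \<Rightarrow> real" where
  "opt_cost G s f A = Inf {routing_cost G f A P | P. routing G s A P}"

definition oblivious_spanning_tree :: "'a wgraph \<Rightarrow> 'a \<Rightarrow> 'a set set \<Rightarrow> real \<Rightarrow> bool" where
  "oblivious_spanning_tree G s T \<sigma> \<longleftrightarrow>
     spanning_tree G T \<and>
     (\<forall>A \<subseteq> verts G. \<forall>f. canonical_fusion f \<longrightarrow>
        tree_cost G s f T A \<le> \<sigma> * opt_cost G s f A)"


section \<open>Deterministic computation with logarithmic cost\<close>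

text \<open>
  Structured programs for a random access machine with finitely many unbounded arrays of
  natural numbers. Array names are literals of the program, indices are computed. Every
  operation is charged the bit lengths of its operands and results (the logarithmic cost
  criterion of Aho, Hopcroft and Ullman), so running times agree with those of deterministic
  multitape Turing machines up to a polynomial.
\<close>

type_synonym memory = "nat \<Rightarrow> nat \<Rightarrow> nat"

definition bit_length :: "nat \<Rightarrow> nat" where
  "bit_length n = Suc (floor_log n)"

datatype aexp =
    Const nat
  | Cell nat aexp
  | Add aexp aexp
  | Sub aexp aexp
  | Mult aexp aexp
  | Quot aexp aexp

fun aval :: "aexp \<Rightarrow> memory \<Rightarrow> nat" where
  "aval (Const n) M = n"
| "aval (Cell x a) M = M x (aval a M)"
| "aval (Add a b) M = aval a M + aval b M"
| "aval (Sub a b) M = aval a M - aval b M"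
| "aval (Mult a b) M = aval a M * aval b M"
| "aval (Quot a b) M = aval a M div aval b M"

text \<open>Each node of an expression contributes the bit length of its value.\<close>
fun acost :: "aexp \<Rightarrow> memory \<Rightarrow> nat" where
  "acost (Const n) M = bit_length n"
| "acost (Cell x a) M = acost a M + bit_length (aval (Cell x a) M)"
| "acost (Add a b) M = acost a M + acost b M + bit_length (aval (Add a b) M)"
| "acost (Sub a b) M = acost a M + acost b M + bit_length (aval (Sub a b) M)"
| "acost (Mult a b) M = acost a M + acost b M + bit_length (aval (Mult a b) M)"
| "acost (Quot a b) M = acost a M + acost b M + bit_length (aval (Quot a b) M)"

datatype com =
    Skip
  | Assign nat aexp aexp
  | Seq com com
  | Cond aexp com com
  | While aexp com

definition update :: "memory \<Rightarrow> nat \<Rightarrow> nat \<Rightarrow> nat \<Rightarrow> memory" where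
  "update M x i v = M(x := (M x)(i := v))"

text \<open>\<open>exec c M t M'\<close>: started in \<open>M\<close>, the program \<open>c\<close> halts after time \<open>t\<close> in \<open>M'\<close>.
  A guard counts as true if its value is nonzero.\<close>
inductive exec :: "com \<Rightarrow> memory \<Rightarrow> nat \<Rightarrow> memory \<Rightarrow> bool" where
  Skip: "exec Skip M 1 M"
| Assign: "exec (Assign x a b) M (acost a M + acost b M) (update M x (aval a M) (aval b M))"
| Seq: "exec c M t M' \<Longrightarrow> exec d M' t' M'' \<Longrightarrow> exec (Seq c d) M (t + t') M''"
| CondTrue: "aval b M \<noteq> 0 \<Longrightarrow> exec c M t M' \<Longrightarrow> exec (Cond b c d) M (acost b M + t) M'"
| CondFalse: "aval b M = 0 \<Longrightarrow> exec d M t M' \<Longrightarrow> exec (Cond b c d) M (acost b M + t) M'"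
| WhileFalse: "aval b M = 0 \<Longrightarrow> exec (While b c) M (acost b M) M"
| WhileTrue: "aval b M \<noteq> 0 \<Longrightarrow> exec c M t M' \<Longrightarrow> exec (While b c) M' t' M'' \<Longrightarrow>
    exec (While b c) M (acost b M + t + t') M''"

inductive_cases exec_SkipE: "exec Skip M t M'"
  and exec_AssignE: "exec (Assign x a b) M t M'"
  and exec_SeqE: "exec (Seq c d) M t M'"
  and exec_CondE: "exec (Cond b c d) M t M'"
  and exec_WhileE: "exec (While b c) M t M'"

lemma exec_deterministic:
  "exec c M t M' \<Longrightarrow> exec c M u N' \<Longrightarrow> u = t \<and> N' = M'"
proof (induction arbitrary: u N' rule: exec.induct)
  case (Skip M)
  then show ?case by (auto elim: exec_SkipE)
next
  case (Assign x a b M)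
  then show ?case by (auto elim: exec_AssignE)
next
  case (Seq c M t M' d t' M'')
  from Seq.prems obtain t1 M1 t2 where "u = t1 + t2" "exec c M t1 M1" "exec d M1 t2 N'"
    by (rule exec_SeqE)
  with Seq.IH show ?case by metis
next
  case (CondTrue b M c t M' d)
  from CondTrue.prems CondTrue.hyps obtain t1 where "u = acost b M + t1" "exec c M t1 N'"
    by (auto elim: exec_CondE)
  with CondTrue.IH show ?case by metis
next
  case (CondFalse b M d t M' c)
  from CondFalse.prems CondFalse.hyps obtain t1 where "u = acost b M + t1" "exec d M t1 N'"
    by (auto elim: exec_CondE)
  with CondFalse.IH show ?case by metis
next
  case (WhileFalse b M c)
  from WhileFalse.prems show ?case by (rule exec_WhileE) (use WhileFalse.hyps in simp_all)
next
  case (WhileTrue b M c t M' t' M'')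
  from WhileTrue.prems obtain t1 M1 t2
    where "u = acost b M + t1 + t2" "exec c M t1 M1" "exec (While b c) M1 t2 N'"
    by (rule exec_WhileE) (use WhileTrue.hyps in simp_all)
  with WhileTrue.IH show ?case by metis
qed

definition initial_memory :: "nat list \<Rightarrow> memory" where
  "initial_memory xs = (\<lambda>x i. if x = 0 \<and> i < length xs then xs ! i else 0)"

definition input_size :: "nat list \<Rightarrow> nat" where
  "input_size xs = (\<Sum>x \<leftarrow> xs. bit_length x)"


section \<open>Encoding of instances and of rooted trees\<close>

text \<open>
  The list \<open>vs\<close> numbers the nodes. An instance is given by the number of nodes, the number of
  the sink and the weighted adjacency matrix, row by row, where 0 stands for a missing edge.
\<close>
definition encodes_instance :: "nat list \<Rightarrow> 'a list \<Rightarrow> 'a wgraph \<Rightarrow> 'a \<Rightarrow> bool" where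
  "encodes_instance xs vs G s \<longleftrightarrow>
     distinct vs \<and> set vs = verts G \<and>
     (\<exists>k < length vs. vs ! k = s \<and>
        xs = length vs # k #
          [if {u, v} \<in> edges G then weight G {u, v} else 0. u \<leftarrow> vs, v \<leftarrow> vs])"

text \<open>
  A tree rooted at \<open>s\<close> is represented by parent pointers: for each node number \<open>i\<close> with
  \<open>vs ! i \<noteq> s\<close>, the entry \<open>q i\<close> is the number of the parent of \<open>vs ! i\<close>.
\<close>
definition parent_tree :: "(nat \<Rightarrow> nat) \<Rightarrow> 'a list \<Rightarrow> 'a \<Rightarrow> 'a set set \<Rightarrow> bool" where
  "parent_tree q vs s T \<longleftrightarrow>
     (\<forall>i < length vs. vs ! i \<noteq> s \<longrightarrow> q i < length vs) \<and>
     T = {{vs ! i, vs ! q i} | i. i < length vs \<and> vs ! i \<noteq> s}"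

end

theory Submission
  imports Defs
begin

text \<open>
  The tree is built from nets: the \<open>l\<close>-th net is a maximal set of nodes with pairwise distances at
  least \<open>4 ^ l\<close> that contains the sink, so the last net is the sink alone. From every node of the
  \<open>l\<close>-th net a shortest path runs to the next net, and the level-\<open>l\<close> paths are kept consistent by a
  fixed choice of next hops. Every node follows the path of the highest level on which it lies.

  A root path travels less than \<open>4 ^ (l + 1)\<close> on level \<open>l\<close>, and once its level is high compared to
  the distance to the sink it heads straight for the sink. Hence the sources in a ball of radius
  \<open>4 ^ min l i\<close> at distance about \<open>4 ^ i\<close> from the sink use only \<open>2 ^ O(\<rho>)\<close> different level-\<open>l\<close> paths, each
  for a length \<open>O(4 ^ min l i)\<close>. Any fusion scheme pays for such balls, packed disjointly up to \<open>2 ^ O(\<rho>)\<close>,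
  the radius times \<open>f\<close> of the number of sources in the ball. Summing over the \<open>O(log D)\<close> values of \<open>l\<close>
  and of \<open>i\<close> gives a tree that is \<open>O(2 ^ (7 * \<rho>) * log\<^sup>2 D)\<close>-oblivious.
\<close>

section \<open>Distances and packings\<close>

text \<open>Paths of different levels cross, so their union is not a tree. Letting the highest level
  win makes levels monotone along root paths, and the pair of level and remaining distance to the
  next net is then a potential that excludes cycles. Base 4 is dictated by the sink argument: travel
  on levels up to \<open>j\<close> adds up to \<open>S j\<close>, about a third of
  \<open>4 ^ (j + 2)\<close>, and twice that plus twice the distance of the source must stay below
  the separation of net \<open>j + 2\<close>. Ratios 2 and 3 leave no room for the source. The scale
  \<open>min l i\<close> balances both sides. For \<open>l \<le> i\<close> a level-\<open>l\<close>
  path is short as a whole; for \<open>l > i\<close> only its last piece near the sink is used. In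
  both cases the centre of a cell is at least its scale away from the sink, so every scheme has to
  carry the items out of a ball around it. Neither \<open>f\<close> nor \<open>A\<close> enters the
  construction, and of \<open>f\<close> only monotonicity, subadditivity and the decrease of
  \<open>f k / k\<close> are exploited.\<close>

lemma path_edges_alt: "path_edges p = (\<lambda>i. {p ! i, p ! Suc i}) ` {i. Suc i < length p}"
  by (auto simp: path_edges_def)

lemma path_edges_Cons2: "path_edges (x # y # p) = insert {x, y} (path_edges (y # p))"
proof -
  have "{i. Suc i < length (x # y # p)} = insert 0 (Suc ` {i. Suc i < length (y # p)})"
    by (auto simp: image_iff) (metis Suc_less_eq not0_implies_Suc)
  then show ?thesis by (simp add: path_edges_alt image_image)
qed

lemma path_edges_single: "path_edges [x] = {}"
  by (auto simp: path_edges_def)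

lemma path_edges_subset: "e \<in> path_edges p \<Longrightarrow> e \<subseteq> set p"
  by (auto simp: path_edges_def)

lemma finite_path_edges: "finite (path_edges p)"
proof -
  have "finite {i. Suc i < length p}" by (rule finite_subset[of _ "{..<length p}"]) auto
  then show ?thesis by (simp add: path_edges_alt)
qed

lemma gpath_single: "gpath G u [x] v \<longleftrightarrow> x = u \<and> u = v \<and> u \<in> verts G"
  by (auto simp: gpath_def)

lemma gpath_Cons2:
  "gpath G u (x # y # p) v \<longleftrightarrow>
     x = u \<and> u \<in> verts G \<and> {u, y} \<in> edges G \<and> u \<notin> set (y # p) \<and> gpath G y (y # p) v"
proof -
  have *: "(\<forall>i. Suc i < length (x # y # p) \<longrightarrow> R ((x # y # p) ! i) ((x # y # p) ! Suc i)) \<longleftrightarrow>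
    R x y \<and> (\<forall>i. Suc i < length (y # p) \<longrightarrow> R ((y # p) ! i) ((y # p) ! Suc i))" for R
    by (auto simp: less_Suc_eq_0_disj nth_Cons')
  show ?thesis unfolding gpath_def *[of "\<lambda>a b. {a, b} \<in> edges G"] by auto
qed

lemma gpath_induct [consumes 1, case_names single step]:
  assumes "gpath G u p v"
    and "\<And>u. u \<in> verts G \<Longrightarrow> u = v \<Longrightarrow> P u [u]"
    and "\<And>u y p. u \<in> verts G \<Longrightarrow> {u, y} \<in> edges G \<Longrightarrow> u \<notin> set (y # p) \<Longrightarrow> gpath G y (y # p) v \<Longrightarrow>
           P y (y # p) \<Longrightarrow> P u (u # y # p)"
  shows "P u p"
  using assms(1)
proof (induction p arbitrary: u rule: induct_list012)
  case 1 then show ?case by (simp add: gpath_def)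
next
  case (2 x) then show ?case using assms(2) by (auto simp: gpath_single)
next
  case (3 x y zs)
  then have *: "x = u" "u \<in> verts G" "{u, y} \<in> edges G" "u \<notin> set (y # zs)" "gpath G y (y # zs) v"
    unfolding gpath_Cons2 by auto
  with 3(2)[OF *(5)] assms(3) show ?case by auto
qed

lemma gpath_hd: "gpath G u p v \<Longrightarrow> \<exists>p'. p = u # p'"
  by (cases p) (auto simp: gpath_def)

lemma gpath_path_edges: "gpath G u p v \<Longrightarrow> path_edges p \<subseteq> edges G"
  by (auto simp: gpath_def path_edges_def)

lemma gpath_suffix: "gpath G u p v \<Longrightarrow> x \<in> set p \<Longrightarrow> \<exists>p'. gpath G x p' v \<and> path_edges p' \<subseteq> path_edges p"
proof (induction rule: gpath_induct)
  case (single u)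
  then show ?case by (auto intro!: exI[of _ "[u]"] simp: gpath_single)
next
  case (step u y p)
  show ?case
  proof (cases "x = u")
    case True
    then show ?thesis using step by (intro exI[of _ "u # y # p"]) (auto simp: gpath_Cons2)
  next
    case False
    then show ?thesis using step by (auto simp: path_edges_Cons2)
  qed
qed

text \<open>Paths are simple, so prepending \<open>u\<close> fails when \<open>p\<close> already
  visits \<open>u\<close>; the suffix of \<open>p\<close> from \<open>u\<close> serves then. Hence
  only an inclusion of edge sets.\<close>

lemma gpath_extend:
  assumes "gpath G v p x" "{u, v} \<in> edges G" "u \<in> verts G"
  shows "\<exists>p'. gpath G u p' x \<and> path_edges p' \<subseteq> insert {u, v} (path_edges p)"
proof (cases "u \<in> set p")
  case True
  then show ?thesis using gpath_suffix[OF assms(1)] by blast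
next
  case False
  obtain p' where "p = v # p'" using gpath_hd[OF assms(1)] by blast
  then show ?thesis using False assms
    by (intro exI[of _ "u # p"]) (auto simp: gpath_Cons2 path_edges_Cons2)
qed

lemma gpath_rev: "gpath G u p v \<Longrightarrow> gpath G v (rev p) u"
  unfolding gpath_def
proof (intro conjI allI impI; (elim conjE)?)
  fix i assume *: "\<forall>i. Suc i < length p \<longrightarrow> {p ! i, p ! Suc i} \<in> edges G" and "Suc i < length (rev p)"
  then have "{p ! (length p - Suc (Suc i)), p ! Suc (length p - Suc (Suc i))} \<in> edges G" by auto
  moreover have "Suc (length p - Suc (Suc i)) = length p - Suc i" using \<open>Suc i < _\<close> by auto
  ultimately show "{rev p ! i, rev p ! Suc i} \<in> edges G" using \<open>Suc i < _\<close>
    by (simp add: rev_nth insert_commute)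
qed (auto simp: hd_rev last_rev)

lemma path_edges_rev_subset: "path_edges (rev p) \<subseteq> path_edges p"
proof
  fix e assume "e \<in> path_edges (rev p)"
  then obtain i where i: "e = {rev p ! i, rev p ! Suc i}" "Suc i < length p" by (auto simp: path_edges_def)
  then have "e = {p ! (length p - Suc (Suc i)), p ! Suc (length p - Suc (Suc i))}"
    by (simp add: rev_nth insert_commute Suc_diff_Suc)
  then show "e \<in> path_edges p" using i by (auto simp: path_edges_def)
qed

lemma path_edges_rev: "path_edges (rev p) = path_edges p"
  using path_edges_rev_subset[of p] path_edges_rev_subset[of "rev p"] by auto

lemma gpath_of_rtrancl:
  assumes "(u, v) \<in> {(x, y). {x, y} \<in> edges G \<and> x \<in> verts G}\<^sup>*" "v \<in> verts G"
  shows "\<exists>p. gpath G u p v"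
  using assms(1)
proof (induction rule: converse_rtrancl_induct)
  case base
  show ?case using assms(2) by (auto intro!: exI[of _ "[v]"] simp: gpath_single)
next
  case (step x y)
  then show ?case using gpath_extend[of G y _ v x] by auto
qed

locale graph =
  fixes G :: "'a wgraph"
  assumes wg: "weighted_graph G" and conn: "connected_graph G"
begin

abbreviation "V \<equiv> verts G"
abbreviation "d \<equiv> gdist G"
abbreviation "w \<equiv> weight G"

lemma finV: "finite V" using wg by (simp add: weighted_graph_def)

lemma edge_verts: "{u, v} \<in> edges G \<Longrightarrow> u \<in> V \<and> v \<in> V \<and> u \<noteq> v \<and> w {u, v} > 0"
  using wg unfolding weighted_graph_def by (metis doubleton_eq_iff)

lemma finE: "finite (edges G)"
proof (rule finite_subset)
  show "edges G \<subseteq> Pow V" using wg unfolding weighted_graph_def by auto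
qed (simp add: finV)

section \<open>The shortest-path metric\<close>

definition plen :: "'a list \<Rightarrow> nat" where "plen p = (\<Sum>e \<in> path_edges p. w e)"

lemma plen_single: "plen [x] = 0" by (simp add: plen_def path_edges_single)

lemma plen_Cons2: "x \<notin> set (y # p) \<Longrightarrow> plen (x # y # p) = w {x, y} + plen (y # p)"
  unfolding plen_def path_edges_Cons2
  by (subst sum.insert) (auto simp: finite_path_edges dest: path_edges_subset)

lemma d_alt: "d u v = Inf {plen p | p. gpath G u p v}"
  by (simp add: gdist_def plen_def)

lemma d_le: "gpath G u p v \<Longrightarrow> d u v \<le> plen p"
  unfolding d_alt by (rule cInf_lower) auto

lemma d_attained: "u \<in> V \<Longrightarrow> v \<in> V \<Longrightarrow> \<exists>p. gpath G u p v \<and> plen p = d u v"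
proof -
  assume "u \<in> V" "v \<in> V"
  then have "{plen p | p. gpath G u p v} \<noteq> {}" using conn by (auto simp: connected_graph_def)
  then have "Inf {plen p | p. gpath G u p v} \<in> {plen p | p. gpath G u p v}"
    by (rule Inf_nat_def1)
  then show ?thesis unfolding d_alt by auto
qed

lemma d_self: "u \<in> V \<Longrightarrow> d u u = 0"
  using d_le[of u "[u]" u] by (simp add: gpath_single plen_single)

lemma d_sym_le: "u \<in> V \<Longrightarrow> v \<in> V \<Longrightarrow> d v u \<le> d u v"
proof -
  assume "u \<in> V" "v \<in> V"
  then obtain p where "gpath G u p v" "plen p = d u v" using d_attained by blast
  then show ?thesis using d_le[OF gpath_rev] by (metis plen_def path_edges_rev)
qed

lemma d_sym: "u \<in> V \<Longrightarrow> v \<in> V \<Longrightarrow> d v u = d u v"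
  using d_sym_le by (simp add: order_antisym)

lemma d_step: "{u, v} \<in> edges G \<Longrightarrow> x \<in> V \<Longrightarrow> d u x \<le> w {u, v} + d v x"
proof -
  assume e: "{u, v} \<in> edges G" and x: "x \<in> V"
  with edge_verts obtain p where p: "gpath G v p x" "plen p = d v x" using d_attained by blast
  obtain p' where p': "gpath G u p' x" "path_edges p' \<subseteq> insert {u, v} (path_edges p)"
    using gpath_extend[OF p(1) e] edge_verts[OF e] by auto
  have "d u x \<le> plen p'" using d_le p' by blast
  also have "\<dots> \<le> (\<Sum>e \<in> insert {u, v} (path_edges p). w e)"
    unfolding plen_def by (rule sum_mono2) (auto simp: finite_path_edges p')
  also have "\<dots> \<le> w {u, v} + plen p"
    unfolding plen_def by (subst sum.insert_if) (auto simp: finite_path_edges)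
  finally show ?thesis by (simp add: p)
qed

text \<open>Induction along a shortest path from \<open>u\<close> to \<open>v\<close> with
  \<open>d_step\<close>, which avoids concatenating simple paths.\<close>

lemma d_tri: "u \<in> V \<Longrightarrow> v \<in> V \<Longrightarrow> x \<in> V \<Longrightarrow> d u x \<le> d u v + d v x"
proof -
  assume *: "u \<in> V" "v \<in> V" "x \<in> V"
  have "gpath G u p v \<Longrightarrow> d u x \<le> plen p + d v x" for p
  proof (induction rule: gpath_induct)
    case (single u) then show ?case by (simp add: plen_single)
  next
    case (step u y p)
    then show ?case using d_step[of u y x] * by (simp add: plen_Cons2)
  qed
  then show ?thesis using d_attained[OF *(1,2)] by metis
qed

lemma d_edge: "{u, v} \<in> edges G \<Longrightarrow> d u v \<le> w {u, v}"
  using d_step[of u v v] edge_verts[of u v] d_self[of v] by auto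

lemma d_next:
  assumes "u \<in> V" "v \<in> V" "u \<noteq> v"
  shows "\<exists>y. {u, y} \<in> edges G \<and> w {u, y} + d y v = d u v"
proof -
  obtain p where p: "gpath G u p v" "plen p = d u v" using d_attained[OF assms(1,2)] by auto
  obtain p' where p': "p = u # p'" using gpath_hd[OF p(1)] by auto
  show ?thesis
  proof (cases p')
    case Nil then show ?thesis using p p' assms by (simp add: gpath_single)
  next
    case (Cons y p'')
    then have "gpath G u (u # y # p'') v" using p p' by simp
    then have e: "{u, y} \<in> edges G" "u \<notin> set (y # p'')" "gpath G y (y # p'') v" by (auto simp: gpath_Cons2)
    then have "d u v = w {u, y} + plen (y # p'')" using p p' Cons plen_Cons2[of u y p''] by auto
    moreover have "d y v \<le> plen (y # p'')" using d_le e by blast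
    moreover have "d u v \<le> w {u, y} + d y v" using d_step e assms by blast
    ultimately show ?thesis using e by (intro exI[of _ y]) auto
  qed
qed

lemma d_pos: "u \<in> V \<Longrightarrow> v \<in> V \<Longrightarrow> u \<noteq> v \<Longrightarrow> d u v > 0"
  using d_next[of u v] edge_verts by fastforce

lemma d_le_diam: "u \<in> V \<Longrightarrow> v \<in> V \<Longrightarrow> d u v \<le> gdiameter G"
  unfolding gdiameter_def
proof (rule Max_ge)
  have "{d u v |u v. u \<in> V \<and> v \<in> V} = (\<lambda>(u, v). d u v) ` (V \<times> V)" by auto
  then show "finite {d u v |u v. u \<in> V \<and> v \<in> V}" by (simp add: finV)
qed auto

section \<open>Packing bounds from the doubling property\<close>

lemma doubling_iterate:
  assumes "doubling_bound G \<rho>" "u \<in> V" "R \<ge> 0"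
  shows "\<exists>C \<subseteq> V. real (card C) \<le> (2 powr \<rho>) ^ m \<and> nbhd G u R \<subseteq> (\<Union>v \<in> C. nbhd G v (R / 2 ^ m))"
proof (induction m)
  case 0
  then show ?case using assms by (intro exI[of _ "{u}"]) auto
next
  case (Suc m)
  then obtain C where C: "C \<subseteq> V" "real (card C) \<le> (2 powr \<rho>) ^ m"
    "nbhd G u R \<subseteq> (\<Union>v \<in> C. nbhd G v (R / 2 ^ m))" by blast
  have "\<forall>v\<in>C. \<exists>C' \<subseteq> V. real (card C') \<le> 2 powr \<rho> \<and> nbhd G v (R / 2 ^ m) \<subseteq> (\<Union>v \<in> C'. nbhd G v (R / 2 ^ m / 2))"
    using assms C(1) unfolding doubling_bound_def by (meson divide_nonneg_pos subsetD zero_less_numeral zero_less_power)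
  then obtain F where F: "\<And>v. v \<in> C \<Longrightarrow> F v \<subseteq> V" "\<And>v. v \<in> C \<Longrightarrow> real (card (F v)) \<le> 2 powr \<rho>"
    "\<And>v. v \<in> C \<Longrightarrow> nbhd G v (R / 2 ^ m) \<subseteq> (\<Union>v \<in> F v. nbhd G v (R / 2 ^ m / 2))"
    by metis
  have fC: "finite C" using C(1) finV finite_subset by blast
  show ?case
  proof (intro exI[of _ "\<Union>(F ` C)"] conjI)
    show "\<Union>(F ` C) \<subseteq> V" using F(1) by auto
    have "real (card (\<Union>(F ` C))) \<le> real (\<Sum>v\<in>C. card (F v))"
      by (rule of_nat_mono) (rule card_UN_le[OF fC])
    also have "\<dots> = (\<Sum>v\<in>C. real (card (F v)))" by simp
    also have "\<dots> \<le> real (card C) * 2 powr \<rho>" using sum_bounded_above[of C "\<lambda>v. real (card (F v))"] F(2) by simp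
    also have "\<dots> \<le> (2 powr \<rho>) ^ m * 2 powr \<rho>" using C(2) by (intro mult_right_mono) auto
    finally show "real (card (\<Union>(F ` C))) \<le> (2 powr \<rho>) ^ Suc m" by (simp add: mult.commute)
    have "R / 2 ^ m / 2 = R / 2 ^ Suc m" by simp
    with F(3) have "nbhd G v (R / 2 ^ m) \<subseteq> (\<Union>v \<in> F v. nbhd G v (R / 2 ^ Suc m))" if "v \<in> C" for v
      using that by (simp only:)
    then have "(\<Union>v \<in> C. nbhd G v (R / 2 ^ m)) \<subseteq> (\<Union>v \<in> C. \<Union>u \<in> F v. nbhd G u (R / 2 ^ Suc m))"
      by (rule UN_mono[OF order_refl])
    with C(3) show "nbhd G u R \<subseteq> (\<Union>v\<in>\<Union>(F ` C). nbhd G v (R / 2 ^ Suc m))"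
      unfolding UN_UN_flatten by (rule order_trans)
  qed
qed

text \<open>After \<open>m\<close> halvings the covering balls have radius \<open>R / 2 ^ m\<close>.
  Two points in one of them are at distance at most \<open>2 * R / 2 ^ m\<close>, so each ball
  accounts for at most one point of \<open>X\<close>.\<close>

lemma packing:
  assumes "doubling_bound G \<rho>" "u \<in> V" "X \<subseteq> V" "\<And>x. x \<in> X \<Longrightarrow> d u x \<le> R"
    and "\<And>x y. x \<in> X \<Longrightarrow> y \<in> X \<Longrightarrow> x \<noteq> y \<Longrightarrow> 2 * R < 2 ^ m * d x y"
  shows "real (card X) \<le> (2 powr \<rho>) ^ m"
proof -
  obtain C where C: "C \<subseteq> V" "real (card C) \<le> (2 powr \<rho>) ^ m"
    "nbhd G u (real R) \<subseteq> (\<Union>v \<in> C. nbhd G v (real R / 2 ^ m))"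
    using doubling_iterate[OF assms(1,2), of "real R" m] by auto
  have "\<forall>x\<in>X. \<exists>c\<in>C. real (d c x) \<le> real R / 2 ^ m"
  proof
    fix x assume "x \<in> X"
    then have "x \<in> nbhd G u (real R)" using assms(3,4) by (auto simp: nbhd_def)
    then show "\<exists>c\<in>C. real (d c x) \<le> real R / 2 ^ m" using C(3) by (auto simp: nbhd_def)
  qed
  then obtain g where g: "\<And>x. x \<in> X \<Longrightarrow> g x \<in> C" "\<And>x. x \<in> X \<Longrightarrow> real (d (g x) x) \<le> real R / 2 ^ m"
    by metis
  have "inj_on g X"
  proof (rule inj_onI, rule ccontr)
    fix x y assume xy: "x \<in> X" "y \<in> X" "g x = g y" "x \<noteq> y"
    have V: "x \<in> V" "y \<in> V" "g x \<in> V" using xy assms(3) g(1) C(1) by auto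
    have "d x y \<le> d x (g x) + d (g x) y" using d_tri V by blast
    then have "real (d x y) \<le> real (d (g x) x) + real (d (g y) y)"
      using d_sym[of x "g x"] V xy by simp
    also have "\<dots> \<le> 2 * (real R / 2 ^ m)" using g(2)[OF xy(1)] g(2)[OF xy(2)] by simp
    finally have "2 ^ m * real (d x y) \<le> 2 * real R" by (simp add: field_simps)
    moreover have "real (2 * R) < real (2 ^ m * d x y)"
      using assms(5)[OF xy(1,2,4)] by (simp only: of_nat_less_iff)
    ultimately show False by simp
  qed
  then have "card X \<le> card C"
    using g(1) C(1) finV by (intro card_inj_on_le[of g]) (auto intro: finite_subset)
  then show ?thesis using C(2) by linarith
qed

end

section \<open>Lower bounds for fusion schemes\<close>

lemma fusion_nonneg: "canonical_fusion f \<Longrightarrow> f k \<ge> 0" by (simp add: canonical_fusion_def)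

lemma fusion_mono: "canonical_fusion f \<Longrightarrow> j \<le> k \<Longrightarrow> f j \<le> f k"
  by (simp add: canonical_fusion_def mono_def)

lemma fusion_increment:
  assumes "canonical_fusion f"
  shows "f (Suc (a + b)) - f (a + b) \<le> f (Suc b) - f b"
proof (induction a)
  case (Suc a)
  have "f (Suc (Suc (a + b))) - f (Suc (a + b)) \<le> f (Suc (a + b)) - f (a + b)"
    using assms unfolding canonical_fusion_def by blast
  with Suc show ?case by simp
qed simp

lemma fusion_subadditive:
  assumes "canonical_fusion f"
  shows "f (a + b) \<le> f a + f b"
proof (induction b)
  case 0
  show ?case using fusion_nonneg[OF assms] by simp
next
  case (Suc b)
  then show ?case using fusion_increment[OF assms, of a b] by simp
qed

text \<open>Concavity and \<open>f 0 = 0\<close> make \<open>f k / k\<close> non-increasing; the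
  product form includes the argument 0.\<close>

lemma fusion_star:
  assumes f: "canonical_fusion f" and "l \<le> a"
  shows "real l * f a \<le> real a * f l"
proof -
  \<comment> \<open>Increments decrease, so the newest one is at most the average
    \<open>f k / k\<close> of the earlier ones.\<close>
  have 1: "real k * (f (Suc k) - f k) \<le> f k" for k
  proof (induction k)
    case 0
    show ?case using fusion_nonneg[OF f] by simp
  next
    case (Suc k)
    have "f (Suc (Suc k)) - f (Suc k) \<le> f (Suc k) - f k" using f unfolding canonical_fusion_def by blast
    then have "real (Suc k) * (f (Suc (Suc k)) - f (Suc k)) \<le> real (Suc k) * (f (Suc k) - f k)"
      by (rule mult_left_mono) simp
    also have "\<dots> = real k * (f (Suc k) - f k) + (f (Suc k) - f k)" by (simp add: algebra_simps)
    finally show ?case using Suc by linarith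
  qed
  show ?thesis using \<open>l \<le> a\<close>
  proof (induction a rule: dec_induct)
    case base
    show ?case by simp
  next
    case (step a)
    show ?case
    proof (cases "a = 0")
      case True
      then show ?thesis using step fusion_nonneg[OF f] by simp
    next
      case False
      have "real a * (real l * f (Suc a)) = real l * (real a * f (Suc a))" by simp
      also have "\<dots> \<le> real l * (real (Suc a) * f a)"
        using 1[of a] by (intro mult_left_mono) (auto simp: algebra_simps)
      also have "\<dots> = real (Suc a) * (real l * f a)" by simp
      also have "\<dots> \<le> real (Suc a) * (real a * f l)" using step by (intro mult_left_mono) auto
      also have "\<dots> = real a * (real (Suc a) * f l)" by simp
      finally show ?thesis using False by simp
    qed
  qed
qed

lemma fusion_UN:
  assumes f: "canonical_fusion f" and "finite I" "\<And>i. i \<in> I \<Longrightarrow> finite (B i)"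
  shows "f (card (\<Union>i\<in>I. B i)) \<le> (\<Sum>i\<in>I. f (card (B i)))"
  using assms(2,3)
proof (induction I rule: finite_induct)
  case empty
  then show ?case using f by (simp add: canonical_fusion_def)
next
  case (insert i I)
  have "f (card (\<Union>i\<in>insert i I. B i)) \<le> f (card (B i) + card (\<Union>i\<in>I. B i))"
    using card_Un_le[of "B i" "\<Union>i\<in>I. B i"] by (intro fusion_mono[OF f]) simp
  also have "\<dots> \<le> f (card (B i)) + f (card (\<Union>i\<in>I. B i))" by (rule fusion_subadditive[OF f])
  finally show ?case using insert by simp
qed

lemma fusion_cover:
  assumes f: "canonical_fusion f" and "finite I" "\<And>i. i \<in> I \<Longrightarrow> finite (B i)" "X \<subseteq> (\<Union>i\<in>I. B i)"
  shows "f (card X) \<le> (\<Sum>i\<in>I. f (card (B i)))"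
proof -
  have "finite (\<Union>i\<in>I. B i)" using assms(2,3) by blast
  then have "f (card X) \<le> f (card (\<Union>i\<in>I. B i))" by (intro fusion_mono[OF f] card_mono assms(4))
  also have "\<dots> \<le> (\<Sum>i\<in>I. f (card (B i)))" using assms(2,3) by (rule fusion_UN[OF f])
  finally show ?thesis .
qed

context graph
begin

text \<open>A 1-Lipschitz test function, constant outside the ball of radius \<open>R\<close> around
  \<open>q\<close>. Summing its jumps along paths bounds the cost of an arbitrary routing without
  any structure on the paths.\<close>

definition cap :: "nat \<Rightarrow> 'a \<Rightarrow> 'a \<Rightarrow> nat" where "cap R q x = min (d x q) R"

definition variation :: "nat \<Rightarrow> 'a \<Rightarrow> 'a set \<Rightarrow> nat" where
  "variation R q e = Max (cap R q ` e) - Min (cap R q ` e)"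

lemma variation_pair: "variation R q {x, y} = max (cap R q x) (cap R q y) - min (cap R q x) (cap R q y)"
  by (simp add: variation_def)

lemma cap_le_variation: "gpath G u p v \<Longrightarrow> cap R q v \<le> cap R q u + (\<Sum>e\<in>path_edges p. variation R q e)"
proof (induction rule: gpath_induct)
  case (single u)
  then show ?case by simp
next
  case (step u y p)
  have "(\<Sum>e\<in>path_edges (u # y # p). variation R q e)
      = variation R q {u, y} + (\<Sum>e\<in>path_edges (y # p). variation R q e)"
    unfolding path_edges_Cons2 using step(3)
    by (subst sum.insert) (auto simp: finite_path_edges dest: path_edges_subset)
  then show ?case using step(5) by (simp add: variation_pair)
qed

text \<open>Only centres within \<open>R\<close> of an endpoint see a jump at \<open>e\<close>: at
  most \<open>K\<close> for each of the two endpoints, and each jump is at most \<open>w e\<close>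
  by the triangle inequality.\<close>

lemma sum_variation_le:
  assumes Q: "Q \<subseteq> V" and K: "\<And>x. x \<in> V \<Longrightarrow> real (card {q \<in> Q. d x q < R}) \<le> K"
    and e: "e \<in> edges G"
  shows "(\<Sum>q\<in>Q. real (variation R q e)) \<le> 2 * K * w e"
proof -
  have "\<exists>u\<in>V. \<exists>v\<in>V. u \<noteq> v \<and> e = {u, v}" using wg e by (simp add: weighted_graph_def)
  then obtain x y where xy: "x \<in> V" "y \<in> V" "e = {x, y}" by auto
  have fQ: "finite Q" using Q finV finite_subset by blast
  let ?Q = "{q \<in> Q. d x q < R} \<union> {q \<in> Q. d y q < R}"
  have le: "variation R q e \<le> w e" if "q \<in> Q" for q
  proof -
    have "d x q \<le> w e + d y q" "d y q \<le> w e + d x q"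
      using d_step[of x y q] d_step[of y x q] that Q e xy by (auto simp: insert_commute)
    then show ?thesis by (auto simp: xy variation_pair cap_def)
  qed
  have 0: "variation R q e = 0" if "q \<in> Q - ?Q" for q
    using that by (auto simp: xy variation_pair cap_def)
  have "(\<Sum>q\<in>Q. real (variation R q e)) = (\<Sum>q\<in>?Q. real (variation R q e))"
    by (rule sum.mono_neutral_right) (use fQ 0 in auto)
  also have "\<dots> \<le> real (card ?Q) * w e" using le sum_bounded_above[of ?Q "\<lambda>q. real (variation R q e)" "w e"] by auto
  also have "\<dots> \<le> (2 * K) * w e"
  proof (rule mult_right_mono)
    have "card ?Q \<le> card {q \<in> Q. d x q < R} + card {q \<in> Q. d y q < R}" by (rule card_Un_le)
    then show "real (card ?Q) \<le> 2 * K" using K[OF xy(1)] K[OF xy(2)] by linarith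
  qed simp
  finally show ?thesis by simp
qed

text \<open>The items of a cell far from the sink have to leave the ball of radius \<open>R\<close> around its
  centre, so by concavity each cell pays within that ball for half the radius at its full load.\<close>

lemma routing_cost_ge:
  assumes f: "canonical_fusion f" and A: "A \<subseteq> V" and P: "routing G s A P"
    and Q: "Q \<subseteq> V" "\<And>q. q \<in> Q \<Longrightarrow> R \<le> d s q"
    and K: "\<And>x. x \<in> V \<Longrightarrow> real (card {q \<in> Q. d x q < R}) \<le> K"
  shows "real R / 2 * (\<Sum>q\<in>Q. f (card {v \<in> A. 2 * d v q \<le> R})) \<le> 2 * K * routing_cost G f A P"
proof -
  define ld where "ld e = card {a \<in> A. e \<in> path_edges (P a)}" for e
  define B where "B q = {v \<in> A. 2 * d v q \<le> R}" for q
  have fA: "finite A" using A finV finite_subset by blast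
  have fB: "finite (B q)" for q using fA by (simp add: B_def)
  have one: "real R / 2 * f (card (B q)) \<le> (\<Sum>e\<in>edges G. real (variation R q e) * f (ld e))" if "q \<in> Q" for q
  proof (cases "B q = {}")
    case True
    then show ?thesis using f fusion_nonneg[OF f] by (auto simp: canonical_fusion_def intro!: sum_nonneg)
  next
    case False
    define lq where "lq e = card {a \<in> B q. e \<in> path_edges (P a)}" for e
    have lq_le: "lq e \<le> card (B q)" for e unfolding lq_def by (rule card_mono) (auto simp: fB)
    have lq_ld: "lq e \<le> ld e" for e unfolding lq_def ld_def by (rule card_mono) (auto simp: fA B_def)
    have "real R / 2 * real (card (B q)) = (\<Sum>a\<in>B q. real R / 2)" by simp
    also have "\<dots> \<le> (\<Sum>a\<in>B q. \<Sum>e\<in>path_edges (P a). real (variation R q e))"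
    proof (rule sum_mono)
      \<comment> \<open>Along the path of \<open>a\<close> the capped distance rises from at most
        \<open>R / 2\<close> to \<open>R\<close>, its value at the sink because
        \<open>R \<le> d s q\<close>.\<close>
      fix a assume a: "a \<in> B q"
      then have "gpath G a (P a) s" using P by (auto simp: routing_def B_def)
      from cap_le_variation[OF this, of R q]
      have "R \<le> d a q + (\<Sum>e\<in>path_edges (P a). variation R q e)"
        using Q(2)[OF that] by (simp add: cap_def)
      moreover have "2 * d a q \<le> R" using a by (simp add: B_def)
      ultimately have "R \<le> 2 * (\<Sum>e\<in>path_edges (P a). variation R q e)" by linarith
      then have "real R \<le> real (2 * (\<Sum>e\<in>path_edges (P a). variation R q e))" by (simp only: of_nat_le_iff)
      then show "real R / 2 \<le> (\<Sum>e\<in>path_edges (P a). real (variation R q e))" by simp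
    qed
    also have "\<dots> = (\<Sum>a\<in>B q. \<Sum>e\<in>edges G. if e \<in> path_edges (P a) then real (variation R q e) else 0)"
    proof (rule sum.cong)
      fix a assume a: "a \<in> B q"
      then have "path_edges (P a) \<subseteq> edges G" using P gpath_path_edges by (fastforce simp: routing_def B_def)
      then have "edges G \<inter> path_edges (P a) = path_edges (P a)" by auto
      then show "(\<Sum>e\<in>path_edges (P a). real (variation R q e)) = (\<Sum>e\<in>edges G. if e \<in> path_edges (P a) then real (variation R q e) else 0)"
        by (simp add: sum.inter_restrict[OF finE, symmetric])
    qed simp
    also have "\<dots> = (\<Sum>e\<in>edges G. \<Sum>a\<in>B q. if e \<in> path_edges (P a) then real (variation R q e) else 0)"
      by (rule sum.swap)
    also have "\<dots> = (\<Sum>e\<in>edges G. real (variation R q e) * real (lq e))"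
      by (simp add: sum.If_cases fB lq_def Int_def mult.commute)
    finally have "real R / 2 * real (card (B q)) \<le> (\<Sum>e\<in>edges G. real (variation R q e) * real (lq e))" .
    \<comment> \<open>Multiplying by \<open>f (card (B q))\<close> lets \<open>fusion_star\<close>
      trade the linear load \<open>lq e\<close> for \<open>f (lq e)\<close>; the factor
      \<open>card (B q)\<close> that appears is cancelled at the end.\<close>
    then have "real R / 2 * real (card (B q)) * f (card (B q))
        \<le> (\<Sum>e\<in>edges G. real (variation R q e) * real (lq e)) * f (card (B q))"
      by (rule mult_right_mono) (rule fusion_nonneg[OF f])
    also have "\<dots> = (\<Sum>e\<in>edges G. real (variation R q e) * (real (lq e) * f (card (B q))))"
      by (simp add: sum_distrib_right mult.assoc)
    also have "\<dots> \<le> (\<Sum>e\<in>edges G. real (variation R q e) * (real (card (B q)) * f (ld e)))"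
    proof (intro sum_mono mult_left_mono)
      fix e
      have "real (lq e) * f (card (B q)) \<le> real (card (B q)) * f (lq e)" by (rule fusion_star[OF f lq_le])
      also have "\<dots> \<le> real (card (B q)) * f (ld e)" by (intro mult_left_mono fusion_mono[OF f lq_ld]) simp
      finally show "real (lq e) * f (card (B q)) \<le> real (card (B q)) * f (ld e)" .
    qed simp
    also have "\<dots> = real (card (B q)) * (\<Sum>e\<in>edges G. real (variation R q e) * f (ld e))"
      by (simp add: sum_distrib_left mult_ac)
    finally have "real (card (B q)) * (real R / 2 * f (card (B q)))
        \<le> real (card (B q)) * (\<Sum>e\<in>edges G. real (variation R q e) * f (ld e))"
      by (simp add: mult_ac)
    moreover have "0 < real (card (B q))" using False fB by (simp add: card_gt_0_iff)
    ultimately show ?thesis by (simp only: mult_le_cancel_left_pos)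
  qed
  have "real R / 2 * (\<Sum>q\<in>Q. f (card (B q))) = (\<Sum>q\<in>Q. real R / 2 * f (card (B q)))"
    by (rule sum_distrib_left)
  also have "\<dots> \<le> (\<Sum>q\<in>Q. \<Sum>e\<in>edges G. real (variation R q e) * f (ld e))"
    by (rule sum_mono) (rule one)
  also have "\<dots> = (\<Sum>e\<in>edges G. (\<Sum>q\<in>Q. real (variation R q e)) * f (ld e))"
    by (subst sum.swap) (simp add: sum_distrib_right)
  also have "\<dots> \<le> (\<Sum>e\<in>edges G. (2 * K * w e) * f (ld e))"
    by (intro sum_mono mult_right_mono fusion_nonneg[OF f] sum_variation_le[OF Q(1) K])
  also have "\<dots> = 2 * K * routing_cost G f A P"
    by (simp add: routing_cost_def ld_def sum_distrib_left mult_ac)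
  finally show ?thesis by (simp add: B_def)
qed

lemma opt_cost_ge:
  assumes "canonical_fusion f" "A \<subseteq> V" "s \<in> V"
    and "Q \<subseteq> V" "\<And>q. q \<in> Q \<Longrightarrow> R \<le> d s q"
    and "\<And>x. x \<in> V \<Longrightarrow> real (card {q \<in> Q. d x q < R}) \<le> K" and "K > 0"
  shows "real R / 2 * (\<Sum>q\<in>Q. f (card {v \<in> A. 2 * d v q \<le> R})) \<le> 2 * K * opt_cost G s f A"
proof -
  let ?L = "real R / 2 * (\<Sum>q\<in>Q. f (card {v \<in> A. 2 * d v q \<le> R}))"
  have "\<forall>a\<in>A. \<exists>p. gpath G a p s" using conn assms(2,3) by (auto simp: connected_graph_def)
  then obtain P where "routing G s A P" unfolding routing_def by metis
  then have "{routing_cost G f A P | P. routing G s A P} \<noteq> {}" by auto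
  moreover have "?L / (2 * K) \<le> c" if "c \<in> {routing_cost G f A P | P. routing G s A P}" for c
    using that routing_cost_ge[OF assms(1,2) _ assms(4-6)] \<open>K > 0\<close> by (auto simp: field_simps)
  ultimately have "?L / (2 * K) \<le> opt_cost G s f A" unfolding opt_cost_def by (rule cInf_greatest)
  then show ?thesis using \<open>K > 0\<close> by (simp add: field_simps)
qed

end

section \<open>Trees given by parent pointers\<close>

text \<open>The strictly decreasing \<open>rank\<close> certifies that every pointer walk ends at
  \<open>s\<close>; nothing is asked of \<open>par\<close> at \<open>s\<close> itself.\<close>

locale parent_pointers = graph +
  fixes s :: 'a and par :: "'a \<Rightarrow> 'a" and rank :: "'a \<Rightarrow> nat"
  assumes sV: "s \<in> V"
    and par_edge: "\<And>u. u \<in> V \<Longrightarrow> u \<noteq> s \<Longrightarrow> {u, par u} \<in> edges G"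
    and rank_par: "\<And>u. u \<in> V \<Longrightarrow> u \<noteq> s \<Longrightarrow> rank (par u) < rank u"
begin

definition T :: "'a set set" where "T = (\<lambda>u. {u, par u}) ` (V - {s})"

text \<open>The source \<open>v\<close> is fixed and the second argument moves towards the root, so
  inductions follow a root path from its source.\<close>

inductive anc :: "'a \<Rightarrow> 'a \<Rightarrow> bool" for v where
  anc_refl: "anc v v"
| anc_par: "anc v u \<Longrightarrow> u \<noteq> s \<Longrightarrow> anc v (par u)"

lemma par_V: "u \<in> V \<Longrightarrow> u \<noteq> s \<Longrightarrow> par u \<in> V"
  using par_edge edge_verts by blast

lemma anc_V: "anc v u \<Longrightarrow> v \<in> V \<Longrightarrow> u \<in> V"
  by (induction rule: anc.induct) (auto simp: par_V)

lemma anc_from_par: "anc (par v) u \<Longrightarrow> v \<noteq> s \<Longrightarrow> anc v u"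
  by (induction rule: anc.induct) (auto intro: anc.intros)

lemma anc_s: "anc s u \<Longrightarrow> u = s"
  by (induction rule: anc.induct) auto

text \<open>The edge set \<open>F\<close> is left open: it is \<open>T\<close> for connectedness and
  \<open>T\<close> without one edge for the nodes below that edge.\<close>

lemma path_to_root:
  assumes "v \<in> V" "\<And>x. anc v x \<Longrightarrow> x \<noteq> s \<Longrightarrow> {x, par x} \<in> F"
  shows "(v, s) \<in> {(x, y). {x, y} \<in> F \<and> x \<in> V}\<^sup>*"
  using assms
proof (induction "rank v" arbitrary: v rule: less_induct)
  case less
  show ?case
  proof (cases "v = s")
    case False
    have "(par v, s) \<in> {(x, y). {x, y} \<in> F \<and> x \<in> V}\<^sup>*"
      using less.prems False by (intro less.hyps rank_par par_V) (auto intro: anc_from_par)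
    moreover have "{v, par v} \<in> F" using less.prems(2)[OF anc_refl False] .
    ultimately show ?thesis using less.prems(1)
      by (intro converse_rtrancl_into_rtrancl[of v "par v"]) auto
  qed simp
qed

lemma T_subset: "T \<subseteq> edges G" using par_edge by (auto simp: T_def)

lemma T_edge: "{x, y} \<in> T \<Longrightarrow> y = par x \<and> rank y < rank x \<or> x = par y \<and> rank x < rank y"
  using rank_par by (auto simp: T_def doubleton_eq_iff)

lemma T_connected: "connected_graph (G\<lparr>edges := T\<rparr>)"
proof -
  let ?R = "{(x, y). {x, y} \<in> T \<and> x \<in> V}"
  have "sym ?R" using T_subset edge_verts by (intro symI) (auto simp: insert_commute)
  then have sym: "sym (?R\<^sup>*)" by (rule sym_rtrancl)
  have root: "(v, s) \<in> ?R\<^sup>*" if "v \<in> V" for v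
    using that by (intro path_to_root) (auto simp: T_def dest: anc_V)
  show ?thesis unfolding connected_graph_def
  proof (intro ballI)
    fix u v assume "u \<in> verts (G\<lparr>edges := T\<rparr>)" "v \<in> verts (G\<lparr>edges := T\<rparr>)"
    then have uv: "u \<in> V" "v \<in> V" by auto
    have "(s, v) \<in> ?R\<^sup>*" using root[OF uv(2)] sym by (meson symD)
    with root[OF uv(1)] have "(u, v) \<in> ?R\<^sup>*" by (rule rtrancl_trans)
    then show "\<exists>p. gpath (G\<lparr>edges := T\<rparr>) u p v" using gpath_of_rtrancl[of u v "G\<lparr>edges := T\<rparr>"] uv by simp
  qed
qed

text \<open>On a cycle, a node of maximal rank could only be joined to its parent, yet its two
  cyclic neighbours \<open>a\<close> and \<open>b\<close> are different nodes.\<close>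

lemma T_acyclic: "\<not> has_cycle (G\<lparr>edges := T\<rparr>)"
proof
  assume "has_cycle (G\<lparr>edges := T\<rparr>)"
  then obtain u p v where p: "gpath (G\<lparr>edges := T\<rparr>) u p v" "length p \<ge> 3" "{v, u} \<in> T"
    by (auto simp: has_cycle_def)
  let ?n = "length p"
  have step: "{p ! i, p ! (Suc i mod ?n)} \<in> T" if "i < ?n" for i
  proof (cases "Suc i = ?n")
    case True
    then have "i = ?n - 1" by simp
    then have "p ! i = v" "p ! 0 = u" using p
      by (auto simp: gpath_def hd_conv_nth last_conv_nth)
    then show ?thesis using True p by simp
  next
    case False
    then show ?thesis using p that by (simp add: gpath_def)
  qed
  have "finite (rank ` set p)" "rank ` set p \<noteq> {}" using p by (auto simp: gpath_def)
  then have "Max (rank ` set p) \<in> rank ` set p" by (rule Max_in)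
  then obtain x where x: "x \<in> set p" "rank x = Max (rank ` set p)" by auto
  then obtain j where j: "j < ?n" "x = p ! j" by (auto simp: in_set_conv_nth)
  have top: "y = par x" if "{x, y} \<in> T" "y \<in> set p" for y
  proof -
    have "rank y \<le> rank x" using that x by simp
    then show ?thesis using T_edge[OF that(1)] by auto
  qed
  define a where "a = Suc j mod ?n"
  define b where "b = (j + (?n - 1)) mod ?n"
  have ab: "a < ?n" "b < ?n" using p(2) unfolding a_def b_def by (auto intro!: mod_less_divisor)
  have "Suc b mod ?n = j"
  proof -
    have "Suc b mod ?n = Suc (j + (?n - 1)) mod ?n" by (simp add: b_def mod_Suc_eq)
    also have "Suc (j + (?n - 1)) = j + ?n" using p(2) by simp
    finally show ?thesis using j by simp
  qed
  then have "{p ! b, x} \<in> T" using step[OF ab(2)] j by simp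
  then have 1: "p ! b = par x" using ab by (intro top) (auto simp: insert_commute)
  have 2: "p ! a = par x" using step[OF j(1)] j ab by (intro top) (auto simp: a_def)
  \<comment> \<open>This is where a cycle needs at least three nodes.\<close>
  have "a \<noteq> b"
  proof (cases "j = 0")
    case True
    then show ?thesis using p(2) by (auto simp: a_def b_def)
  next
    case False
    then have "j + (?n - 1) = (j - 1) + ?n" using p(2) by simp
    then have "b = (j - 1) mod ?n" unfolding b_def by (simp only: mod_add_self2)
    then have "b = j - 1" using j by simp
    then show ?thesis using False p(2) j by (cases "Suc j = ?n") (auto simp: a_def)
  qed
  moreover have "distinct p" using p by (simp add: gpath_def)
  ultimately show False using 1 2 ab nth_eq_iff_index_eq[of p a b] by simp
qed

lemma T_spanning: "spanning_tree G T"
  by (simp add: spanning_tree_def T_subset T_connected T_acyclic)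

text \<open>If the root path of \<open>v\<close> misses \<open>u\<close>, it survives the deletion
  of \<open>{u, par u}\<close>: an edge \<open>{x, par x}\<close> on it equals this one only if
  \<open>x = u\<close> or \<open>par x = u\<close>.\<close>

lemma below_subset:
  assumes "u \<in> V" "u \<noteq> s"
  shows "below G s T {u, par u} \<subseteq> {v \<in> V. anc v u}"
proof (rule subsetI, rule ccontr)
  fix v assume v: "v \<in> below G s T {u, par u}" "v \<notin> {v \<in> V. anc v u}"
  then have vV: "v \<in> V" "\<not> anc v u" by (auto simp: below_def)
  let ?F = "T - {{u, par u}}"
  have "(v, s) \<in> {(x, y). {x, y} \<in> ?F \<and> x \<in> V}\<^sup>*"
  proof (rule path_to_root[OF vV(1)])
    fix x assume x: "anc v x" "x \<noteq> s"
    have xV: "x \<in> V" using anc_V[OF x(1) vV(1)] .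
    have "x \<noteq> u" using x vV by auto
    moreover have "\<not> (x = par u \<and> par x = u)" using anc_par[OF x] vV by auto
    ultimately have "{x, par x} \<noteq> {u, par u}" by (auto simp: doubleton_eq_iff)
    then show "{x, par x} \<in> ?F" using xV x by (auto simp: T_def)
  qed
  then have "\<exists>p. gpath (G\<lparr>edges := ?F\<rparr>) v p s"
    using gpath_of_rtrancl[of v s "G\<lparr>edges := ?F\<rparr>"] sV by simp
  then show False using v by (simp add: below_def)
qed

lemma tree_cost_le:
  assumes f: "canonical_fusion f" and A: "A \<subseteq> V"
  shows "tree_cost G s f T A \<le> (\<Sum>u\<in>V - {s}. real (w {u, par u}) * f (card {v \<in> A. anc v u}))"
proof -
  have fA: "finite A" using A finV finite_subset by blast
  have "tree_cost G s f T A \<le> (\<Sum>u\<in>V - {s}. real (w {u, par u}) * f (card (A \<inter> below G s T {u, par u})))"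
    unfolding tree_cost_def T_def[symmetric]
    by (subst (2) T_def, rule order_trans[OF sum_image_le]) (auto simp: finV intro!: mult_nonneg_nonneg fusion_nonneg[OF f])
  also have "\<dots> \<le> (\<Sum>u\<in>V - {s}. real (w {u, par u}) * f (card {v \<in> A. anc v u}))"
    using below_subset by (intro sum_mono mult_left_mono fusion_mono[OF f] card_mono) (auto simp: fA)
  finally show ?thesis .
qed

end

section \<open>The tree of a hierarchy of nets\<close>

text \<open>\<open>e\<close> is meant as the distance to a net, so \<open>e x = 0\<close> is
  membership in it; \<open>g\<close> is the next hop towards the coarser net.\<close>

definition trail :: "'a set \<Rightarrow> ('a \<Rightarrow> nat) \<Rightarrow> ('a \<Rightarrow> 'a) \<Rightarrow> 'a set" where
  "trail U e g = {(g ^^ t) x | t x. x \<in> U \<and> e x = 0}"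

text \<open>A net appears only as the zero set of \<open>E l\<close>, which \<open>E_le\<close> and
  \<open>E_attained\<close> make the distance to it. \<open>E_less\<close> is maximality of the net,
  and \<open>h l\<close> moves one edge closer to net \<open>Suc l\<close>. By
  \<open>par_trail\<close> the highest trail through a node decides its parent.\<close>

locale hierarchy = graph +
  fixes s :: 'a and E :: "nat \<Rightarrow> 'a \<Rightarrow> nat" and h :: "nat \<Rightarrow> 'a \<Rightarrow> 'a" and L :: nat and par :: "'a \<Rightarrow> 'a"
  assumes sV: "s \<in> V"
    and E_0: "\<And>u. u \<in> V \<Longrightarrow> E 0 u = 0"
    and E_s: "\<And>l. l \<le> L \<Longrightarrow> E l s = 0"
    and E_le: "\<And>l u y. l \<le> L \<Longrightarrow> u \<in> V \<Longrightarrow> y \<in> V \<Longrightarrow> E l y = 0 \<Longrightarrow> E l u \<le> d u y"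
    and E_attained: "\<And>l u. l \<le> L \<Longrightarrow> u \<in> V \<Longrightarrow> \<exists>y\<in>V. E l y = 0 \<and> d u y = E l u"
    and E_less: "\<And>l u. l \<le> L \<Longrightarrow> u \<in> V \<Longrightarrow> E l u < 4 ^ l"
    and separated: "\<And>l x y. l \<le> L \<Longrightarrow> x \<in> V \<Longrightarrow> y \<in> V \<Longrightarrow> E l x = 0 \<Longrightarrow> E l y = 0 \<Longrightarrow> x \<noteq> y \<Longrightarrow> 4 ^ l \<le> d x y"
    and h_fix: "\<And>l u. l < L \<Longrightarrow> u \<in> V \<Longrightarrow> E (Suc l) u = 0 \<Longrightarrow> h l u = u"
    and h_edge: "\<And>l u. l < L \<Longrightarrow> u \<in> V \<Longrightarrow> E (Suc l) u \<noteq> 0 \<Longrightarrow> {u, h l u} \<in> edges G"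
    and h_weight: "\<And>l u. l < L \<Longrightarrow> u \<in> V \<Longrightarrow> E (Suc l) u \<noteq> 0 \<Longrightarrow> w {u, h l u} + E (Suc l) (h l u) = E (Suc l) u"
    and diam_less: "gdiameter G < 4 ^ L"
    and par_trail: "\<And>l u. u \<in> V \<Longrightarrow> u \<noteq> s \<Longrightarrow> l < L \<Longrightarrow> u \<in> trail V (E l) (h l) \<Longrightarrow>
      (\<And>l'. l < l' \<Longrightarrow> l' < L \<Longrightarrow> u \<notin> trail V (E l') (h l')) \<Longrightarrow> par u = h l u"
begin

abbreviation P :: "nat \<Rightarrow> 'a set" where "P l \<equiv> trail V (E l) (h l)"

definition lev :: "'a \<Rightarrow> nat" where "lev u = Max {l. l < L \<and> u \<in> P l}"

lemma h_V: "l < L \<Longrightarrow> u \<in> V \<Longrightarrow> h l u \<in> V"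
  using h_fix h_edge edge_verts by metis

lemma funpow_h_V: "l < L \<Longrightarrow> u \<in> V \<Longrightarrow> (h l ^^ t) u \<in> V"
  by (induction t) (auto simp: h_V)

lemma P_net: "x \<in> V \<Longrightarrow> E l x = 0 \<Longrightarrow> x \<in> P l"
  by (auto simp: trail_def intro!: exI[of _ 0])

lemma P_h: "u \<in> P l \<Longrightarrow> h l u \<in> P l"
proof -
  assume "u \<in> P l"
  then obtain t x where "u = (h l ^^ t) x" "x \<in> V" "E l x = 0" by (auto simp: trail_def)
  then show "h l u \<in> P l" by (auto simp: trail_def intro!: exI[of _ "Suc t"] exI[of _ x])
qed

lemma net_large:
  assumes "l \<le> L" "gdiameter G < 4 ^ l" "x \<in> V" "E l x = 0"
  shows "x = s"
proof (rule ccontr)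
  assume "x \<noteq> s"
  then have "4 ^ l \<le> d x s" using assms sV by (intro separated) (auto simp: E_s)
  also have "d x s \<le> gdiameter G" using d_le_diam assms sV by blast
  finally show False using assms by simp
qed

lemma lev:
  assumes "u \<in> V" "u \<noteq> s"
  shows "lev u < L" "u \<in> P (lev u)" "\<And>l. l < L \<Longrightarrow> u \<in> P l \<Longrightarrow> l \<le> lev u"
    "E (Suc (lev u)) u \<noteq> 0" "par u = h (lev u) u"
proof -
  have "L \<noteq> 0"
  proof
    assume "L = 0"
    then have "u = s" using net_large[of 0 u] assms diam_less E_0 by auto
    then show False using assms by simp
  qed
  then have "0 \<in> {l. l < L \<and> u \<in> P l}" using assms E_0 by (auto intro: P_net)
  then have ne: "{l. l < L \<and> u \<in> P l} \<noteq> {}" by blast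
  have fin: "finite {l. l < L \<and> u \<in> P l}" by simp
  have "lev u \<in> {l. l < L \<and> u \<in> P l}" unfolding lev_def using fin ne by (rule Max_in)
  then show 1: "lev u < L" "u \<in> P (lev u)" by auto
  show 2: "l \<le> lev u" if "l < L" "u \<in> P l" for l
    unfolding lev_def using fin that by (intro Max_ge) auto
  \<comment> \<open>A point of the net above \<open>lev u\<close> would start a trail on that level,
    against maximality of \<open>lev u\<close>; on the top level it would be the sink.\<close>
  show "E (Suc (lev u)) u \<noteq> 0"
  proof
    assume 0: "E (Suc (lev u)) u = 0"
    show False
    proof (cases "Suc (lev u) = L")
      case True
      then show False using net_large[of L u] 0 assms diam_less by auto
    next
      case False
      then have "Suc (lev u) \<le> lev u" using 0 assms 1 by (intro 2 P_net) auto
      then show False by simp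
    qed
  qed
  show "par u = h (lev u) u" using assms 1 2 by (intro par_trail) (auto dest: 2)
qed

lemma par_facts:
  assumes "u \<in> V" "u \<noteq> s"
  shows "{u, par u} \<in> edges G" "w {u, par u} + E (Suc (lev u)) (par u) = E (Suc (lev u)) u"
    "w {u, par u} > 0" "par u \<in> V"
proof -
  note l = lev[OF assms]
  show e: "{u, par u} \<in> edges G" using h_edge[OF l(1) assms(1) l(4)] l(5) by simp
  show "w {u, par u} + E (Suc (lev u)) (par u) = E (Suc (lev u)) u"
    using h_weight[OF l(1) assms(1) l(4)] l(5) by simp
  show "w {u, par u} > 0" "par u \<in> V" using edge_verts[OF e] by auto
qed

lemma lev_par: "u \<in> V \<Longrightarrow> u \<noteq> s \<Longrightarrow> par u \<noteq> s \<Longrightarrow> lev u \<le> lev (par u)"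
  using lev[of u] P_h[of u "lev u"] par_facts[of u] by (intro lev(3)) auto

text \<open>Lexicographic order on level, where higher is closer to the root, and remaining
  distance, packed into one number: \<open>4 ^ L\<close> exceeds every remaining distance, and
  \<open>Suc\<close> keeps the other nodes above the sink.\<close>

definition rank :: "'a \<Rightarrow> nat" where
  "rank u = (if u = s then 0 else Suc ((L - lev u) * 4 ^ L + E (Suc (lev u)) u))"

sublocale parent_pointers G s par rank
proof
  fix u assume u: "u \<in> V" "u \<noteq> s"
  show "{u, par u} \<in> edges G" using par_facts[OF u] by simp
  show "rank (par u) < rank u"
  proof (cases "par u = s")
    case True
    then show ?thesis using u by (simp add: rank_def)
  next
    case False
    note p = par_facts[OF u] and l = lev[OF u] and l' = lev[OF par_facts(4)[OF u] False]
    show ?thesis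
    proof (cases "lev (par u) = lev u")
      case True
      then show ?thesis using u False p by (simp add: rank_def)
    next
      case ne: False
      then have lt: "lev u < lev (par u)" using lev_par[OF u False] by simp
      have "E (Suc (lev (par u))) (par u) < 4 ^ Suc (lev (par u))" using l'(1) p by (intro E_less) auto
      also have "\<dots> \<le> 4 ^ L" using l'(1) by (intro power_increasing) auto
      finally have "(L - lev (par u)) * 4 ^ L + E (Suc (lev (par u))) (par u) < Suc (L - lev (par u)) * 4 ^ L" by simp
      also have "\<dots> \<le> (L - lev u) * 4 ^ L" using lt l'(1) by (intro mult_le_mono1) linarith
      finally show ?thesis using u False by (simp add: rank_def)
    qed
  qed
qed (rule sV)

definition S :: "nat \<Rightarrow> nat" where "S l = (\<Sum>j\<le>l. 4 ^ Suc j)"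

lemma S_eq: "3 * S l + 4 = 4 ^ (l + 2)"
  by (induction l) (auto simp: S_def)

lemma S_mono: "l \<le> l' \<Longrightarrow> S l \<le> S l'"
  unfolding S_def by (intro sum_mono2) auto

lemma S_less: "l < l' \<Longrightarrow> S l + 4 ^ Suc l' \<le> S l'"
  using S_mono[of l "l' - 1"] by (cases l') (auto simp: S_def)

text \<open>The level-\<open>l\<close> part of a root path is part of a shortest path to the next net, so it is
  shorter than \<open>4 ^ (l + 1)\<close>; levels never decrease towards the root.\<close>

lemma anc_dist:
  assumes "anc v u" "v \<in> V" "u \<noteq> s"
  shows "d v u + E (Suc (lev u)) u \<le> S (lev u)"
  using assms
proof (induction rule: anc.induct)
  case anc_refl
  have "E (Suc (lev v)) v < 4 ^ Suc (lev v)" using lev[of v] anc_refl by (intro E_less) auto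
  also have "4 ^ Suc (lev v) \<le> S (lev v)" unfolding S_def by (rule member_le_sum) auto
  finally show ?case using anc_refl by (simp add: d_self)
next
  case (anc_par u)
  have uV: "u \<in> V" using anc_V anc_par by blast
  note p = par_facts[OF uV anc_par(2)]
  have "d v (par u) \<le> d v u + d u (par u)" using anc_par uV p by (intro d_tri) auto
  also have "d u (par u) \<le> w {u, par u}" using p(1) by (rule d_edge)
  finally have 1: "d v (par u) + E (Suc (lev u)) (par u) \<le> S (lev u)"
    using anc_par.IH anc_par.prems anc_par.hyps p(2) by linarith
  show ?case
  proof (cases "lev (par u) = lev u")
    case True
    then show ?thesis using 1 by simp
  next
    case False
    then have lt: "lev u < lev (par u)" using lev_par[OF uV] anc_par by (simp add: order_less_le)
    have "E (Suc (lev (par u))) (par u) < 4 ^ Suc (lev (par u))"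
      using lev[of "par u"] anc_par p by (intro E_less) auto
    then show ?thesis using 1 S_less[OF lt] by linarith
  qed
qed

text \<open>Once a root path reaches a level that is high compared to the distance to the sink, the
  sink is the nearest point of the next net and the path heads for it directly.\<close>

lemma anc_dist_sink:
  assumes "anc v u" "v \<in> V" "6 * d v s \<le> 4 ^ (j + 2)"
  shows "d u s \<le> d v s + S j"
  using assms
proof (induction rule: anc.induct)
  case anc_refl
  then show ?case by simp
next
  case (anc_par u)
  have uV: "u \<in> V" using anc_V anc_par by blast
  note p = par_facts[OF uV anc_par(2)] and l = lev[OF uV anc_par(2)]
  have IH: "d u s \<le> d v s + S j" using anc_par by blast
  show ?case
  proof (cases "lev u \<le> j")
    case True
    have "d v (par u) \<le> d v u + d u (par u)" using anc_par uV p by (intro d_tri) auto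
    also have "d u (par u) \<le> w {u, par u}" using p(1) by (rule d_edge)
    finally have "d v (par u) \<le> S j"
      using anc_dist[OF anc_par(1,4,2)] p(2) S_mono[OF True] by linarith
    moreover have "d (par u) s \<le> d (par u) v + d v s" using anc_par p sV by (intro d_tri) auto
    moreover have "d (par u) v = d v (par u)" using anc_par p by (intro d_sym) auto
    ultimately show ?thesis by linarith
  next
    case False
    have sl: "Suc (lev u) \<le> L" using l by simp
    obtain y where y: "y \<in> V" "E (Suc (lev u)) y = 0" "d (par u) y = E (Suc (lev u)) (par u)"
      using E_attained[OF sl p(4)] by auto
    have le: "E (Suc (lev u)) u \<le> d u s" using sl uV sV by (intro E_le) (auto simp: E_s)
    have "d u y \<le> d u (par u) + d (par u) y" using uV p y by (intro d_tri) auto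
    also have "d u (par u) \<le> w {u, par u}" using p(1) by (rule d_edge)
    finally have "d u y \<le> d u s" using y le p(2) by linarith
    moreover have "d y s \<le> d y u + d u s" using y uV sV by (intro d_tri) auto
    moreover have "d y u = d u y" using y uV by (intro d_sym) auto
    ultimately have "d y s \<le> 2 * (d v s + S j)" using IH unfolding mult_2 by linarith
    \<comment> \<open>The hypothesis bounds \<open>6 * d v s\<close> by one copy of
      \<open>4 ^ (j + 2)\<close>, and \<open>S_eq\<close> bounds \<open>6 * S j\<close> by two
      copies less 8. So \<open>y\<close> is closer to the sink than two points of the net
      \<open>Suc (lev u)\<close> can be.\<close>
    moreover have "6 * d v s + 6 * S j + 8 \<le> 3 * 4 ^ (j + 2)" using anc_par.prems S_eq[of j] by linarith
    ultimately have "d y s < 4 ^ (j + 2)" unfolding distrib_left by linarith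
    also have "(4::nat) ^ (j + 2) \<le> 4 ^ Suc (lev u)" using False by (intro power_increasing) auto
    finally have "y = s" using separated[OF sl y(1) sV y(2) E_s[OF sl]] by force
    then have "d (par u) s \<le> d u s" using y p(2) le by simp
    then show ?thesis using IH by linarith
  qed
qed

text \<open>On a level up to \<open>k\<close> the whole path is short. Above \<open>k\<close>,
  \<open>anc_dist_sink\<close> with \<open>j = Suc k\<close> puts \<open>u\<close> within
  \<open>(4 + 64 / 3) * 4 ^ k\<close> of the sink, which is below \<open>28 * 4 ^ k\<close>, and the
  sink belongs to every net.\<close>

lemma anc_remaining:
  assumes "anc v u" "v \<in> V" "u \<noteq> s" "d v s < 4 ^ Suc k"
  shows "E (Suc (lev u)) u \<le> 28 * 4 ^ min (lev u) k"
proof -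
  have uV: "u \<in> V" using anc_V assms by blast
  note l = lev[OF uV assms(3)]
  show ?thesis
  proof (cases "lev u \<le> k")
    case True
    have "E (Suc (lev u)) u < 4 ^ Suc (lev u)" using l uV by (intro E_less) auto
    then show ?thesis using True by (simp add: min_absorb1)
  next
    case False
    have "E (Suc (lev u)) u \<le> d u s" using l uV sV by (intro E_le) (auto simp: E_s)
    also have "d u s \<le> d v s + S (Suc k)" using assms by (intro anc_dist_sink) auto
    finally have "3 * E (Suc (lev u)) u \<le> 3 * d v s + 3 * S (Suc k)" by linarith
    moreover have "3 * S (Suc k) + 4 = 64 * 4 ^ k" using S_eq[of "Suc k"] by simp
    moreover have "d v s < 4 * 4 ^ k" using assms by simp
    ultimately have "3 * E (Suc (lev u)) u \<le> 84 * 4 ^ k" by linarith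
    then show ?thesis using False by (simp add: min_absorb2)
  qed
qed

section \<open>The pieces of level paths used by one cell of sources\<close>

lemma funpow_h_dist:
  assumes "l < L" "x \<in> V"
  shows "d x ((h l ^^ t) x) + E (Suc l) ((h l ^^ t) x) \<le> E (Suc l) x"
proof (induction t)
  case 0
  then show ?case using assms by (simp add: d_self)
next
  case (Suc t)
  let ?u = "(h l ^^ t) x"
  have uV: "?u \<in> V" using assms by (rule funpow_h_V)
  show ?case
  proof (cases "E (Suc l) ?u = 0")
    case True
    then show ?thesis using h_fix[OF assms(1) uV] Suc by simp
  next
    case False
    have "d x (h l ?u) \<le> d x ?u + d ?u (h l ?u)" using assms uV by (intro d_tri h_V) auto
    also have "d ?u (h l ?u) \<le> w {?u, h l ?u}" using h_edge[OF assms(1) uV False] by (rule d_edge)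
    finally show ?thesis using Suc h_weight[OF assms(1) uV False] by simp
  qed
qed

text \<open>Points of the next net are excluded because \<open>h l\<close> fixes them:
  \<open>{u, h l u}\<close> is then a singleton, whose weight is arbitrary.\<close>

definition hops :: "nat \<Rightarrow> 'a \<Rightarrow> nat \<Rightarrow> 'a set" where
  "hops l x Y = {u. (\<exists>t. u = (h l ^^ t) x) \<and> E (Suc l) u \<noteq> 0 \<and> E (Suc l) u \<le> Y}"

lemma finite_hops: "l < L \<Longrightarrow> x \<in> V \<Longrightarrow> finite (hops l x Y)"
  by (rule finite_subset[OF _ finV]) (auto simp: hops_def funpow_h_V)

lemma hops_step:
  assumes "l < L" "x \<in> V" "E (Suc l) x \<noteq> 0"
  shows "hops l x Y = (if E (Suc l) x \<le> Y then insert x (hops l (h l x) Y) else hops l (h l x) Y)"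
proof -
  have "(\<exists>t. u = (h l ^^ t) x) \<longleftrightarrow> u = x \<or> (\<exists>t. u = (h l ^^ t) (h l x))" for u
  proof
    assume "\<exists>t. u = (h l ^^ t) x"
    then obtain t where "u = (h l ^^ t) x" by blast
    then show "u = x \<or> (\<exists>t. u = (h l ^^ t) (h l x))"
      by (cases t) (auto simp: funpow_Suc_right simp del: funpow.simps)
  next
    assume "u = x \<or> (\<exists>t. u = (h l ^^ t) (h l x))"
    then show "\<exists>t. u = (h l ^^ t) x"
    proof
      assume "u = x"
      then show ?thesis by (intro exI[of _ 0]) simp
    next
      assume "\<exists>t. u = (h l ^^ t) (h l x)"
      then obtain t where "u = (h l ^^ t) (h l x)" by blast
      then show ?thesis by (intro exI[of _ "Suc t"]) (simp add: funpow_Suc_right del: funpow.simps)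
    qed
  qed
  then show ?thesis using assms unfolding hops_def by auto
qed

text \<open>Each hop lowers the remaining distance by exactly its weight, so the weights telescope
  from the first remaining distance that does not exceed \<open>Y\<close>.\<close>

lemma hops_weight_le: "l < L \<Longrightarrow> x \<in> V \<Longrightarrow> (\<Sum>u\<in>hops l x Y. w {u, h l u}) \<le> min Y (E (Suc l) x)"
proof (induction "E (Suc l) x" arbitrary: x rule: less_induct)
  case less
  note x = less.prems
  show ?case
  proof (cases "E (Suc l) x = 0")
    case True
    have "(h l ^^ t) x = x" for t using h_fix[OF x True] by (induction t) auto
    then have "hops l x Y = {}" using True by (auto simp: hops_def)
    then show ?thesis by simp
  next
    case False
    note e = h_edge[OF x False] h_weight[OF x False]
    have "0 < w {x, h l x}" using edge_verts[OF e(1)] by simp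
    then have IH: "(\<Sum>u\<in>hops l (h l x) Y. w {u, h l u}) \<le> min Y (E (Suc l) (h l x))"
      using e(2) x by (intro less.hyps h_V) auto
    show ?thesis
    proof (cases "E (Suc l) x \<le> Y")
      case True
      then have "hops l x Y = insert x (hops l (h l x) Y)" using hops_step[OF x False] by simp
      then have "(\<Sum>u\<in>hops l x Y. w {u, h l u}) \<le> w {x, h l x} + (\<Sum>u\<in>hops l (h l x) Y. w {u, h l u})"
        using finite_hops[OF x(1) h_V[OF x]] by (simp add: sum.insert_if)
      then show ?thesis using IH e(2) True by simp
    next
      case F: False
      then have "hops l x Y = hops l (h l x) Y" using hops_step[OF x False] by simp
      then show ?thesis using IH e(2) by simp
    qed
  qed
qed

text \<open>The radius \<open>4 ^ min i k / 2\<close> is the cell size of \<open>opt_cost_ge\<close>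
  for \<open>R = 4 ^ min i k\<close>.\<close>

definition touched :: "nat \<Rightarrow> nat \<Rightarrow> 'a \<Rightarrow> 'a set" where
  "touched i k q = {u \<in> V - {s}. lev u = i \<and>
     (\<exists>v\<in>V. d v s < 4 ^ Suc k \<and> 2 * d v q \<le> 4 ^ min i k \<and> anc v u)}"

text \<open>A touched node lies on a walk from a point of net \<open>i\<close> at distance at most
  \<open>(1 / 2 + 16 / 3 + 4) * 4 ^ i\<close> from \<open>q\<close>, below
  \<open>12 * 4 ^ i\<close>. Points of that net are \<open>4 ^ i\<close> apart and
  \<open>2 * 12 < 2 ^ 5\<close>, whence the exponent 5.\<close>

lemma touched_weight_le:
  assumes "doubling_bound G \<rho>" "i < L" "q \<in> V"
  shows "(\<Sum>u\<in>touched i k q. real (w {u, par u})) \<le> (2 powr \<rho>) ^ 5 * (28 * 4 ^ min i k)"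
proof -
  define X where "X = {x \<in> V. E i x = 0 \<and> d q x \<le> 12 * 4 ^ i}"
  let ?Y = "28 * 4 ^ min i k :: nat"
  have fX: "finite X" using finV by (simp add: X_def)
  have card_X: "real (card X) \<le> (2 powr \<rho>) ^ 5"
  proof (rule packing[OF assms(1,3)])
    fix x y assume xy: "x \<in> X" "y \<in> X" "x \<noteq> y"
    then have "4 ^ i \<le> d x y" using assms(2) by (intro separated) (auto simp: X_def)
    moreover have "(0::nat) < 4 ^ i" by simp
    ultimately have "24 * 4 ^ i < 32 * d x y" by linarith
    then show "2 * (12 * 4 ^ i) < 2 ^ 5 * d x y" by simp
  qed (auto simp: X_def)
  have sub: "touched i k q \<subseteq> (\<Union>x\<in>X. hops i x ?Y)"
  proof
    fix u assume "u \<in> touched i k q"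
    then obtain v where u: "u \<in> V" "u \<noteq> s" "lev u = i"
      and v: "v \<in> V" "d v s < 4 ^ Suc k" "2 * d v q \<le> 4 ^ min i k" "anc v u"
      by (auto simp: touched_def)
    note l = lev[OF u(1,2)]
    obtain x t where x: "x \<in> V" "E i x = 0" "u = (h i ^^ t) x"
      using l(2) u(3) by (auto simp: trail_def)
    have "d x u \<le> E (Suc i) x" using funpow_h_dist[OF assms(2) x(1), of t] x(3) by simp
    also have "\<dots> < 4 ^ Suc i" using assms(2) x by (intro E_less) auto
    finally have 1: "d x u < 4 * 4 ^ i" by simp
    have "3 * d v u + 4 \<le> 16 * 4 ^ i" using anc_dist[OF v(4,1) u(2)] S_eq[of i] u(3) by simp
    then have 2: "3 * d v u \<le> 16 * 4 ^ i" by simp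
    have "(4::nat) ^ min i k \<le> 4 ^ i" by (intro power_increasing) auto
    then have 3: "2 * d v q \<le> 4 ^ i" using v by linarith
    have "d q x \<le> d q v + d v x" "d v x \<le> d v u + d u x" using d_tri assms(3) v u x(1) by blast+
    moreover have "d q v = d v q" "d u x = d x u" using d_sym assms(3) v u x(1) by auto
    ultimately have "6 * d q x \<le> 72 * 4 ^ i" using 1 2 3 by linarith
    then have "x \<in> X" using x by (simp add: X_def)
    moreover have "u \<in> hops i x ?Y"
      using x l u anc_remaining[OF v(4,1) u(2) v(2)] by (auto simp: hops_def)
    ultimately show "u \<in> (\<Union>x\<in>X. hops i x ?Y)" by blast
  qed
  have fin: "finite (hops i x ?Y)" if "x \<in> X" for x
    using that assms(2) by (auto simp: X_def intro: finite_hops)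
  have "(\<Sum>u\<in>touched i k q. w {u, par u}) = (\<Sum>u\<in>touched i k q. w {u, h i u})"
    by (rule sum.cong) (auto simp: touched_def lev)
  also have "\<dots> \<le> (\<Sum>u\<in>(\<Union>x\<in>X. hops i x ?Y). w {u, h i u})"
    using sub fX fin by (intro sum_mono2) auto
  also have "\<dots> \<le> (\<Sum>x\<in>X. \<Sum>u\<in>hops i x ?Y. w {u, h i u})"
    using fX fin
  proof (induction X rule: finite_induct)
    case (insert x X)
    have "(\<Sum>u\<in>(\<Union>x\<in>insert x X. hops i x ?Y). w {u, h i u})
      \<le> (\<Sum>u\<in>hops i x ?Y. w {u, h i u}) + (\<Sum>u\<in>(\<Union>x\<in>X. hops i x ?Y). w {u, h i u})"
      using insert by (simp add: sum_Un_nat)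
    then show ?case using insert by simp
  qed simp
  also have "\<dots> \<le> (\<Sum>x\<in>X. ?Y)"
    using hops_weight_le[OF assms(2)] by (intro sum_mono) (auto simp: X_def intro: order_trans)
  finally have "(\<Sum>u\<in>touched i k q. w {u, par u}) \<le> card X * ?Y" by simp
  then have "real (\<Sum>u\<in>touched i k q. w {u, par u}) \<le> real (card X * ?Y)"
    by (simp only: of_nat_le_iff)
  also have "\<dots> = real (card X) * (28 * 4 ^ min i k)" by simp
  also have "\<dots> \<le> (2 powr \<rho>) ^ 5 * (28 * 4 ^ min i k)" using card_X by (intro mult_right_mono) auto
  finally show ?thesis by simp
qed

end

text \<open>Greedy choice: a node joins unless an earlier centre covers it. The factor 2 expresses
  the radius \<open>R / 2\<close> in \<open>nat\<close>.\<close>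

lemma (in graph) maximal_separated:
  assumes "U \<subseteq> V"
  shows "\<exists>Q\<subseteq>U. (\<forall>x\<in>Q. \<forall>y\<in>Q. x \<noteq> y \<longrightarrow> R < 2 * d x y) \<and> (\<forall>v\<in>U. \<exists>q\<in>Q. 2 * d v q \<le> R)"
  using finite_subset[OF assms finV] assms
proof (induction U rule: finite_induct)
  case empty
  then show ?case by auto
next
  case (insert v U)
  then obtain Q where Q: "Q \<subseteq> U" "\<forall>x\<in>Q. \<forall>y\<in>Q. x \<noteq> y \<longrightarrow> R < 2 * d x y" "\<forall>v\<in>U. \<exists>q\<in>Q. 2 * d v q \<le> R"
    by auto
  show ?case
  proof (cases "\<exists>q\<in>Q. 2 * d v q \<le> R")
    case True
    then show ?thesis using Q by (intro exI[of _ Q]) auto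
  next
    case False
    then have 1: "R < 2 * d v q" if "q \<in> Q" for q using that by (meson not_le)
    have 2: "R < 2 * d q v" if "q \<in> Q" for q
      using 1[OF that] d_sym[of v q] that insert.prems Q(1) by auto
    have 3: "d v v = 0" using insert.prems by (simp add: d_self)
    show ?thesis
    proof (intro exI[of _ "insert v Q"] conjI)
      show "insert v Q \<subseteq> insert v U" using Q(1) by auto
      show "\<forall>x\<in>insert v Q. \<forall>y\<in>insert v Q. x \<noteq> y \<longrightarrow> R < 2 * d x y" using 1 2 Q(2) by auto
      show "\<forall>x\<in>insert v U. \<exists>q\<in>insert v Q. 2 * d x q \<le> R" using 3 Q(3) by auto
    qed
  qed
qed

section \<open>Comparison of the tree with the optimum\<close>

context hierarchy
begin

text \<open>\<open>L\<close> may be far larger than the logarithm of the diameter, since the program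
  stops by the sum of all weights. Once \<open>4 ^ l\<close> exceeds the diameter, the net is the
  sink alone and its trail never leaves the sink, so higher levels cost nothing.\<close>

lemma lev_less:
  assumes "gdiameter G < 4 ^ K" "u \<in> V" "u \<noteq> s"
  shows "lev u < K"
proof (rule ccontr)
  assume "\<not> lev u < K"
  then have "(4::nat) ^ K \<le> 4 ^ lev u" by (intro power_increasing) auto
  then have dl: "gdiameter G < 4 ^ lev u" using assms by linarith
  note l = lev[OF assms(2,3)]
  obtain x t where x: "x \<in> V" "E (lev u) x = 0" "u = (h (lev u) ^^ t) x" using l(2) by (auto simp: trail_def)
  have "x = s" using dl x l(1) by (intro net_large) auto
  moreover have "(h (lev u) ^^ t) s = s" using h_fix[OF l(1) sV] E_s[of "Suc (lev u)"] l(1) by (induction t) auto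
  ultimately show False using x assms by simp
qed

definition shell :: "nat \<Rightarrow> 'a set" where
  "shell k = {v \<in> V. 4 ^ k \<le> d v s \<and> d v s < 4 ^ Suc k}"

lemma ex_shell:
  assumes "gdiameter G < 4 ^ K" "v \<in> V" "v \<noteq> s"
  shows "\<exists>k<K. v \<in> shell k"
proof -
  have "1 \<le> d v s" using d_pos[OF assms(2) sV assms(3)] by simp
  then obtain k where k: "4 ^ k \<le> d v s" "d v s < 4 ^ (k + 1)" using ex_power_ivl1[of 4 "d v s"] by auto
  have "4 ^ k < (4::nat) ^ K" using k(1) d_le_diam[OF assms(2) sV] assms(1) by linarith
  then have "k < K" by simp
  then show ?thesis using k assms(2) by (auto simp: shell_def)
qed

text \<open>For an edge level \<open>i\<close> and a source shell \<open>k\<close>, take cells of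
  scale \<open>4 ^ min i k\<close>. Per cell the tree pays at most
  \<open>28 * (2 powr \<rho>) ^ 5\<close> times scale and load; the optimum pays half the scale, up
  to an overlap of \<open>2 * (2 powr \<rho>) ^ 2\<close>. Hence \<open>112 = 28 * 2 * 2\<close> and
  the exponent 7.\<close>

theorem tree_cost_le_opt:
  assumes db: "doubling_bound G \<rho>" and K: "gdiameter G < 4 ^ K"
    and f: "canonical_fusion f" and A: "A \<subseteq> V"
  shows "tree_cost G s f T A \<le> 112 * (2 powr \<rho>) ^ 7 * real K ^ 2 * opt_cost G s f A"
proof -
  define a where "a = 2 powr \<rho>"
  have a: "a > 0" by (simp add: a_def)
  have fA: "finite A" using A finV finite_subset by blast
  have "\<forall>k m. \<exists>Q\<subseteq>shell k. (\<forall>x\<in>Q. \<forall>y\<in>Q. x \<noteq> y \<longrightarrow> 4 ^ m < 2 * d x y) \<and> (\<forall>v\<in>shell k. \<exists>q\<in>Q. 2 * d v q \<le> 4 ^ m)"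
    by (intro allI maximal_separated) (auto simp: shell_def)
  then obtain Q where Q: "\<And>k m. Q k m \<subseteq> shell k"
    "\<And>k m x y. x \<in> Q k m \<Longrightarrow> y \<in> Q k m \<Longrightarrow> x \<noteq> y \<Longrightarrow> 4 ^ m < 2 * d x y"
    "\<And>k m v. v \<in> shell k \<Longrightarrow> \<exists>q\<in>Q k m. 2 * d v q \<le> 4 ^ m"
    by metis
  have QV: "Q k m \<subseteq> V" for k m using Q(1)[of k m] by (auto simp: shell_def)
  have fQ: "finite (Q k m)" for k m using QV finV finite_subset by blast
  define F where "F q m = f (card {v \<in> A. 2 * d v q \<le> 4 ^ m})" for q and m :: nat
  have F0: "F q m \<ge> 0" for q m unfolding F_def by (rule fusion_nonneg[OF f])
  \<comment> \<open>By \<open>m \<le> k\<close>, centres in shell \<open>k\<close> are at least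
    \<open>4 ^ m\<close> away from the sink. They are more than \<open>4 ^ m / 2\<close> apart, so
    \<open>packing\<close> with two halvings bounds the overlap.\<close>
  have opt: "4 ^ m / 2 * (\<Sum>q\<in>Q k m. F q m) \<le> 2 * a ^ 2 * opt_cost G s f A" if "m \<le> k" for k m
  proof -
    have "real (4 ^ m) / 2 * (\<Sum>q\<in>Q k m. f (card {v \<in> A. 2 * d v q \<le> 4 ^ m})) \<le> 2 * a ^ 2 * opt_cost G s f A"
    proof (rule opt_cost_ge[OF f A sV QV])
      fix q assume "q \<in> Q k m"
      then have q: "q \<in> V" "4 ^ k \<le> d q s" using Q(1)[of k m] by (auto simp: shell_def)
      have "(4::nat) ^ m \<le> 4 ^ k" using that by (intro power_increasing) auto
      then show "4 ^ m \<le> d s q" using q d_sym[OF q(1) sV] by linarith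
    next
      fix x assume x: "x \<in> V"
      show "real (card {q \<in> Q k m. d x q < 4 ^ m}) \<le> a ^ 2"
        unfolding a_def
      proof (rule packing[OF db x])
        show "2 * 4 ^ m < 2 ^ 2 * d y z" if "y \<in> {q \<in> Q k m. d x q < 4 ^ m}" "z \<in> {q \<in> Q k m. d x q < 4 ^ m}" "y \<noteq> z" for y z
          using Q(2)[of y k m z] that by simp
      qed (use QV in auto)
    qed (use a in simp)
    then show ?thesis by (simp add: F_def)
  qed
  define c where "c i k q u = (if u \<in> touched i k q then F q (min i k) else 0)" for i k q u
  \<comment> \<open>The cells that touch \<open>u\<close> cover the sources below \<open>u\<close>,
    and subadditivity splits the load among them. The cell scale depends on \<open>lev u\<close>, so
    the sum is grouped by level afterwards.\<close>
  have load: "f (card {v \<in> A. anc v u}) \<le> (\<Sum>k<K. \<Sum>q\<in>Q k (min (lev u) k). c (lev u) k q u)"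
    if u: "u \<in> V - {s}" for u
  proof -
    let ?m = "\<lambda>k. min (lev u) k"
    define J where "J k = {q \<in> Q k (?m k). u \<in> touched (lev u) k q}" for k
    define B where "B = (\<lambda>(k, q). {v \<in> A. 2 * d v q \<le> 4 ^ ?m k})"
    have "f (card {v \<in> A. anc v u}) \<le> (\<Sum>i\<in>Sigma {..<K} J. f (card (B i)))"
    proof (rule fusion_cover[OF f])
      show "finite (Sigma {..<K} J)" using fQ by (auto simp: J_def)
      show "finite (B i)" for i using fA by (auto simp: B_def split: prod.splits)
      show "{v \<in> A. anc v u} \<subseteq> \<Union> (B ` Sigma {..<K} J)"
      proof
        fix v assume v: "v \<in> {v \<in> A. anc v u}"
        then have vV: "v \<in> V" "v \<noteq> s" using A u anc_s by auto
        obtain k where k: "k < K" "v \<in> shell k" using ex_shell[OF K vV] by blast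
        obtain q where q: "q \<in> Q k (?m k)" "2 * d v q \<le> 4 ^ ?m k" using Q(3)[OF k(2)] by blast
        have "u \<in> touched (lev u) k q" using u v vV k q by (auto simp: touched_def shell_def)
        then have "(k, q) \<in> Sigma {..<K} J" "v \<in> B (k, q)" using k q v by (auto simp: J_def B_def)
        then show "v \<in> \<Union> (B ` Sigma {..<K} J)" by blast
      qed
    qed
    also have "\<dots> = (\<Sum>k<K. \<Sum>q\<in>J k. F q (?m k))"
      using fQ by (subst sum.Sigma) (auto simp: J_def B_def F_def intro: sum.cong)
    also have "\<dots> = (\<Sum>k<K. \<Sum>q\<in>Q k (?m k). c (lev u) k q u)"
      unfolding J_def c_def by (intro sum.cong refl sum.inter_filter fQ)
    finally show ?thesis .
  qed
  have "tree_cost G s f T A \<le> (\<Sum>u\<in>V - {s}. real (w {u, par u}) * f (card {v \<in> A. anc v u}))"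
    by (rule tree_cost_le[OF f A])
  also have "\<dots> \<le> (\<Sum>u\<in>V - {s}. real (w {u, par u}) * (\<Sum>k<K. \<Sum>q\<in>Q k (min (lev u) k). c (lev u) k q u))"
    by (intro sum_mono mult_left_mono load) auto
  also have "\<dots> = (\<Sum>i<K. \<Sum>u | u \<in> V - {s} \<and> lev u = i.
      real (w {u, par u}) * (\<Sum>k<K. \<Sum>q\<in>Q k (min (lev u) k). c (lev u) k q u))"
    by (rule sum.group[symmetric]) (use finV lev_less[OF K] in auto)
  also have "\<dots> = (\<Sum>i<K. \<Sum>k<K. \<Sum>q\<in>Q k (min i k). \<Sum>u | u \<in> V - {s} \<and> lev u = i. real (w {u, par u}) * c i k q u)"
  proof (rule sum.cong[OF refl])
    fix i
    let ?U = "{u. u \<in> V - {s} \<and> lev u = i}"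
    have "(\<Sum>u\<in>?U. real (w {u, par u}) * (\<Sum>k<K. \<Sum>q\<in>Q k (min (lev u) k). c (lev u) k q u))
        = (\<Sum>u\<in>?U. \<Sum>k<K. \<Sum>q\<in>Q k (min i k). real (w {u, par u}) * c i k q u)"
      by (rule sum.cong) (auto simp: sum_distrib_left)
    also have "\<dots> = (\<Sum>k<K. \<Sum>u\<in>?U. \<Sum>q\<in>Q k (min i k). real (w {u, par u}) * c i k q u)"
      by (rule sum.swap)
    also have "\<dots> = (\<Sum>k<K. \<Sum>q\<in>Q k (min i k). \<Sum>u\<in>?U. real (w {u, par u}) * c i k q u)"
      by (rule sum.cong[OF refl], rule sum.swap)
    finally show "(\<Sum>u\<in>?U. real (w {u, par u}) * (\<Sum>k<K. \<Sum>q\<in>Q k (min (lev u) k). c (lev u) k q u))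
        = (\<Sum>k<K. \<Sum>q\<in>Q k (min i k). \<Sum>u\<in>?U. real (w {u, par u}) * c i k q u)" .
  qed
  also have "\<dots> \<le> (\<Sum>i<K. \<Sum>k<K. 112 * a ^ 7 * opt_cost G s f A)"
  proof (intro sum_mono)
    fix i k
    let ?m = "min i k" and ?U = "{u. u \<in> V - {s} \<and> lev u = i}"
    have "(\<Sum>u\<in>?U. real (w {u, par u}) * c i k q u) \<le> F q ?m * (a ^ 5 * (28 * 4 ^ ?m))" if "q \<in> Q k ?m" for q
    proof -
      have "(\<Sum>u\<in>?U. real (w {u, par u}) * c i k q u) = (\<Sum>u\<in>touched i k q. real (w {u, par u}) * F q ?m)"
        by (rule sum.mono_neutral_cong_right) (use finV in \<open>auto simp: c_def touched_def\<close>)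
      also have "\<dots> = F q ?m * (\<Sum>u\<in>touched i k q. real (w {u, par u}))"
        by (simp add: sum_distrib_left mult.commute)
      also have "\<dots> \<le> F q ?m * (a ^ 5 * (28 * 4 ^ ?m))"
      proof (rule mult_left_mono[OF _ F0])
        show "(\<Sum>u\<in>touched i k q. real (w {u, par u})) \<le> a ^ 5 * (28 * 4 ^ ?m)"
        proof (cases "i < L")
          case True
          then show ?thesis using touched_weight_le[OF db True] subsetD[OF QV that] by (simp add: a_def)
        next
          case False
          then have e: "touched i k q = {}" using lev(1) by (auto simp: touched_def)
          show ?thesis unfolding e using a by simp
        qed
      qed
      finally show ?thesis .
    qed
    then have "(\<Sum>q\<in>Q k ?m. \<Sum>u\<in>?U. real (w {u, par u}) * c i k q u) \<le> (\<Sum>q\<in>Q k ?m. F q ?m * (a ^ 5 * (28 * 4 ^ ?m)))"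
      by (rule sum_mono)
    also have "\<dots> = 56 * a ^ 5 * (4 ^ ?m / 2 * (\<Sum>q\<in>Q k ?m. F q ?m))"
      by (simp add: sum_distrib_right[symmetric])
    also have "\<dots> \<le> 56 * a ^ 5 * (2 * a ^ 2 * opt_cost G s f A)"
      using a by (intro mult_left_mono opt) auto
    also have "\<dots> = 112 * a ^ 7 * opt_cost G s f A" by (simp add: power_add[symmetric])
    finally show "(\<Sum>q\<in>Q k ?m. \<Sum>u\<in>?U. real (w {u, par u}) * c i k q u) \<le> 112 * a ^ 7 * opt_cost G s f A" .
  qed
  also have "\<dots> = 112 * a ^ 7 * real K ^ 2 * opt_cost G s f A" by (simp add: power2_eq_square)
  finally show ?thesis by (simp add: a_def)
qed

lemma opt_cost_nonneg:
  assumes "canonical_fusion f" "A \<subseteq> V"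
  shows "opt_cost G s f A \<ge> 0"
  using opt_cost_ge[OF assms sV, of "{}" 0 1] by simp

text \<open>The slack of the stated bound is spent here: exponent 7 against 10, square against cube,
  and the logarithm of the node count. \<open>448 = 4 * 112\<close> comes from \<open>K\<close>
  being at most twice the logarithmic term, where \<open>max 1\<close> covers diameter 1 with its
  vanishing logarithm.\<close>

theorem oblivious:
  assumes "doubling_bound G \<rho>"
  shows "oblivious_spanning_tree G s T
    (448 * 2 powr (10 * \<rho>) * (max 1 (log 2 (real (gdiameter G)))) ^ 3 * log 2 (real (card V)))"
proof -
  let ?l = "max 1 (log 2 (real (gdiameter G)))" and ?n = "log 2 (real (card V))"
  \<comment> \<open>Even a ball of radius 0 needs one covering set, so raising the exponent of
    \<open>2 powr \<rho>\<close> only weakens the bound.\<close>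
  have "1 \<le> 2 powr \<rho>"
  proof -
    obtain C where C: "real (card C) \<le> 2 powr \<rho>" "C \<subseteq> V" "nbhd G s 0 \<subseteq> (\<Union>v \<in> C. nbhd G v (0 / 2))"
      using assms sV unfolding doubling_bound_def by (meson order_refl)
    have "s \<in> nbhd G s 0" using sV by (simp add: nbhd_def d_self)
    then have "C \<noteq> {}" using C(3) by auto
    then have "card C \<noteq> 0" using C(2) finV finite_subset by (metis card_0_eq)
    then show ?thesis using C(1) by linarith
  qed
  then have "(2 powr \<rho>) ^ 7 \<le> (2 powr \<rho>) ^ 10" by (intro power_increasing) auto
  then have p: "(2 powr \<rho>) ^ 7 \<le> 2 powr (10 * \<rho>)" by (simp add: powr_powr powr_realpow[symmetric] mult.commute)
  obtain K where K: "gdiameter G < 4 ^ K" "real K \<le> 2 * ?l"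
  proof (cases "gdiameter G = 0")
    case True
    then show ?thesis by (intro that[of 0]) auto
  next
    case False
    then have "1 \<le> gdiameter G" by simp
    then obtain k where k: "4 ^ k \<le> gdiameter G" "gdiameter G < 4 ^ (k + 1)"
      using ex_power_ivl1[of 4 "gdiameter G"] by auto
    have "2 ^ k \<le> (4::nat) ^ k" by (rule power_mono) auto
    then have "2 ^ k \<le> gdiameter G" using k(1) by linarith
    then have "real (2 ^ k) \<le> real (gdiameter G)" by (simp only: of_nat_le_iff)
    then have "log 2 (2 ^ k) \<le> log 2 (real (gdiameter G))" using False by (subst log_le_cancel_iff) auto
    then have "real k \<le> log 2 (real (gdiameter G))" by (simp add: log_nat_power)
    then have "real (k + 1) \<le> 2 * ?l" by linarith
    then show ?thesis using k by (intro that[of "k + 1"]) auto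
  qed
  have "tree_cost G s f T A \<le> 448 * 2 powr (10 * \<rho>) * ?l ^ 3 * ?n * opt_cost G s f A"
    if "A \<subseteq> V" "canonical_fusion f" for A f
  \<comment> \<open>For a single node the logarithm makes the bound vanish, but the tree has no
    edges; otherwise the logarithm is at least 1.\<close>
  proof (cases "card V = 1")
    case True
    then have "V - {s} = {}" using sV by (auto simp: card_1_singleton_iff)
    then have "T = {}" by (simp add: T_def)
    then show ?thesis using True by (simp add: tree_cost_def)
  next
    case False
    moreover have "card V \<noteq> 0" using sV finV by auto
    ultimately have n: "1 \<le> ?n" by (simp add: le_log_iff)
    have "real K ^ 2 \<le> (2 * ?l) ^ 2" using K(2) by (intro power_mono) auto
    also have "\<dots> = 4 * ?l ^ 2" by (simp add: power_mult_distrib)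
    also have "\<dots> \<le> 4 * ?l ^ 3" by (intro mult_left_mono power_increasing) auto
    also have "\<dots> \<le> 4 * ?l ^ 3 * ?n" using n by (simp add: mult_le_cancel_left1)
    finally have "112 * (2 powr \<rho>) ^ 7 * real K ^ 2 \<le> 112 * 2 powr (10 * \<rho>) * (4 * ?l ^ 3 * ?n)"
      using p by (intro mult_mono) auto
    also have "\<dots> = 448 * 2 powr (10 * \<rho>) * ?l ^ 3 * ?n" by simp
    finally have "112 * (2 powr \<rho>) ^ 7 * real K ^ 2 * opt_cost G s f A \<le> 448 * 2 powr (10 * \<rho>) * ?l ^ 3 * ?n * opt_cost G s f A"
      by (rule mult_right_mono) (rule opt_cost_nonneg[OF that(2,1)])
    with tree_cost_le_opt[OF assms K(1) that(2,1)] show ?thesis by linarith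
  qed
  then show ?thesis by (simp add: oblivious_spanning_tree_def T_spanning)
qed

end

section \<open>Weakest preconditions with running times\<close>

definition bounded :: "nat \<Rightarrow> memory \<Rightarrow> bool" where
  "bounded B M \<longleftrightarrow> (\<forall>x i. M x i < 2 ^ B)"

text \<open>Deliberately crude: the program is fixed, so a literal may count \<open>n + 1\<close>
  bits and every operation is bounded like a product. Only polynomial growth in \<open>B\<close>
  matters.\<close>

fun value_bits :: "nat \<Rightarrow> aexp \<Rightarrow> nat" where
  "value_bits B (Const n) = n + 1"
| "value_bits B (Cell x a) = B"
| "value_bits B (Add a b) = value_bits B a + value_bits B b"
| "value_bits B (Sub a b) = value_bits B a + value_bits B b"
| "value_bits B (Mult a b) = value_bits B a + value_bits B b"
| "value_bits B (Quot a b) = value_bits B a + value_bits B b"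

fun aexp_time :: "nat \<Rightarrow> aexp \<Rightarrow> nat" where
  "aexp_time B (Const n) = n + 1"
| "aexp_time B (Cell x a) = aexp_time B a + B"
| "aexp_time B (Add a b) = aexp_time B a + aexp_time B b + value_bits B a + value_bits B b"
| "aexp_time B (Sub a b) = aexp_time B a + aexp_time B b + value_bits B a + value_bits B b"
| "aexp_time B (Mult a b) = aexp_time B a + aexp_time B b + value_bits B a + value_bits B b"
| "aexp_time B (Quot a b) = aexp_time B a + aexp_time B b + value_bits B a + value_bits B b"

text \<open>A time bound for runs in which all cells stay below \<open>2 ^ B\<close> and every loop makes at most
  \<open>B\<close> iterations.\<close>

fun com_time :: "nat \<Rightarrow> com \<Rightarrow> nat" where
  "com_time B Skip = 1"
| "com_time B (Assign x a b) = aexp_time B a + aexp_time B b"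
| "com_time B (Seq c d) = com_time B c + com_time B d"
| "com_time B (Cond b c d) = aexp_time B b + com_time B c + com_time B d"
| "com_time B (While b c) = aexp_time B b + B * (aexp_time B b + com_time B c)"

lemma poly_add_ex: "\<exists>p. \<forall>B. f B = poly p B \<Longrightarrow> \<exists>q. \<forall>B. g B = poly q B \<Longrightarrow> \<exists>r. \<forall>B. f B + g B = poly r (B::nat)"
  by (metis poly_add)

lemma poly_mult_ex: "\<exists>p. \<forall>B. f B = poly p B \<Longrightarrow> \<exists>q. \<forall>B. g B = poly q B \<Longrightarrow> \<exists>r. \<forall>B. f B * g B = poly r (B::nat)"
  by (metis poly_mult)

lemma poly_const_ex: "\<exists>p. \<forall>B. (c::nat) = poly p B"
  by (intro exI[of _ "[:c:]"]) simp

lemma poly_id_ex: "\<exists>p. \<forall>B. (B::nat) = poly p B"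
  by (intro exI[of _ "[:0, 1:]"]) simp

lemma poly_one_ex: "\<exists>p. \<forall>B. poly p B = (1::nat)"
  by (intro exI[of _ "[:1:]"]) simp

lemmas poly_ex = poly_one_ex poly_add_ex poly_mult_ex poly_const_ex poly_id_ex

lemma value_bits_poly: "\<exists>p. \<forall>B. value_bits B a = poly p B"
  by (induction a) (auto intro!: poly_ex simp del: add_Suc_right One_nat_def)

lemma aexp_time_poly: "\<exists>p. \<forall>B. aexp_time B a = poly p B"
  by (induction a) (auto intro!: poly_ex value_bits_poly simp del: add_Suc_right One_nat_def)

lemma com_time_poly: "\<exists>p. \<forall>B. com_time B c = poly p B"
  by (induction c) (auto intro!: poly_ex aexp_time_poly simp del: One_nat_def)

lemma less_power_bit_length: "n < 2 ^ bit_length n"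
  unfolding bit_length_def using floor_log_exp2_gt[of n] by simp

lemma bit_length_le: "n < 2 ^ k \<Longrightarrow> 0 < k \<Longrightarrow> bit_length n \<le> k"
proof (cases "n = 0")
  case True
  then show "0 < k \<Longrightarrow> ?thesis" by (simp add: bit_length_def)
next
  case False
  assume "n < 2 ^ k"
  moreover have "2 ^ floor_log n \<le> n" using False by (intro floor_log_exp2_le) simp
  ultimately have "(2::nat) ^ floor_log n < 2 ^ k" by linarith
  then show ?thesis by (simp add: bit_length_def Suc_le_eq)
qed

lemma value_bits_pos: "0 < B \<Longrightarrow> 0 < value_bits B a"
  by (induction a) auto

lemma aval_less:
  assumes "bounded B M"
  shows "aval a M < 2 ^ value_bits B a"
proof (induction a)
  case (Const n)
  show ?case using less_exp[of n] by (simp, linarith)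
next
  case (Cell x a)
  then show ?case using assms by (simp add: bounded_def)
next
  case (Add a b)
  then have "Suc (aval a M) * Suc (aval b M) \<le> 2 ^ value_bits B a * 2 ^ value_bits B b" by (intro mult_le_mono) auto
  then show ?case by (simp add: power_add algebra_simps)
next
  case (Sub a b)
  then have "Suc (aval a M) * 1 \<le> 2 ^ value_bits B a * 2 ^ value_bits B b" by (intro mult_le_mono) auto
  then show ?case by (simp add: power_add)
next
  case (Mult a b)
  then have "Suc (aval a M) * Suc (aval b M) \<le> 2 ^ value_bits B a * 2 ^ value_bits B b" by (intro mult_le_mono) auto
  then show ?case by (simp add: power_add algebra_simps)
next
  case (Quot a b)
  then have "Suc (aval a M) * 1 \<le> 2 ^ value_bits B a * 2 ^ value_bits B b" by (intro mult_le_mono) auto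
  moreover have "aval a M div aval b M \<le> aval a M" by (rule div_le_dividend)
  ultimately show ?case
    unfolding aval.simps value_bits.simps power_add by (metis Suc_le_eq le_less_trans mult.right_neutral)
qed

lemma acost_le:
  assumes "bounded B M" "0 < B"
  shows "acost a M \<le> aexp_time B a"
proof -
  have 1: "bit_length (aval a M) \<le> value_bits B a" for a
    using aval_less[OF assms(1)] value_bits_pos[OF assms(2)] by (rule bit_length_le)
  show ?thesis
  proof (induction a)
    case (Const n) show ?case using 1[of "Const n"] by simp
  next
    case (Cell x a) then show ?case using 1[of "Cell x a"] by simp
  next
    case (Add a b) then show ?case using 1[of "Add a b"] by simp
  next
    case (Sub a b) then show ?case using 1[of "Sub a b"] by simp
  next
    case (Mult a b) then show ?case using 1[of "Mult a b"] by simp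
  next
    case (Quot a b) then show ?case using 1[of "Quot a b"] by simp
  qed
qed

text \<open>Total correctness with the time bound and \<open>bounded\<close> carried along, so that
  a program proof owes only a size check at each assignment.\<close>

definition wp :: "nat \<Rightarrow> com \<Rightarrow> (memory \<Rightarrow> bool) \<Rightarrow> memory \<Rightarrow> bool" where
  "wp B c Q M \<longleftrightarrow> 0 < B \<longrightarrow> bounded B M \<longrightarrow>
     (\<exists>t M'. exec c M t M' \<and> t \<le> com_time B c \<and> bounded B M' \<and> Q M')"

fun written :: "com \<Rightarrow> nat set" where
  "written Skip = {}"
| "written (Assign x a b) = {x}"
| "written (Seq c d) = written c \<union> written d"
| "written (Cond b c d) = written c \<union> written d"
| "written (While b c) = written c"

lemma exec_frame: "exec c M t M' \<Longrightarrow> y \<notin> written c \<Longrightarrow> M' y = M y"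
  by (induction rule: exec.induct) (auto simp: update_def)

lemma wp_Skip: "Q M \<Longrightarrow> wp B Skip Q M"
  unfolding wp_def by (auto intro!: exI exec.Skip)

lemma wp_Assign:
  assumes "bounded B M \<Longrightarrow> aval b M < 2 ^ B \<and> Q (update M x (aval a M) (aval b M))"
  shows "wp B (Assign x a b) Q M"
  unfolding wp_def
proof (intro impI)
  assume B: "0 < B" "bounded B M"
  have "bounded B (update M x (aval a M) (aval b M))"
    using B assms by (auto simp: bounded_def update_def)
  then show "\<exists>t M'. exec (Assign x a b) M t M' \<and> t \<le> com_time B (Assign x a b) \<and> bounded B M' \<and> Q M'"
    using assms B acost_le[OF B(2,1)] by (intro exI[of _ "acost a M + acost b M"] exI conjI exec.Assign) (auto intro: add_mono exec.Assign)
qed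

lemma wp_frame:
  assumes "wp B c Q M" "\<And>M'. (\<And>y. y \<notin> written c \<Longrightarrow> M' y = M y) \<Longrightarrow> bounded B M' \<Longrightarrow> Q M' \<Longrightarrow> R M'"
  shows "wp B c R M"
  unfolding wp_def
proof (intro impI)
  assume B: "0 < B" "bounded B M"
  then obtain t M' where "exec c M t M'" "t \<le> com_time B c" "bounded B M'" "Q M'"
    using assms(1) unfolding wp_def by blast
  then show "\<exists>t M'. exec c M t M' \<and> t \<le> com_time B c \<and> bounded B M' \<and> R M'"
    using assms(2)[of M'] exec_frame[of c M t M'] by blast
qed

text \<open>The frame is built in: arrays that the first command does not write stay known, so
  intermediate assertions mention only what changed.\<close>

lemma wp_Seq:
  assumes "wp B c Q M" "\<And>M'. (\<And>y. y \<notin> written c \<Longrightarrow> M' y = M y) \<Longrightarrow> bounded B M' \<Longrightarrow> Q M' \<Longrightarrow> wp B d R M'"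
  shows "wp B (Seq c d) R M"
  unfolding wp_def
proof (intro impI)
  assume B: "0 < B" "bounded B M"
  then obtain t M' where M': "exec c M t M'" "t \<le> com_time B c" "bounded B M'" "Q M'"
    using assms(1) unfolding wp_def by blast
  then have "wp B d R M'" using assms(2)[of M'] exec_frame[of c M t M'] by blast
  then obtain t' M'' where "exec d M' t' M''" "t' \<le> com_time B d" "bounded B M''" "R M''"
    using B M' unfolding wp_def by blast
  then show "\<exists>t M'. exec (Seq c d) M t M' \<and> t \<le> com_time B (Seq c d) \<and> bounded B M' \<and> R M'"
    using M' by (intro exI[of _ "t + t'"] exI[of _ M'']) (auto intro: exec.Seq)
qed

lemma wp_Cond:
  assumes "aval b M \<noteq> 0 \<Longrightarrow> wp B c Q M" "aval b M = 0 \<Longrightarrow> wp B d Q M"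
  shows "wp B (Cond b c d) Q M"
  unfolding wp_def
proof (intro impI)
  assume B: "0 < B" "bounded B M"
  note time = acost_le[OF B(2,1), of b]
  show "\<exists>t M'. exec (Cond b c d) M t M' \<and> t \<le> com_time B (Cond b c d) \<and> bounded B M' \<and> Q M'"
  proof (cases "aval b M = 0")
    case True
    then obtain t M' where "exec d M t M'" "t \<le> com_time B d" "bounded B M'" "Q M'"
      using assms(2) B unfolding wp_def by blast
    then show ?thesis using True time
      by (intro exI[of _ "acost b M + t"] exI[of _ M']) (auto intro: exec.CondFalse)
  next
    case False
    then obtain t M' where "exec c M t M'" "t \<le> com_time B c" "bounded B M'" "Q M'"
      using assms(1) B unfolding wp_def by blast
    then show ?thesis using False time
      by (intro exI[of _ "acost b M + t"] exI[of _ M']) (auto intro: exec.CondTrue)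
  qed
qed

text \<open>The number \<open>N\<close> of iterations is fixed beforehand, which yields termination
  and the time bound at once; \<open>N \<le> B\<close> is what \<open>com_time\<close>
  presupposes.\<close>

lemma wp_While:
  assumes "N \<le> B" "I 0 M"
    and step: "\<And>j M'. j < N \<Longrightarrow> bounded B M' \<Longrightarrow> I j M' \<Longrightarrow> aval b M' \<noteq> 0 \<and> wp B c (I (Suc j)) M'"
    and stop: "\<And>M'. I N M' \<Longrightarrow> aval b M' = 0"
  shows "wp B (While b c) (I N) M"
  unfolding wp_def
proof (intro impI)
  assume B: "0 < B" "bounded B M"
  have "\<exists>t M'. exec (While b c) M t M' \<and> t \<le> aexp_time B b + i * (aexp_time B b + com_time B c)
          \<and> bounded B M' \<and> I N M'"
    if "j + i = N" "bounded B M" "I j M" for i j M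
    using that
  proof (induction i arbitrary: j M)
    case 0
    then have "aval b M = 0" using stop by simp
    then show ?case using 0 acost_le[OF 0(2) B(1), of b] by (auto intro!: exI exec.WhileFalse)
  next
    case (Suc i)
    note time = acost_le[OF Suc.prems(2) B(1), of b]
    have b: "aval b M \<noteq> 0" "wp B c (I (Suc j)) M" using step[of j M] Suc.prems by auto
    then obtain t M' where M': "exec c M t M'" "t \<le> com_time B c" "bounded B M'" "I (Suc j) M'"
      using B(1) Suc.prems(2) unfolding wp_def by blast
    obtain t' M'' where M'': "exec (While b c) M' t' M''" "t' \<le> aexp_time B b + i * (aexp_time B b + com_time B c)"
      "bounded B M''" "I N M''"
      using Suc.IH[OF _ M'(3,4)] Suc.prems(1) by auto
    show ?case
      using exec.WhileTrue[OF b(1) M'(1) M''(1)] time M'(2) M''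
      by (intro exI[of _ "acost b M + t + t'"] exI[of _ M'']) auto
  qed
  from this[of 0 N M] obtain t M' where M': "exec (While b c) M t M'"
    "t \<le> aexp_time B b + N * (aexp_time B b + com_time B c)" "bounded B M'" "I N M'"
    using B assms(2) by auto
  have "N * (aexp_time B b + com_time B c) \<le> B * (aexp_time B b + com_time B c)"
    using assms(1) by (rule mult_le_mono1)
  then have "t \<le> com_time B (While b c)"
    unfolding com_time.simps by (intro order_trans[OF M'(2)] add_left_mono)
  then show "\<exists>t M'. exec (While b c) M t M' \<and> t \<le> com_time B (While b c) \<and> bounded B M' \<and> I N M'"
    using M' by (intro exI[of _ t] exI[of _ M']) auto
qed

abbreviation Var :: "nat \<Rightarrow> aexp" where "Var x \<equiv> Cell x (Const 0)"
abbreviation SetVar :: "nat \<Rightarrow> aexp \<Rightarrow> com" where "SetVar x e \<equiv> Assign x (Const 0) e"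

definition For :: "nat \<Rightarrow> aexp \<Rightarrow> com \<Rightarrow> com" where
  "For x e c = Seq (SetVar x (Const 0))
     (While (Sub e (Var x)) (Seq c (SetVar x (Add (Var x) (Const 1)))))"

lemma written_For [simp]: "written (For x e c) = insert x (written c)"
  by (auto simp: For_def)

lemma wp_For:
  assumes x: "x \<notin> written c" and N: "N \<le> B"
    and guard: "\<And>M'. (\<And>y. y \<notin> insert x (written c) \<Longrightarrow> M' y = M y) \<Longrightarrow> aval e M' = N"
    and inv: "I 0 M" "\<And>j M v. I j (M(x := v)) = I j M"
    and step: "\<And>j M'. j < N \<Longrightarrow> M' x 0 = j \<Longrightarrow> (\<And>y. y \<notin> insert x (written c) \<Longrightarrow> M' y = M y) \<Longrightarrow>
      bounded B M' \<Longrightarrow> I j M' \<Longrightarrow> wp B c (I (Suc j)) M'"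
  shows "wp B (For x e c) (I N) M"
proof -
  define J where "J j M' \<longleftrightarrow> M' x 0 = j \<and> (\<forall>y. y \<notin> insert x (written c) \<longrightarrow> M' y = M y) \<and> I j M'" for j M'
  have lt: "j < 2 ^ B" if "j \<le> N" for j using that N less_exp[of B] by linarith
  show ?thesis
    unfolding For_def
  proof (rule wp_Seq[where Q = "J 0"])
    show "wp B (SetVar x (Const 0)) (J 0) M"
      using inv by (intro wp_Assign) (auto simp: J_def update_def)
  next
    fix M' assume "J 0 M'"
    then have "wp B (While (Sub e (Var x)) (Seq c (SetVar x (Add (Var x) (Const 1))))) (J N) M'"
    proof (rule wp_While[where I = J, OF N])
      fix j M' assume j: "j < N" and b: "bounded B M'" and J: "J j M'"
      then have J': "M' x 0 = j" "\<And>y. y \<notin> insert x (written c) \<Longrightarrow> M' y = M y" "I j M'"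
        by (auto simp: J_def)
      have g: "aval e M' = N" using J'(2) by (rule guard)
      moreover have "wp B (Seq c (SetVar x (Add (Var x) (Const 1)))) (J (Suc j)) M'"
      proof (rule wp_Seq[where Q = "I (Suc j)"])
        show "wp B c (I (Suc j)) M'" using j J' b by (intro step)
        fix M'' assume *: "\<And>y. y \<notin> written c \<Longrightarrow> M'' y = M' y" "I (Suc j) M''"
        then have "M'' x 0 = j" using x J' by simp
        then show "wp B (SetVar x (Add (Var x) (Const 1))) (J (Suc j)) M''"
          using * J' x lt[of "Suc j"] j inv(2)
          by (intro wp_Assign) (auto simp: J_def update_def)
      qed
      ultimately show "aval (Sub e (Var x)) M' \<noteq> 0 \<and> wp B (Seq c (SetVar x (Add (Var x) (Const 1)))) (J (Suc j)) M'"
        using j J' by simp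
    next
      fix M' assume "J N M'"
      then show "aval (Sub e (Var x)) M' = 0" using guard[of M'] by (auto simp: J_def)
    qed
    then show "wp B (While (Sub e (Var x)) (Seq c (SetVar x (Add (Var x) (Const 1))))) (I N) M'"
      by (rule wp_frame) (auto simp: J_def)
  qed
qed

section \<open>The program\<close>

text \<open>
  Arrays: 0 input, 1 parent pointers, 4 an upper bound for all distances, 5 distance matrix,
  6 separation of the current net, 7 distance to the next net, 8 distance to the current net,
  9 next hop towards the next net, 10 current node of a walk, 11 and 12 loop counters.
\<close>

definition neq :: "aexp \<Rightarrow> aexp \<Rightarrow> aexp" where "neq a b = Add (Sub a b) (Sub b a)"

definition "node_count = Cell 0 (Const 0)"
definition "entry a n b = Add (Mult a n) b"
definition "input_weight a b = Cell 0 (Add (entry a node_count b) (Const 2))"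
definition "input_dist a b = Cell 5 (entry a node_count b)"
definition "row x = Quot (Var x) node_count"
definition "col x = Sub (Var x) (Mult (Quot (Var x) node_count) node_count)"

text \<open>The result exceeds every distance; it serves as infinity in the distance matrix and as
  the stopping threshold for the levels. The offset 2 skips the node count and the sink in the
  input.\<close>

definition "sum_prog = Seq (SetVar 4 (Const 1))
  (For 11 (Mult node_count node_count) (SetVar 4 (Add (Var 4) (Cell 0 (Add (Var 11) (Const 2))))))"

definition "init_prog = For 11 (Mult node_count node_count)
  (Cond (neq (row 11) (col 11))
     (Cond (Cell 0 (Add (Var 11) (Const 2)))
        (Assign 5 (Var 11) (Cell 0 (Add (Var 11) (Const 2))))
        (Assign 5 (Var 11) (Var 4)))
     (Assign 5 (Var 11) (Const 0)))"

definition "detour = Add (input_dist (row 12) (Var 11)) (input_dist (Var 11) (col 12))"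

definition "floyd_prog = For 11 node_count (For 12 (Mult node_count node_count)
  (Cond (Sub (Cell 5 (Var 12)) detour) (Assign 5 (Var 12) detour) Skip))"

definition "init_net_prog = For 11 node_count (Assign 7 (Var 11) (input_dist (Var 11) (Cell 0 (Const 1))))"

text \<open>Greedy net: the guard is true when the distance of the node to the net so far is at
  least the separation; the node then joins and all distances are refreshed.\<close>

definition "net_prog = For 11 node_count
  (Cond (Sub (Add (Cell 7 (Var 11)) (Const 1)) (Var 6))
     (For 12 node_count
        (Cond (Sub (Cell 7 (Var 12)) (input_dist (Var 12) (Var 11)))
           (Assign 7 (Var 12) (input_dist (Var 12) (Var 11))) Skip))
     Skip)"

definition "hop_prog = For 11 node_count
  (Seq (Assign 9 (Var 11) (Var 11))
     (For 12 node_count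
        (Cond (input_weight (Var 11) (Var 12))
           (Cond (neq (Add (input_weight (Var 11) (Var 12)) (Cell 7 (Var 12))) (Cell 7 (Var 11)))
              Skip
              (Assign 9 (Var 11) (Var 12)))
           Skip)))"

text \<open>Levels are processed upwards and each walk overwrites earlier pointers, so the highest
  level wins without being stored. As many steps as there are nodes exhaust the orbit.\<close>

definition "walk_prog = For 11 node_count
  (Cond (Cell 8 (Var 11)) Skip
     (Seq (SetVar 10 (Var 11))
        (For 12 node_count
           (Seq (Assign 1 (Var 10) (Cell 9 (Var 10))) (SetVar 10 (Cell 9 (Var 10)))))))"

definition "copy_prog = For 11 node_count (Assign 8 (Var 11) (Cell 7 (Var 11)))"

definition "level_prog = Seq (SetVar 6 (Mult (Const 4) (Var 6))) (Seq init_net_prog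
  (Seq net_prog (Seq hop_prog (Seq walk_prog copy_prog))))"

text \<open>Array 8 is initially zero, which already represents level 0, the net of all
  nodes.\<close>

definition "tree_prog = Seq sum_prog (Seq init_prog (Seq floyd_prog
  (Seq (SetVar 6 (Const 1)) (While (Sub (Add (Var 4) (Const 1)) (Var 6)) level_prog))))"

section \<open>Correctness of the program on numbered nodes\<close>

lemma index_less: "i < n \<Longrightarrow> j < n \<Longrightarrow> i * n + j < n * (n::nat)"
proof -
  assume "i < n" "j < n"
  then have "i * n + j < Suc i * n" by simp
  also have "\<dots> \<le> n * n" using \<open>i < n\<close> by (intro mult_le_mono1) simp
  finally show ?thesis .
qed

lemma index_div: "j < n \<Longrightarrow> (i * n + j) div n = (i::nat)"
  by simp

lemma index_mod: "j < n \<Longrightarrow> (i * n + j) mod n = (j::nat)"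
  by simp

lemma index_eq: "v < n \<Longrightarrow> v' < n \<Longrightarrow> u * n + v = u' * n + v' \<longleftrightarrow> u = u' \<and> v = (v'::nat)"
  by (metis index_div index_mod)

text \<open>\<open>dd\<close> is the metric on node numbers that the program has to compute.
  \<open>4 * W < 2 ^ B\<close> leaves room for the last separation, as separations are multiplied by
  4 while at most \<open>W\<close>; \<open>n * n \<le> B\<close> admits the loops over the
  matrix.\<close>

locale instance_memory =
  fixes B n k W :: nat and inp :: "nat \<Rightarrow> nat" and dd :: "nat \<Rightarrow> nat \<Rightarrow> nat"
  assumes inp_0: "inp 0 = n" and inp_1: "inp (Suc 0) = k" and k: "k < n"
    and W: "W = 1 + (\<Sum>j<n * n. inp (j + 2))"
    and W_B: "4 * W < 2 ^ B" and n_B: "n * n \<le> B"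
    and dd_self: "\<And>u. u < n \<Longrightarrow> dd u u = 0"
    and dd_pos: "\<And>u v. u < n \<Longrightarrow> v < n \<Longrightarrow> u \<noteq> v \<Longrightarrow> dd u v \<noteq> 0"
    and dd_sym: "\<And>u v. u < n \<Longrightarrow> v < n \<Longrightarrow> dd u v = dd v u"
    and dd_tri: "\<And>u v x. u < n \<Longrightarrow> v < n \<Longrightarrow> x < n \<Longrightarrow> dd u x \<le> dd u v + dd v x"
    and dd_W: "\<And>u v. u < n \<Longrightarrow> v < n \<Longrightarrow> dd u v \<le> W"
    and dd_edge: "\<And>u v. u < n \<Longrightarrow> v < n \<Longrightarrow> inp (u * n + v + 2) \<noteq> 0 \<Longrightarrow> dd u v \<le> inp (u * n + v + 2)"
    and dd_next: "\<And>u v. u < n \<Longrightarrow> v < n \<Longrightarrow> u \<noteq> v \<Longrightarrow>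
      \<exists>y<n. inp (u * n + y + 2) \<noteq> 0 \<and> inp (u * n + y + 2) + dd y v = dd u v"
begin

abbreviation wt :: "nat \<Rightarrow> nat \<Rightarrow> nat" where "wt u v \<equiv> inp (u * n + v + 2)"

lemma n_le: "n \<le> B" using n_B k by (metis le_square order_trans)

lemma B_pos: "0 < B" using n_le k by simp

lemma wt_le_W: "j < n * n \<Longrightarrow> inp (j + 2) < W"
  unfolding W by (rule le_imp_less_Suc[THEN order.strict_trans2]) (auto intro!: member_le_sum)

lemma minus_div_mult: "j - j div n * n = j mod (n::nat)"
  by (simp add: minus_div_mult_eq_mod)

lemmas prog_simps = node_count_def entry_def input_weight_def input_dist_def row_def col_def
  detour_def neq_def inp_0 inp_1 minus_div_mult update_def

lemma sum_prog: "M 0 = inp \<Longrightarrow> wp B sum_prog (\<lambda>M'. M' 4 0 = W) M"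
  unfolding sum_prog_def
proof (rule wp_Seq[where Q = "\<lambda>M. M 4 0 = 1"])
  assume M: "M 0 = inp"
  have "W < 2 ^ B" using W_B by linarith
  then have lt: "W' < 2 ^ B" if "W' \<le> W" for W' using that by linarith
  show "wp B (SetVar 4 (Const 1)) (\<lambda>M. M 4 0 = 1) M"
    using lt[of 1] W by (intro wp_Assign) (auto simp: update_def)
  fix M' assume M': "\<And>y. y \<notin> written (SetVar 4 (Const 1)) \<Longrightarrow> M' y = M y" "M' 4 0 = 1"
  have "wp B (For 11 (Mult node_count node_count) (SetVar 4 (Add (Var 4) (Cell 0 (Add (Var 11) (Const 2))))))
     (\<lambda>M. M 4 0 = 1 + (\<Sum>j<n * n. inp (j + 2))) M'"
  proof (rule wp_For[where I = "\<lambda>j M. M 4 0 = 1 + (\<Sum>i<j. inp (i + 2))", OF _ n_B])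
    fix j M'' assume j: "j < n * n" "M'' 11 0 = j" "M'' 4 0 = 1 + (\<Sum>i<j. inp (i + 2))"
      and fr: "\<And>y. y \<notin> insert 11 (written (SetVar 4 (Add (Var 4) (Cell 0 (Add (Var 11) (Const 2)))))) \<Longrightarrow> M'' y = M' y"
    have "M'' 0 = inp" using M M' fr[of 0] by simp
    moreover have "(\<Sum>i<Suc j. inp (i + 2)) \<le> (\<Sum>j<n * n. inp (j + 2))"
      using j(1) by (intro sum_mono2) auto
    then have "1 + (\<Sum>i<Suc j. inp (i + 2)) < 2 ^ B" using W by (intro lt) simp
    ultimately show "wp B (SetVar 4 (Add (Var 4) (Cell 0 (Add (Var 11) (Const 2)))))
        (\<lambda>M. M 4 0 = 1 + (\<Sum>i<Suc j. inp (i + 2))) M''"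
      using j by (intro wp_Assign) (auto simp: update_def add_ac)
  qed (use M M' in \<open>auto simp: prog_simps\<close>)
  then show "wp B (For 11 (Mult node_count node_count) (SetVar 4 (Add (Var 4) (Cell 0 (Add (Var 11) (Const 2))))))
     (\<lambda>M. M 4 0 = W) M'" unfolding W .
qed

section \<open>All distances by the Floyd-Warshall scheme\<close>

definition d0 :: "nat \<Rightarrow> nat \<Rightarrow> nat" where
  "d0 u v = (if u = v then 0 else if wt u v = 0 then W else wt u v)"

lemma init_prog:
  assumes M: "M 0 = inp" "M 4 0 = W"
  shows "wp B init_prog (\<lambda>M'. \<forall>u<n. \<forall>v<n. M' 5 (u * n + v) = d0 u v) M"
proof -
  have W': "W < 2 ^ B" using W_B by linarith
  have "wp B init_prog (\<lambda>M'. \<forall>i<n * n. M' 5 i = d0 (i div n) (i mod n)) M"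
    unfolding init_prog_def
  proof (rule wp_For[where I = "\<lambda>j M'. \<forall>i<j. M' 5 i = d0 (i div n) (i mod n)", OF _ n_B], goal_cases)
    case (5 j M')
    have *: "M' 0 = inp" "M' 4 0 = W" using M 5(3)[of 0] 5(3)[of 4] by auto
    have "j div n * n + j mod n = j" by simp
    then show ?case using * 5 W' wt_le_W[OF 5(1)]
      by (intro wp_Cond wp_Assign) (auto simp: prog_simps d0_def less_Suc_eq)
  qed (use M in \<open>auto simp: prog_simps\<close>)
  then show ?thesis
  proof (rule wp_frame, intro allI impI)
    fix M' :: memory and u v assume "\<forall>i<n * n. M' 5 i = d0 (i div n) (i mod n)" "u < n" "v < n"
    then show "M' 5 (u * n + v) = d0 u v" using index_less[of u n v] index_div index_mod by metis
  qed
qed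

fun pl :: "nat list \<Rightarrow> nat" where
  "pl (x # y # p) = d0 x y + pl (y # p)"
| "pl _ = 0"

lemma pl_append: "pl (a @ x # b) = pl (a @ [x]) + pl (x # b)"
  by (induction a rule: induct_list012) auto

lemma dd_le_d0: "u < n \<Longrightarrow> v < n \<Longrightarrow> dd u v \<le> d0 u v"
  using dd_self dd_W dd_edge by (auto simp: d0_def)

text \<open>Repeatedly taking the first edge of a shortest path strictly lowers the distance to
  \<open>v\<close>, so the intermediate nodes are distinct.\<close>

lemma dd_path:
  assumes "u < n" "v < n"
  shows "\<exists>m. distinct m \<and> set m \<subseteq> {..<n} \<and> (\<forall>x\<in>set m. dd x v < dd u v) \<and> pl (u # m @ [v]) \<le> dd u v"
  using assms
proof (induction "dd u v" arbitrary: u rule: less_induct)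
  case less
  show ?case
  proof (cases "u = v")
    case True
    then show ?thesis by (intro exI[of _ "[]"]) (simp add: d0_def)
  next
    case False
    then obtain y where y: "y < n" "wt u y \<noteq> 0" "wt u y + dd y v = dd u v" using dd_next less by blast
    have d: "d0 u y \<le> wt u y" using y by (auto simp: d0_def)
    have lt: "dd y v < dd u v" using y by simp
    show ?thesis
    proof (cases "y = v")
      case True
      then show ?thesis using d y by (intro exI[of _ "[]"]) simp
    next
      case False
      obtain m where m: "distinct m" "set m \<subseteq> {..<n}" "\<forall>x\<in>set m. dd x v < dd y v" "pl (y # m @ [v]) \<le> dd y v"
        using less.hyps[OF lt y(1) less.prems(2)] by blast
      have "y \<notin> set m" using m(3) by auto
      then show ?thesis using m y d lt
        by (intro exI[of _ "y # m"]) (auto intro: order.strict_trans)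
    qed
  qed
qed

text \<open>Only an upper bound on the entry, hence stable under decrease. The lower bound
  \<open>dd u v\<close> is kept separately, so that in-place updates do no harm.\<close>

definition via :: "nat \<Rightarrow> nat \<Rightarrow> nat \<Rightarrow> nat \<Rightarrow> bool" where
  "via c u v x \<longleftrightarrow> (\<forall>m. distinct m \<longrightarrow> set m \<subseteq> {..<c} \<longrightarrow> x \<le> pl (u # m @ [v]))"

lemma via_antimono: "via c u v x \<Longrightarrow> y \<le> x \<Longrightarrow> via c u v y"
  unfolding via_def using order_trans by blast

text \<open>A list of distinct intermediate nodes contains \<open>c\<close> at most once and splits
  there into two lists of nodes below \<open>c\<close>.\<close>

lemma via_Suc:
  assumes "via c u v x" "via c u c y" "via c c v z"
  shows "via (Suc c) u v (min x (y + z))"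
  unfolding via_def
proof (intro allI impI)
  fix m assume m: "distinct m" "set m \<subseteq> {..<Suc c}"
  show "min x (y + z) \<le> pl (u # m @ [v])"
  proof (cases "c \<in> set m")
    case True
    then obtain a b where ab: "m = a @ c # b" by (meson split_list)
    then have "set a \<subseteq> {..<c}" "set b \<subseteq> {..<c}" "distinct a" "distinct b"
      using m by (auto simp: lessThan_Suc)
    then have "y \<le> pl (u # a @ [c])" "z \<le> pl (c # b @ [v])" using assms(2,3) by (auto simp: via_def)
    moreover have "pl (u # m @ [v]) = pl (u # a @ [c]) + pl (c # b @ [v])"
      using pl_append[of "u # a" c "b @ [v]"] by (simp add: ab)
    ultimately show ?thesis by linarith
  next
    case False
    then have "set m \<subseteq> {..<c}" using m by (auto simp: less_Suc_eq)
    then have "x \<le> pl (u # m @ [v])" using assms(1) m by (auto simp: via_def)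
    then show ?thesis by simp
  qed
qed

text \<open>During phase \<open>c\<close> the entries before \<open>j\<close> already account for the intermediate node \<open>c\<close>.\<close>

definition floyd_inv :: "nat \<Rightarrow> nat \<Rightarrow> memory \<Rightarrow> bool" where
  "floyd_inv c j M \<longleftrightarrow> (\<forall>u<n. \<forall>v<n. dd u v \<le> M 5 (u * n + v) \<and> via c u v (M 5 (u * n + v)) \<and>
     (u * n + v < j \<longrightarrow> via (Suc c) u v (M 5 (u * n + v))))"

lemma floyd_prog:
  assumes M: "M 0 = inp" "\<forall>u<n. \<forall>v<n. M 5 (u * n + v) = d0 u v"
  shows "wp B floyd_prog (\<lambda>M'. \<forall>u<n. \<forall>v<n. M' 5 (u * n + v) = dd u v) M"
proof -
  have "wp B floyd_prog (floyd_inv n 0) M"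
    unfolding floyd_prog_def
  proof (rule wp_For[where I = "\<lambda>c. floyd_inv c 0", OF _ n_le], goal_cases)
    case (3)
    show ?case using M dd_le_d0 by (auto simp: floyd_inv_def via_def)
  next
    case (5 c M')
    have M'0: "M' 0 = inp" using M 5(3)[of 0] by simp
    have "wp B (For 12 (Mult node_count node_count) (Cond (Sub (Cell 5 (Var 12)) detour) (Assign 5 (Var 12) detour) Skip))
      (floyd_inv c (n * n)) M'"
    proof (rule wp_For[where I = "floyd_inv c", OF _ n_B], goal_cases)
      case (5 j M'')
      note cn = \<open>c < n\<close>
      have M'': "M'' 0 = inp" "M'' 11 0 = c" "M'' 12 0 = j" using M'0 5 \<open>M' 11 0 = c\<close> by auto
      define a b where "a = j div n" and "b = j mod n"
      have j: "j = a * n + b" by (simp add: a_def b_def)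
      have ab: "a < n" "b < n" using 5(1) k by (auto simp: a_def b_def less_mult_imp_div_less)
      define x where "x = M'' 5 (a * n + c) + M'' 5 (c * n + b)"
      have det: "aval detour M'' = x" using M'' by (simp add: prog_simps x_def a_def b_def)
      have inv: "\<And>u v. u < n \<Longrightarrow> v < n \<Longrightarrow> dd u v \<le> M'' 5 (u * n + v)"
        "\<And>u v. u < n \<Longrightarrow> v < n \<Longrightarrow> via c u v (M'' 5 (u * n + v))"
        "\<And>u v. u < n \<Longrightarrow> v < n \<Longrightarrow> u * n + v < j \<Longrightarrow> via (Suc c) u v (M'' 5 (u * n + v))"
        using 5(5) by (auto simp: floyd_inv_def)
      \<comment> \<open>Row and column \<open>c\<close> may have been updated earlier in this phase;
        the invariant gives \<open>via c\<close> for old and new entries alike.\<close>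
      have new: "via (Suc c) a b (min (M'' 5 j) x)"
        unfolding x_def j using inv(2) ab cn by (intro via_Suc) auto
      have low: "dd a b \<le> x"
        using dd_tri[of a c b] inv(1)[of a c] inv(1)[of c b] ab cn unfolding x_def by linarith
      have upd: "floyd_inv c (Suc j) M3"
        if "M3 5 j = min (M'' 5 j) x" "\<And>i. i \<noteq> j \<Longrightarrow> M3 5 i = M'' 5 i" for M3
        unfolding floyd_inv_def
      proof (intro allI impI)
        fix u v assume uv: "u < n" "v < n"
        show "dd u v \<le> M3 5 (u * n + v) \<and> via c u v (M3 5 (u * n + v)) \<and>
          (u * n + v < Suc j \<longrightarrow> via (Suc c) u v (M3 5 (u * n + v)))"
        proof (cases "u * n + v = j")
          case True
          then have "u = a" "v = b" using index_eq[OF uv(2) ab(2)] j by auto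
          then show ?thesis using that(1) True new low inv(1)[OF ab] inv(2)[OF ab] j
            by (auto intro: via_antimono)
        next
          case False
          then show ?thesis using that(2)[OF False] inv uv by (auto simp: less_Suc_eq)
        qed
      qed
      show ?case
      proof (rule wp_Cond)
        assume "aval (Sub (Cell 5 (Var 12)) detour) M'' \<noteq> 0"
        then have lt: "x < M'' 5 j" using det M'' by simp
        show "wp B (Assign 5 (Var 12) detour) (floyd_inv c (Suc j)) M''"
        proof (rule wp_Assign)
          assume "bounded B M''"
          \<comment> \<open>The detour is stored only when it lies below the entry it replaces, so
            it fits into a cell.\<close>
          then have "M'' 5 j < 2 ^ B" by (simp add: bounded_def)
          then have "x < 2 ^ B" using lt by (rule order.strict_trans[rotated])
          moreover have "update M'' 5 (aval (Var 12) M'') (aval detour M'') = M''(5 := (M'' 5)(j := x))"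
            using det M'' by (simp add: update_def)
          moreover have "floyd_inv c (Suc j) (M''(5 := (M'' 5)(j := x)))" using lt by (intro upd) auto
          ultimately show "aval detour M'' < 2 ^ B \<and>
              floyd_inv c (Suc j) (update M'' 5 (aval (Var 12) M'') (aval detour M''))"
            using det by simp
        qed
      next
        assume "aval (Sub (Cell 5 (Var 12)) detour) M'' = 0"
        then have "M'' 5 j \<le> x" using det M'' by simp
        then show "wp B Skip (floyd_inv c (Suc j)) M''" by (intro wp_Skip upd) auto
      qed
    qed (use M'0 5 in \<open>auto simp: prog_simps floyd_inv_def\<close>)
    then show ?case
      by (rule wp_frame) (auto simp: floyd_inv_def index_less)
  qed (use M in \<open>auto simp: prog_simps floyd_inv_def\<close>)
  then show ?thesis
  proof (rule wp_frame, intro allI impI)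
    fix M' u v assume *: "floyd_inv n 0 M'" "u < n" "v < n"
    obtain m where m: "distinct m" "set m \<subseteq> {..<n}" "pl (u # m @ [v]) \<le> dd u v"
      using dd_path[OF *(2,3)] by blast
    have "M' 5 (u * n + v) \<le> pl (u # m @ [v])" using * m by (auto simp: floyd_inv_def via_def)
    moreover have "dd u v \<le> M' 5 (u * n + v)" using * by (auto simp: floyd_inv_def)
    ultimately show "M' 5 (u * n + v) = dd u v" using m(3) by linarith
  qed
qed

section \<open>Greedy nets, represented by their distance functions, and next hops\<close>

definition partial_net :: "nat \<Rightarrow> (nat \<Rightarrow> nat) \<Rightarrow> bool" where
  "partial_net r e \<longleftrightarrow> e k = 0 \<and> (\<forall>u<n. \<exists>y<n. e y = 0 \<and> dd u y = e u) \<and>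
     (\<forall>u<n. \<forall>y<n. e y = 0 \<longrightarrow> e u \<le> dd u y) \<and>
     (\<forall>x<n. \<forall>y<n. e x = 0 \<longrightarrow> e y = 0 \<longrightarrow> x \<noteq> y \<longrightarrow> r \<le> dd x y)"

definition net :: "nat \<Rightarrow> (nat \<Rightarrow> nat) \<Rightarrow> bool" where
  "net r e \<longleftrightarrow> partial_net r e \<and> (\<forall>u<n. e u < r)"

lemma partial_net_init:
  assumes "\<forall>u<n. e u = dd u k"
  shows "partial_net r e"
proof -
  have "e y = 0 \<longleftrightarrow> y = k" if "y < n" for y using assms that k dd_pos[of y k] dd_self[of k] by (cases "y = k") auto
  then show ?thesis using assms k by (auto simp: partial_net_def dd_self)
qed

text \<open>\<open>r \<le> e x\<close> keeps \<open>x\<close> at distance at least \<open>r\<close>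
  from all present net points, and the minimum with \<open>dd u x\<close> is the distance to the
  enlarged net.\<close>

lemma partial_net_insert:
  assumes e: "partial_net r e" and x: "x < n" "r \<le> e x" and e': "\<forall>u<n. e' u = min (e u) (dd u x)"
  shows "partial_net r e'"
proof -
  have z: "e' y = 0 \<longleftrightarrow> e y = 0 \<or> y = x" if "y < n" for y
    using e' that x dd_pos[of y x] dd_self by auto
  have far: "r \<le> dd x y" if "y < n" "e y = 0" for y
    using e x that unfolding partial_net_def by (meson order_trans)
  show ?thesis
    unfolding partial_net_def
  proof (intro conjI allI impI)
    show "e' k = 0" using z[OF k] e by (simp add: partial_net_def)
  next
    fix u assume u: "u < n"
    show "\<exists>y<n. e' y = 0 \<and> dd u y = e' u"
    proof (cases "dd u x \<le> e u")
      case True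
      then show ?thesis using z[OF x(1)] x(1) u e' by (intro exI[of _ x]) auto
    next
      case False
      obtain y where "y < n" "e y = 0" "dd u y = e u" using e u by (auto simp: partial_net_def)
      then show ?thesis using False z u e' by (intro exI[of _ y]) auto
    qed
  next
    fix u y assume "u < n" "y < n" "e' y = 0"
    then show "e' u \<le> dd u y" using z[of y] e e' by (auto simp: partial_net_def min_le_iff_disj)
  next
    fix a b assume ab: "a < n" "b < n" "e' a = 0" "e' b = 0" "a \<noteq> b"
    then show "r \<le> dd a b" using z[of a] z[of b] e far dd_sym x(1) by (auto simp: partial_net_def)
  qed
qed

definition dist_ok :: "memory \<Rightarrow> bool" where
  "dist_ok M \<longleftrightarrow> M 0 = inp \<and> (\<forall>u<n. \<forall>v<n. M 5 (u * n + v) = dd u v)"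

lemma init_net_prog:
  assumes M: "dist_ok M"
  shows "wp B init_net_prog (\<lambda>M'. partial_net r (M' 7)) M"
proof -
  have "wp B init_net_prog (\<lambda>M'. \<forall>u<n. M' 7 u = dd u k) M"
    unfolding init_net_prog_def
  proof (rule wp_For[where I = "\<lambda>j M'. \<forall>u<j. M' 7 u = dd u k", OF _ n_le], goal_cases)
    case (5 j M')
    have "M' 0 = inp" "M' 5 = M 5" using M 5(3)[of 0] 5(3)[of 5] by (auto simp: dist_ok_def)
    moreover have "M' 5 (j * n + k) < 2 ^ B" using 5(4) unfolding bounded_def by blast
    ultimately show ?case using 5 M k
      by (intro wp_Assign) (auto simp: prog_simps dist_ok_def less_Suc_eq)
  qed (use M in \<open>auto simp: prog_simps dist_ok_def\<close>)
  then show ?thesis by (rule wp_frame) (auto intro: partial_net_init)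
qed

lemma net_prog:
  assumes M: "dist_ok M" "M 6 0 = r" "partial_net r (M 7)" "0 < r"
  shows "wp B net_prog (\<lambda>M'. net r (M' 7)) M"
proof -
  have "wp B net_prog (\<lambda>M'. partial_net r (M' 7) \<and> (\<forall>u<n. M' 7 u < r)) M"
    unfolding net_prog_def
  proof (rule wp_For[where I = "\<lambda>x M'. partial_net r (M' 7) \<and> (\<forall>u<x. M' 7 u < r)", OF _ n_le], goal_cases)
    case (5 x M')
    have M': "M' 0 = inp" "M' 5 = M 5" "M' 6 0 = r" using M 5(3)[of 0] 5(3)[of 5] 5(3)[of 6] by (auto simp: dist_ok_def)
    note x = 5(1,2) and I = 5(5)
    show ?case
    proof (rule wp_Cond)
      assume "aval (Sub (Add (Cell 7 (Var 11)) (Const 1)) (Var 6)) M' \<noteq> 0"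
      then have r: "r \<le> M' 7 x" using M' x by simp
      have "wp B (For 12 node_count (Cond (Sub (Cell 7 (Var 12)) (input_dist (Var 12) (Var 11)))
           (Assign 7 (Var 12) (input_dist (Var 12) (Var 11))) Skip))
        (\<lambda>M3. \<forall>u. M3 7 u = (if u < n then min (M' 7 u) (dd u x) else M' 7 u)) M'"
      proof (rule wp_For[where I = "\<lambda>j M3. \<forall>u. M3 7 u = (if u < j then min (M' 7 u) (dd u x) else M' 7 u)", OF _ n_le], goal_cases)
        case (5 j M3)
        have M3: "M3 0 = inp" "M3 5 (j * n + x) = dd j x" "M3 11 0 = x"
          using M M' x 5(1) 5(3)[of 0] 5(3)[of 5] 5(3)[of 11] by (auto simp: dist_ok_def)
        then have "dd j x < 2 ^ B" using 5(4) unfolding bounded_def by metis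
        then show ?case using M3 5(1,2,5)
          by (intro wp_Cond wp_Assign wp_Skip) (auto simp: prog_simps less_Suc_eq)
      qed (use M' in \<open>auto simp: prog_simps\<close>)
      then show "wp B (For 12 node_count (Cond (Sub (Cell 7 (Var 12)) (input_dist (Var 12) (Var 11)))
           (Assign 7 (Var 12) (input_dist (Var 12) (Var 11))) Skip))
        (\<lambda>M'. partial_net r (M' 7) \<and> (\<forall>u<Suc x. M' 7 u < r)) M'"
      proof (rule wp_frame)
        fix M3 :: memory assume M3: "\<forall>u. M3 7 u = (if u < n then min (M' 7 u) (dd u x) else M' 7 u)"
        have "partial_net r (M3 7)"
        proof (rule partial_net_insert[where e = "M' 7" and x = x])
          show "x < n" "r \<le> M' 7 x" by (fact x(1), fact r)
          show "partial_net r (M' 7)" using I by blast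
          show "\<forall>u<n. M3 7 u = min (M' 7 u) (dd u x)" using M3 by simp
        qed
        then show "partial_net r (M3 7) \<and> (\<forall>u<Suc x. M3 7 u < r)"
          using I M3 x dd_self M(4) by (auto simp: less_Suc_eq)
      qed
    next
      assume "aval (Sub (Add (Cell 7 (Var 11)) (Const 1)) (Var 6)) M' = 0"
      then show "wp B Skip (\<lambda>M'. partial_net r (M' 7) \<and> (\<forall>u<Suc x. M' 7 u < r)) M'"
        using M' x I by (intro wp_Skip) (auto simp: less_Suc_eq)
    qed
  qed (use M in \<open>auto simp: prog_simps dist_ok_def\<close>)
  then show ?thesis by (simp add: net_def)
qed

definition good_hop :: "(nat \<Rightarrow> nat) \<Rightarrow> nat \<Rightarrow> nat \<Rightarrow> bool" where
  "good_hop e u v \<longleftrightarrow> wt u v \<noteq> 0 \<and> wt u v + e v = e u"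

definition hops_ok :: "(nat \<Rightarrow> nat) \<Rightarrow> (nat \<Rightarrow> nat) \<Rightarrow> bool" where
  "hops_ok e g \<longleftrightarrow> (\<forall>u<n. g u < n \<and> (if e u = 0 then g u = u else good_hop e u (g u)))"

text \<open>Take the first edge of a shortest path to a nearest net point. The distance to the net
  drops by exactly its weight: if it were even smaller at \<open>v\<close>, the triangle inequality
  would give \<open>u\<close> a closer net point.\<close>

lemma ex_good_hop:
  assumes "partial_net r e" "u < n" "e u \<noteq> 0"
  shows "\<exists>v<n. good_hop e u v"
proof -
  obtain y where y: "y < n" "e y = 0" "dd u y = e u" using assms by (auto simp: partial_net_def)
  then have "u \<noteq> y" using assms by auto
  then obtain v where v: "v < n" "wt u v \<noteq> 0" "wt u v + dd v y = dd u y" using dd_next y assms by blast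
  obtain y' where y': "y' < n" "e y' = 0" "dd v y' = e v" using assms v by (auto simp: partial_net_def)
  have "e v \<le> dd v y" "e u \<le> dd u y'" using assms v y y' by (auto simp: partial_net_def)
  moreover have "dd u y' \<le> dd u v + dd v y'" using assms v y' dd_tri by blast
  moreover have "dd u v \<le> wt u v" using dd_edge assms v by blast
  ultimately show ?thesis using v y y' by (intro exI[of _ v]) (auto simp: good_hop_def)
qed

text \<open>Entry \<open>u\<close> after the candidates before \<open>j\<close> have been tried.\<close>

definition hop_scan :: "(nat \<Rightarrow> nat) \<Rightarrow> nat \<Rightarrow> nat \<Rightarrow> nat \<Rightarrow> bool" where
  "hop_scan e j u v \<longleftrightarrow> v < n \<and> (v = u \<and> (\<forall>x<j. \<not> good_hop e u x) \<or> good_hop e u v)"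

lemma hop_prog:
  assumes M: "M 0 = inp" and e: "partial_net r (M 7)"
  shows "wp B hop_prog (\<lambda>M'. hops_ok (M 7) (M' 9)) M"
proof -
  have "wp B hop_prog (\<lambda>M'. \<forall>u<n. hop_scan (M 7) n u (M' 9 u)) M"
    unfolding hop_prog_def
  proof (rule wp_For[where I = "\<lambda>i M'. \<forall>u<i. hop_scan (M 7) n u (M' 9 u)", OF _ n_le], goal_cases)
    case (5 i M')
    have M': "M' 0 = inp" "M' 7 = M 7" using M 5(3)[of 0] 5(3)[of 7] by auto
    show ?case
    proof (rule wp_Seq[where Q = "\<lambda>M3. M3 9 = (M' 9)(i := i)"])
      have "i < 2 ^ B" using 5(2,4) unfolding bounded_def by metis
      then show "wp B (Assign 9 (Var 11) (Var 11)) (\<lambda>M3. M3 9 = (M' 9)(i := i)) M'"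
        using 5(2) by (intro wp_Assign) (auto simp: update_def)
      fix M3 :: memory assume fr: "\<And>y. y \<notin> written (Assign 9 (Var 11) (Var 11)) \<Longrightarrow> M3 y = M' y"
        and M39: "M3 9 = (M' 9)(i := i)"
      have M3: "M3 0 = inp" "M3 7 = M 7" "M3 11 0 = i" using M' 5(2) fr[of 0] fr[of 7] fr[of 11] by auto
      show "wp B (For 12 node_count (Cond (input_weight (Var 11) (Var 12))
           (Cond (neq (Add (input_weight (Var 11) (Var 12)) (Cell 7 (Var 12))) (Cell 7 (Var 11)))
              Skip (Assign 9 (Var 11) (Var 12))) Skip))
         (\<lambda>M'. \<forall>u<Suc i. hop_scan (M 7) n u (M' 9 u)) M3"
      proof (rule wp_frame[OF wp_For[where I = "\<lambda>j M'. (\<forall>u<i. hop_scan (M 7) n u (M' 9 u)) \<and> hop_scan (M 7) j i (M' 9 i)", OF _ n_le]], goal_cases)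
        case 3
        show ?case using 5(1,5) M39 by (auto simp: hop_scan_def)
      next
        case (5 j M4)
        have M4: "M4 0 = inp" "M4 7 = M 7" "M4 11 0 = i" "M4 12 0 = j"
          using M3 5(2) 5(3)[of 0] 5(3)[of 7] 5(3)[of 11] by auto
        have "j < 2 ^ B" using M4(4) 5(4) unfolding bounded_def by metis
        then show ?case using M4 5(1,5)
          by (intro wp_Cond wp_Assign wp_Skip)
            (auto simp: prog_simps hop_scan_def good_hop_def less_Suc_eq)
      qed (use M3 in \<open>auto simp: prog_simps less_Suc_eq\<close>)
    qed
  qed (use M in \<open>auto simp: prog_simps\<close>)
  then show ?thesis
  proof (rule wp_frame)
    fix M' :: memory assume *: "\<forall>u<n. hop_scan (M 7) n u (M' 9 u)"
    have "M' 9 u < n \<and> (if M 7 u = 0 then M' 9 u = u else good_hop (M 7) u (M' 9 u))" if u: "u < n" for u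
    proof (cases "M 7 u = 0")
      case True
      then have "\<not> good_hop (M 7) u v" for v by (auto simp: good_hop_def)
      then show ?thesis using * u True by (auto simp: hop_scan_def)
    next
      case False
      then show ?thesis using * u ex_good_hop[OF e u False] by (auto simp: hop_scan_def)
    qed
    then show "hops_ok (M 7) (M' 9)" by (simp add: hops_ok_def)
  qed
qed

section \<open>Walks of one level and the loop over the levels\<close>

definition short_trail :: "nat \<Rightarrow> (nat \<Rightarrow> nat) \<Rightarrow> (nat \<Rightarrow> nat) \<Rightarrow> nat set" where
  "short_trail m e g = {(g ^^ t) x | t x. t < n \<and> x < m \<and> e x = 0}"

lemma short_trail_Suc:
  "short_trail (Suc m) e g = short_trail m e g \<union> (if e m = 0 then (\<lambda>t. (g ^^ t) m) ` {..<n} else {})"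
  by (auto simp: short_trail_def less_Suc_eq)

lemma walk_prog:
  assumes M: "M 0 = inp"
  shows "wp B walk_prog (\<lambda>M'. M' 1 = (\<lambda>u. if u \<in> short_trail n (M 8) (M 9) then M 9 u else M 1 u)) M"
  unfolding walk_prog_def
proof (rule wp_For[where I = "\<lambda>x M'. M' 1 = (\<lambda>u. if u \<in> short_trail x (M 8) (M 9) then M 9 u else M 1 u)", OF _ n_le], goal_cases)
  case 3
  show ?case by (auto simp: short_trail_def)
next
  case (5 x M')
  have M': "M' 0 = inp" "M' 8 = M 8" "M' 9 = M 9" using M 5(3)[of 0] 5(3)[of 8] 5(3)[of 9] by auto
  let ?body = "Seq (Assign 1 (Var 10) (Cell 9 (Var 10))) (SetVar 10 (Cell 9 (Var 10)))"
  let ?S = "\<lambda>j. short_trail x (M 8) (M 9) \<union> (\<lambda>t. (M 9 ^^ t) x) ` {..<j}"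
  show ?case
  proof (rule wp_Cond)
    assume "aval (Cell 8 (Var 11)) M' \<noteq> 0"
    then show "wp B Skip (\<lambda>M'. M' 1 = (\<lambda>u. if u \<in> short_trail (Suc x) (M 8) (M 9) then M 9 u else M 1 u)) M'"
      using 5 M' by (intro wp_Skip) (simp add: short_trail_Suc)
  next
    assume "aval (Cell 8 (Var 11)) M' = 0"
    then have z: "M 8 x = 0" using 5 M' by simp
    show "wp B (Seq (SetVar 10 (Var 11)) (For 12 node_count ?body))
      (\<lambda>M'. M' 1 = (\<lambda>u. if u \<in> short_trail (Suc x) (M 8) (M 9) then M 9 u else M 1 u)) M'"
    proof (rule wp_Seq[where Q = "\<lambda>M3. M3 10 0 = x"])
      have "x < 2 ^ B" using 5(2,4) unfolding bounded_def by metis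
      then show "wp B (SetVar 10 (Var 11)) (\<lambda>M3. M3 10 0 = x) M'"
        using 5(2) by (intro wp_Assign) (auto simp: update_def)
      fix M3 :: memory assume fr: "\<And>y. y \<notin> written (SetVar 10 (Var 11)) \<Longrightarrow> M3 y = M' y"
        and x0: "M3 10 0 = x"
      have M3: "M3 0 = inp" "M3 9 = M 9" "M3 1 = M' 1" using M' fr[of 0] fr[of 9] fr[of 1] by auto
      have "wp B (For 12 node_count ?body)
        (\<lambda>M'. M' 10 0 = (M 9 ^^ n) x \<and> M' 1 = (\<lambda>u. if u \<in> ?S n then M 9 u else M 1 u)) M3"
      proof (rule wp_For[where I = "\<lambda>j M'. M' 10 0 = (M 9 ^^ j) x \<and> M' 1 = (\<lambda>u. if u \<in> ?S j then M 9 u else M 1 u)", OF _ n_le], goal_cases)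
        case 3
        show ?case using x0 M3 5(5) by simp
      next
        case (5 j M4)
        have M4: "M4 0 = inp" "M4 9 = M 9" using M3 5(3)[of 0] 5(3)[of 9] by auto
        have "M 9 ((M 9 ^^ j) x) < 2 ^ B" using M4(2) 5(4) unfolding bounded_def by metis
        then show ?case using M4 5(5)
          by (intro wp_Seq[where Q = "\<lambda>M'. M' 10 0 = (M 9 ^^ j) x \<and> M' 9 = M 9 \<and>
                M' 1 = (\<lambda>u. if u \<in> ?S (Suc j) then M 9 u else M 1 u)"] wp_Assign)
            (auto simp: update_def lessThan_Suc fun_eq_iff)
      qed (use M3 in \<open>auto simp: prog_simps\<close>)
      then show "wp B (For 12 node_count ?body)
        (\<lambda>M'. M' 1 = (\<lambda>u. if u \<in> short_trail (Suc x) (M 8) (M 9) then M 9 u else M 1 u)) M3"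
        by (rule wp_frame) (use z in \<open>simp add: short_trail_Suc\<close>)
    qed
  qed
qed (use M in \<open>auto simp: prog_simps\<close>)

lemma copy_prog:
  assumes M: "M 0 = inp"
  shows "wp B copy_prog (\<lambda>M'. \<forall>u<n. M' 8 u = M 7 u) M"
  unfolding copy_prog_def
proof (rule wp_For[where I = "\<lambda>j M'. \<forall>u<j. M' 8 u = M 7 u", OF _ n_le], goal_cases)
  case (5 j M')
  have M': "M' 7 = M 7" using 5(3)[of 7] by auto
  then have "M 7 j < 2 ^ B" using 5(4) unfolding bounded_def by metis
  then show ?case using M' 5 by (intro wp_Assign) (auto simp: update_def less_Suc_eq)
qed (use M in \<open>auto simp: prog_simps\<close>)

lemma level_prog:
  assumes M: "dist_ok M" "M 4 0 = W" "M 6 0 = r" "0 < r" "r \<le> W"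
  shows "wp B level_prog (\<lambda>M'. M' 6 0 = 4 * r \<and> (\<exists>e g. net (4 * r) e \<and> hops_ok e g \<and>
    (\<forall>u<n. M' 8 u = e u) \<and>
    M' 1 = (\<lambda>u. if u \<in> short_trail n (M 8) g then g u else M 1 u))) M"
  unfolding level_prog_def
proof (rule wp_Seq[where Q = "\<lambda>M'. M' 6 0 = 4 * r"], goal_cases)
  case 1
  have "4 * r < 2 ^ B" using M W_B by linarith
  then show ?case using M by (intro wp_Assign) (auto simp: update_def)
next
  case (2 M1)
  have M1: "dist_ok M1" "M1 6 0 = 4 * r" "M1 8 = M 8" "M1 1 = M 1"
    using 2(3) M(1) 2(1)[of 0] 2(1)[of 5] 2(1)[of 8] 2(1)[of 1] by (auto simp: dist_ok_def)
  show ?case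
  proof (rule wp_Seq[OF init_net_prog[of M1 "4 * r", OF M1(1)]], goal_cases)
    case (1 M2)
    have M2: "dist_ok M2" "M2 6 0 = 4 * r" "M2 8 = M 8" "M2 1 = M 1"
      using M1 1(1)[of 0] 1(1)[of 5] 1(1)[of 8] 1(1)[of 1] 1(1)[of 6]
      by (auto simp: dist_ok_def init_net_prog_def)
    have "0 < 4 * r" using M by simp
    show ?case
    proof (rule wp_Seq[OF net_prog[of M2 "4 * r", OF M2(1,2) 1(3) \<open>0 < 4 * r\<close>]], goal_cases)
      case (1 M3)
      have M3: "M3 0 = inp" "M3 6 0 = 4 * r" "M3 8 = M 8" "M3 1 = M 1"
        using M2 1(1)[of 0] 1(1)[of 8] 1(1)[of 1] 1(1)[of 6]
        by (auto simp: dist_ok_def net_prog_def)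
      have pn: "partial_net (4 * r) (M3 7)" using 1(3) by (simp add: net_def)
      show ?case
      proof (rule wp_Seq[OF hop_prog[of M3 "4 * r", OF M3(1) pn]], goal_cases)
        case (1 M4)
        have M4: "M4 0 = inp" "M4 6 0 = 4 * r" "M4 8 = M 8" "M4 1 = M 1" "M4 7 = M3 7"
          using M3 1(1)[of 0] 1(1)[of 8] 1(1)[of 1] 1(1)[of 6] 1(1)[of 7]
          by (auto simp: hop_prog_def)
        note g = 1(3)
        show ?case
        proof (rule wp_Seq[OF walk_prog[of M4, OF M4(1)]], goal_cases)
          case (1 M5)
          have M5: "M5 0 = inp" "M5 6 0 = 4 * r" "M5 7 = M3 7"
            using M4 1(1)[of 0] 1(1)[of 6] 1(1)[of 7] by (auto simp: walk_prog_def)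
          show ?case
          proof (rule wp_frame[OF copy_prog[of M5, OF M5(1)]], goal_cases)
            case (1 M6)
            have "M6 6 0 = 4 * r" "M6 1 = M5 1"
              using M5 1(1)[of 6] 1(1)[of 1] by (auto simp: copy_prog_def)
            moreover have "\<forall>u<n. M6 8 u = M3 7 u" using 1(3) M5 by simp
            ultimately show ?case using \<open>net (4 * r) (M3 7)\<close> g M4
                \<open>M5 1 = (\<lambda>u. if u \<in> short_trail n (M4 8) (M4 9) then M4 9 u else M4 1 u)\<close>
              by (intro conjI exI[of _ "M3 7"] exI[of _ "M4 9"]) auto
          qed
        qed
      qed
    qed
  qed
qed

lemma short_trail_cong: "(\<And>u. u < m \<Longrightarrow> e u = e' u) \<Longrightarrow> short_trail m e g = short_trail m e' g"
  unfolding short_trail_def by (rule Collect_cong) metis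

text \<open>There is one more net than there are hop functions, since \<open>H i\<close> leads into
  net \<open>Suc i\<close>. The clause on \<open>q\<close> is the counterpart of
  \<open>par_trail\<close>.\<close>

definition levels :: "nat \<Rightarrow> (nat \<Rightarrow> nat \<Rightarrow> nat) \<Rightarrow> (nat \<Rightarrow> nat \<Rightarrow> nat) \<Rightarrow> (nat \<Rightarrow> nat) \<Rightarrow> bool" where
  "levels l E H q \<longleftrightarrow> E 0 = (\<lambda>_. 0) \<and> (\<forall>i\<le>l. net (4 ^ i) (E i)) \<and> (\<forall>i<l. hops_ok (E (Suc i)) (H i)) \<and>
     (\<forall>u. \<forall>i<l. u \<in> short_trail n (E i) (H i) \<longrightarrow>
        (\<forall>j. i < j \<longrightarrow> j < l \<longrightarrow> u \<notin> short_trail n (E j) (H j)) \<longrightarrow> q u = H i u)"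

lemma levels_0: "levels 0 (\<lambda>_ _. 0) H q"
  using k dd_self dd_pos by (fastforce simp: levels_def net_def partial_net_def)

lemma levels_Suc:
  assumes "levels l E H q" "net (4 * 4 ^ l) e" "hops_ok e g"
    and "q' = (\<lambda>u. if u \<in> short_trail n (E l) g then g u else q u)"
  shows "levels (Suc l) (E(Suc l := e)) (H(l := g)) q'"
  using assms unfolding levels_def by (auto simp: le_Suc_eq less_Suc_eq)

lemma tree_prog:
  assumes M: "M 0 = inp" "\<And>u. u < n \<Longrightarrow> M 8 u = 0"
  shows "wp B tree_prog (\<lambda>M'. \<exists>L E H. levels L E H (M' 1) \<and> W < 4 ^ L) M"
proof -
  \<comment> \<open>The guard lets the separation grow while it is at most \<open>W\<close>, so the
    loop runs until the first power of 4 above \<open>W\<close>.\<close>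
  define N where "N = (LEAST N. W < 4 ^ N)"
  have "(2::nat) ^ B \<le> 4 ^ B" by (rule power_mono) auto
  then have W4: "W < 4 ^ B" using W_B by linarith
  then have N: "W < 4 ^ N" "N \<le> B" unfolding N_def by (rule LeastI, rule Least_le)
  have less_N: "4 ^ j \<le> W" if "j < N" for j using not_less_Least that unfolding N_def by fastforce
  define I where "I l M \<longleftrightarrow> dist_ok M \<and> M 4 0 = W \<and> M 6 0 = 4 ^ l \<and>
    (\<exists>E H. levels l E H (M 1) \<and> (\<forall>u<n. M 8 u = E l u))" for l M
  show ?thesis
    unfolding tree_prog_def
  proof (rule wp_Seq[OF sum_prog[of M, OF M(1)]], goal_cases)
    case (1 M1)
    have M1: "M1 0 = inp" "M1 8 = M 8" "M1 4 0 = W"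
      using M 1(3) 1(1)[of 0] 1(1)[of 8] by (auto simp: sum_prog_def)
    show ?case
    proof (rule wp_Seq[OF init_prog[of M1, OF M1(1,3)]], goal_cases)
      case (1 M2)
      have M2: "M2 0 = inp" "M2 8 = M 8" "M2 4 0 = W"
        using M1 1(1)[of 0] 1(1)[of 8] 1(1)[of 4] by (auto simp: init_prog_def)
      show ?case
      proof (rule wp_Seq[OF floyd_prog[of M2, OF M2(1) 1(3)]], goal_cases)
        case (1 M3)
        have M3: "dist_ok M3" "M3 8 = M 8" "M3 4 0 = W"
          using M2 1(3) 1(1)[of 0] 1(1)[of 8] 1(1)[of 4] by (auto simp: floyd_prog_def dist_ok_def)
        show ?case
        proof (rule wp_Seq[where Q = "I 0"], goal_cases)
          case 1
          have "1 < (2::nat) ^ B" using B_pos by (rule one_less_power[rotated]) simp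
          then show ?case using M3 M(2) levels_0
            by (intro wp_Assign) (auto simp: update_def I_def dist_ok_def intro!: exI[of _ "\<lambda>_ _. 0"])
        next
          case (2 M4)
          have "wp B (While (Sub (Add (Var 4) (Const 1)) (Var 6)) level_prog) (I N) M4"
          proof (rule wp_While[where I = I, OF N(2) 2(3)], goal_cases)
            case (1 j M5)
            then obtain E H where EH: "levels j E H (M5 1)" "\<forall>u<n. M5 8 u = E j u"
              and M5: "dist_ok M5" "M5 4 0 = W" "M5 6 0 = 4 ^ j" by (auto simp: I_def)
            have "wp B level_prog (I (Suc j)) M5"
            proof (rule wp_frame[OF level_prog[OF M5]], goal_cases)
              case (3 M6)
              then obtain e g where eg: "net (4 * 4 ^ j) e" "hops_ok e g" "\<forall>u<n. M6 8 u = e u"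
                "M6 1 = (\<lambda>u. if u \<in> short_trail n (M5 8) g then g u else M5 1 u)" by auto
              have "short_trail n (M5 8) g = short_trail n (E j) g"
                using EH(2) by (intro short_trail_cong) auto
              then have "levels (Suc j) (E(Suc j := e)) (H(j := g)) (M6 1)"
                using eg by (intro levels_Suc[OF EH(1)]) auto
              moreover have "dist_ok M6" "M6 4 0 = W"
                using M5 3(1)[of 0] 3(1)[of 5] 3(1)[of 4]
                by (auto simp: dist_ok_def level_prog_def init_net_prog_def net_prog_def hop_prog_def
                    walk_prog_def copy_prog_def)
              ultimately show ?case using 3(3) eg(3)
                unfolding I_def by (intro conjI exI[of _ "E(Suc j := e)"] exI[of _ "H(j := g)"]) auto
            qed (use less_N 1 in auto)
            then show ?case using M5 less_N[OF 1(1)] by simp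
          next
            case (2 M5)
            then show ?case using N(1) by (simp add: I_def)
          qed
          then show ?case
            by (rule wp_frame) (use N(1) in \<open>auto simp: I_def\<close>)
        qed
      qed
    qed
  qed
qed

end

section \<open>Instances\<close>

lemma concat_map_nth:
  assumes "i < length us" "j < length vs"
  shows "concat (map (\<lambda>u. map (f u) vs) us) ! (i * length vs + j) = f (us ! i) (vs ! j)"
  using assms(1)
proof (induction us arbitrary: i)
  case (Cons u us)
  then show ?case using assms(2) by (cases i) (auto simp: nth_append)
qed simp

lemma length_concat_map: "length (concat (map (\<lambda>u. map (f u) vs) us)) = length us * length vs"
  by (induction us) auto

lemma sum_list_Suc_le: "Suc (sum_list xs) \<le> 2 ^ input_size xs"
proof (induction xs)
  case (Cons x xs)
  have "Suc x * Suc (sum_list xs) \<le> 2 ^ bit_length x * 2 ^ input_size xs"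
    using Cons less_power_bit_length[of x] by (intro mult_le_mono) (auto simp: Suc_le_eq)
  then show ?case by (simp add: input_size_def power_add)
qed (simp add: input_size_def)

lemma length_le_input_size: "length xs \<le> input_size xs"
  by (induction xs) (auto simp: input_size_def bit_length_def)

text \<open>Before the first time \<open>m\<close> at which the value occurs the orbit has no
  repetition, since a repetition would allow an earlier occurrence; hence
  \<open>m < n\<close>.\<close>

lemma funpow_orbit_less:
  fixes g :: "nat \<Rightarrow> nat"
  assumes g: "\<And>u. u < n \<Longrightarrow> g u < n" and x: "x < n"
  shows "\<exists>t'<n. (g ^^ t) x = (g ^^ t') x"
proof -
  define m where "m = (LEAST m. (g ^^ m) x = (g ^^ t) x)"
  have m: "(g ^^ m) x = (g ^^ t) x" unfolding m_def by (rule LeastI) simp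
  have least: "m \<le> j" if "(g ^^ j) x = (g ^^ t) x" for j unfolding m_def using that by (rule Least_le)
  have "inj_on (\<lambda>i. (g ^^ i) x) {..m}"
  proof (rule linorder_inj_onI)
    fix i j assume ij: "i < j" "i \<in> {..m}" "j \<in> {..m}"
    show "(g ^^ i) x \<noteq> (g ^^ j) x"
    proof
      assume eq: "(g ^^ i) x = (g ^^ j) x"
      have "(g ^^ (m - j + i)) x = (g ^^ (m - j)) ((g ^^ j) x)" by (simp add: funpow_add eq)
      also have "\<dots> = (g ^^ (m - j + j)) x" by (simp only: funpow_add comp_apply)
      also have "\<dots> = (g ^^ t) x" using ij m by simp
      finally have "m \<le> m - j + i" by (rule least)
      then show False using ij by simp
    qed
  qed auto
  moreover have "(g ^^ i) x < n" for i using g x by (induction i) auto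
  then have "(\<lambda>i. (g ^^ i) x) ` {..m} \<subseteq> {..<n}" by auto
  ultimately have "card {..m} \<le> card {..<n}" by (intro card_inj_on_le) auto
  then have "m < n" by simp
  then show ?thesis using m by (intro exI[of _ m]) simp
qed

lemma (in graph) d_le_sum_edges: "u \<in> V \<Longrightarrow> v \<in> V \<Longrightarrow> d u v \<le> (\<Sum>e\<in>edges G. w e)"
proof -
  assume "u \<in> V" "v \<in> V"
  then obtain p where p: "gpath G u p v" "plen p = d u v" using d_attained by blast
  have "plen p \<le> (\<Sum>e\<in>edges G. w e)"
    unfolding plen_def by (rule sum_mono2[OF finE gpath_path_edges[OF p(1)]]) simp
  then show ?thesis using p by simp
qed

locale encoded_instance = graph +
  fixes s :: 'a and vs :: "'a list" and xs :: "nat list" and k :: nat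
  assumes vs: "distinct vs" "set vs = V" and sink: "k < length vs" "vs ! k = s"
    and xs: "xs = length vs # k # [if {u, v} \<in> edges G then w {u, v} else 0. u \<leftarrow> vs, v \<leftarrow> vs]"
begin

abbreviation "n \<equiv> length vs"

definition inp :: "nat \<Rightarrow> nat" where "inp = initial_memory xs 0"

definition W :: nat where "W = 1 + (\<Sum>j<n * n. inp (j + 2))"

definition dd :: "nat \<Rightarrow> nat \<Rightarrow> nat" where "dd i j = d (vs ! i) (vs ! j)"

lemma vs_V: "i < n \<Longrightarrow> vs ! i \<in> V" using vs(2) nth_mem by blast

lemma ex_index: "v \<in> V \<Longrightarrow> \<exists>i<n. vs ! i = v" using vs(2) by (metis in_set_conv_nth)

lemma vs_eq: "i < n \<Longrightarrow> j < n \<Longrightarrow> vs ! i = vs ! j \<longleftrightarrow> i = j" using vs(1) by (rule nth_eq_iff_index_eq)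

lemma length_xs: "length xs = n * n + 2"
  unfolding xs by (simp only: length_Cons length_concat_map)

lemma inp_nth: "j < n * n + 2 \<Longrightarrow> inp j = xs ! j"
  by (simp add: inp_def initial_memory_def length_xs)

lemma inp_weight:
  assumes "i < n" "j < n"
  shows "inp (i * n + j + 2) = (if {vs ! i, vs ! j} \<in> edges G then w {vs ! i, vs ! j} else 0)"
proof -
  have "inp (i * n + j + 2) = xs ! (i * n + j + 2)" using index_less[OF assms] by (intro inp_nth) simp
  then show ?thesis
    using concat_map_nth[OF assms, of "\<lambda>u v. if {u, v} \<in> edges G then w {u, v} else 0"] by (simp add: xs)
qed

lemma inp_weight_pos: "i < n \<Longrightarrow> j < n \<Longrightarrow> inp (i * n + j + 2) \<noteq> 0 \<Longrightarrow>
    {vs ! i, vs ! j} \<in> edges G \<and> inp (i * n + j + 2) = w {vs ! i, vs ! j}"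
  unfolding inp_weight by (auto split: if_splits)

text \<open>Every edge weight occurs among the matrix entries. As distances are at most the sum of
  all edge weights, this places \<open>W\<close> above the diameter.\<close>

lemma sum_edges_le: "(\<Sum>e\<in>edges G. w e) \<le> (\<Sum>j<n * n. inp (j + 2))"
proof -
  define J where "J = {j. j < n * n \<and> {vs ! (j div n), vs ! (j mod n)} \<in> edges G}"
  let ?e = "\<lambda>j. {vs ! (j div n), vs ! (j mod n)}"
  have J: "j div n < n" "j mod n < n" "j div n * n + j mod n = j" if "j < n * n" for j
    using that sink(1) by (auto simp: less_mult_imp_div_less intro!: mod_less_divisor)
  have "edges G \<subseteq> ?e ` J"
  proof
    fix e assume e: "e \<in> edges G"
    have "\<exists>u\<in>V. \<exists>v\<in>V. u \<noteq> v \<and> e = {u, v}" using wg e by (simp add: weighted_graph_def)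
    then obtain u v where uv: "u \<in> V" "v \<in> V" "e = {u, v}" by auto
    obtain i j where ij: "i < n" "vs ! i = u" "j < n" "vs ! j = v" using ex_index uv by metis
    have "(i * n + j) div n = i" "(i * n + j) mod n = j" using index_div[OF ij(3)] index_mod[OF ij(3)] by auto
    then have "?e (i * n + j) = e" using uv ij by simp
    then show "e \<in> ?e ` J" using index_less[OF ij(1,3)] e by (intro image_eqI[of _ _ "i * n + j"]) (auto simp: J_def)
  qed
  then have "(\<Sum>e\<in>edges G. w e) \<le> (\<Sum>e\<in>?e ` J. w e)" by (intro sum_mono2) (auto simp: J_def)
  also have "\<dots> \<le> (\<Sum>j\<in>J. w (?e j))" using sum_image_le[of J w ?e] by (simp add: J_def)
  also have "\<dots> = (\<Sum>j\<in>J. inp (j + 2))"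
  proof (rule sum.cong)
    fix j assume j: "j \<in> J"
    then have "inp (j div n * n + j mod n + 2) = w (?e j)" using J by (subst inp_weight) (auto simp: J_def)
    then show "w (?e j) = inp (j + 2)" using J j by (simp add: J_def)
  qed simp
  also have "\<dots> \<le> (\<Sum>j<n * n. inp (j + 2))" by (intro sum_mono2) (auto simp: J_def)
  finally show ?thesis .
qed

lemma W_le: "W \<le> 2 ^ input_size xs"
proof -
  have "(\<Sum>j<n * n. inp (j + 2)) = (\<Sum>j<n * n. xs ! (j + 2))"
    by (intro sum.cong) (auto simp: inp_nth)
  also have "\<dots> = (\<Sum>j\<in>(\<lambda>j. j + 2) ` {..<n * n}. xs ! j)" by (subst sum.reindex) (auto simp: inj_on_def)
  also have "\<dots> \<le> (\<Sum>j<length xs. xs ! j)" by (intro sum_mono2) (auto simp: length_xs)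
  also have "\<dots> = sum_list xs" by (simp add: sum_list_sum_nth atLeast0LessThan)
  finally show ?thesis using sum_list_Suc_le[of xs] by (simp add: W_def)
qed

lemma dd_le_W: "i < n \<Longrightarrow> j < n \<Longrightarrow> dd i j < W"
  using d_le_sum_edges[of "vs ! i" "vs ! j"] sum_edges_le vs_V unfolding W_def dd_def by fastforce

sublocale instance_memory "input_size xs + 3" n k W inp dd
proof
  have "xs ! 0 = n" "xs ! Suc 0 = k" by (simp_all add: xs)
  then show "inp 0 = n" "inp (Suc 0) = k" by (simp_all add: inp_nth)
  show "k < n" by (rule sink(1))
  show "W = 1 + (\<Sum>j<n * n. inp (j + 2))" by (rule W_def)
  \<comment> \<open>Two of the three extra bits pay for the factor 4, the third for
    strictness.\<close>
  have "4 * W \<le> 4 * 2 ^ input_size xs" using W_le by simp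
  also have "\<dots> < 2 ^ (input_size xs + 3)" by (simp add: power_add)
  finally show "4 * W < 2 ^ (input_size xs + 3)" .
  show "n * n \<le> input_size xs + 3" using length_le_input_size[of xs] length_xs by simp
next
  fix u v assume uv: "u < n" "v < n" "u \<noteq> v"
  then show "dd u v \<noteq> 0" using d_pos[of "vs ! u" "vs ! v"] by (auto simp: dd_def vs_V vs_eq)
  obtain y where y: "{vs ! u, y} \<in> edges G" "w {vs ! u, y} + d y (vs ! v) = d (vs ! u) (vs ! v)"
    using d_next[of "vs ! u" "vs ! v"] uv vs_V vs_eq by auto
  obtain i where i: "i < n" "vs ! i = y" using ex_index edge_verts[OF y(1)] by blast
  then have "inp (u * n + i + 2) = w {vs ! u, y}" using inp_weight[OF uv(1) i(1)] y(1) by simp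
  then show "\<exists>y<n. inp (u * n + y + 2) \<noteq> 0 \<and> inp (u * n + y + 2) + dd y v = dd u v"
    using i y edge_verts[OF y(1)] by (intro exI[of _ i]) (auto simp: dd_def)
next
  fix u v assume uv: "u < n" "v < n"
  show "dd u v = dd v u" using d_sym uv vs_V by (simp add: dd_def)
  show "dd u v \<le> W" using dd_le_W[OF uv] by simp
  assume "inp (u * n + v + 2) \<noteq> 0"
  then show "dd u v \<le> inp (u * n + v + 2)" using inp_weight_pos[OF uv] d_edge by (simp add: dd_def)
qed (auto simp: dd_def d_self d_tri vs_V)

section \<open>From node numbers back to the graph\<close>

definition idx :: "'a \<Rightarrow> nat" where "idx v = (SOME i. i < n \<and> vs ! i = v)"

lemma idx: "v \<in> V \<Longrightarrow> idx v < n \<and> vs ! idx v = v"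
  unfolding idx_def using ex_index by (rule someI_ex)

lemma idx_nth: "i < n \<Longrightarrow> idx (vs ! i) = i"
  using idx[OF vs_V] vs_eq by blast

lemma diam_less_W: "gdiameter G < W"
proof -
  have eq: "{d u v |u v. u \<in> V \<and> v \<in> V} = (\<lambda>(u, v). d u v) ` (V \<times> V)" by auto
  have "s \<in> V" using sink vs_V by auto
  then have "gdiameter G \<in> {d u v |u v. u \<in> V \<and> v \<in> V}"
    unfolding gdiameter_def eq using finV by (intro Max_in) auto
  then obtain u v where "u \<in> V" "v \<in> V" "gdiameter G = d u v" by auto
  then show ?thesis using dd_le_W[of "idx u" "idx v"] idx by (simp add: dd_def)
qed

lemma funpow_idx:
  assumes "\<And>i. i < n \<Longrightarrow> g i < n" "i < n"
  shows "((\<lambda>u. vs ! g (idx u)) ^^ t) (vs ! i) = vs ! ((g ^^ t) i) \<and> (g ^^ t) i < n"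
  by (induction t) (auto simp: assms idx_nth)

text \<open>The walks of the program stop after \<open>n\<close> steps while \<open>trail\<close>
  allows any number; \<open>funpow_orbit_less\<close> bridges the two.\<close>

lemma trail_idx:
  assumes g: "\<And>i. i < n \<Longrightarrow> g i < n" and i: "i < n"
  shows "vs ! i \<in> trail V (\<lambda>u. e (idx u)) (\<lambda>u. vs ! g (idx u)) \<longleftrightarrow> i \<in> short_trail n e g"
proof
  assume "vs ! i \<in> trail V (\<lambda>u. e (idx u)) (\<lambda>u. vs ! g (idx u))"
  then obtain t x where x: "x \<in> V" "e (idx x) = 0" "vs ! i = ((\<lambda>u. vs ! g (idx u)) ^^ t) x"
    by (auto simp: trail_def)
  have j: "idx x < n" "vs ! idx x = x" using idx x by auto
  have "vs ! i = vs ! ((g ^^ t) (idx x))" "(g ^^ t) (idx x) < n"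
    using funpow_idx[of g "idx x" t] g j x(3) by auto
  then have "i = (g ^^ t) (idx x)" using vs_eq i by blast
  moreover obtain t' where "t' < n" "(g ^^ t) (idx x) = (g ^^ t') (idx x)"
    using funpow_orbit_less[of n g "idx x" t] g j by blast
  ultimately show "i \<in> short_trail n e g" using j x by (auto simp: short_trail_def)
next
  assume "i \<in> short_trail n e g"
  then obtain t x where x: "x < n" "e x = 0" "i = (g ^^ t) x" by (auto simp: short_trail_def)
  then have "vs ! i = ((\<lambda>u. vs ! g (idx u)) ^^ t) (vs ! x)" using funpow_idx[of g x t] g by simp
  then show "vs ! i \<in> trail V (\<lambda>u. e (idx u)) (\<lambda>u. vs ! g (idx u))"
    using x by (auto simp: trail_def idx_nth vs_V intro!: exI[of _ t] exI[of _ "vs ! x"])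
qed

lemma oblivious_tree:
  assumes lv: "levels L E H q" and L: "W < 4 ^ L" and db: "doubling_bound G \<rho>"
  shows "\<exists>T. parent_tree q vs s T \<and> oblivious_spanning_tree G s T
    (448 * 2 powr (10 * \<rho>) * (max 1 (log 2 (real (gdiameter G)))) ^ 3 * log 2 (real (card V)))"
proof -
  have sV: "s \<in> V" using sink vs_V by auto
  have ks: "idx s = k" using sink idx_nth by auto
  have net: "net (4 ^ l) (E l)" if "l \<le> L" for l using lv that by (auto simp: levels_def)
  have hops: "hops_ok (E (Suc l)) (H l)" if "l < L" for l using lv that by (auto simp: levels_def)
  have H_less: "H l i < n" if "l < L" "i < n" for l i using hops[OF that(1)] that(2) by (simp add: hops_ok_def)
  have q: "q i = H l i" if "i < n" "l < L" "vs ! i \<in> trail V (\<lambda>u. E l (idx u)) (\<lambda>u. vs ! H l (idx u))"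
    "\<And>l'. l < l' \<Longrightarrow> l' < L \<Longrightarrow> vs ! i \<notin> trail V (\<lambda>u. E l' (idx u)) (\<lambda>u. vs ! H l' (idx u))" for i l
  proof -
    have "i \<in> short_trail n (E l) (H l)" using trail_idx[of "H l" i "E l"] H_less that by blast
    moreover have "i \<notin> short_trail n (E l') (H l')" if "l < l'" "l' < L" for l'
      using trail_idx[of "H l'" i "E l'"] H_less that \<open>i < n\<close> \<open>\<And>l'. l < l' \<Longrightarrow> l' < L \<Longrightarrow> _\<close> by blast
    ultimately show ?thesis using lv that(2) unfolding levels_def by blast
  qed
  have h_hop: "{u, vs ! H l (idx u)} \<in> edges G \<and> w {u, vs ! H l (idx u)} + E (Suc l) (idx (vs ! H l (idx u))) = E (Suc l) (idx u)"
    if "l < L" "u \<in> V" "E (Suc l) (idx u) \<noteq> 0" for l u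
  proof -
    have i: "idx u < n" "vs ! idx u = u" using idx that by auto
    then have "good_hop (E (Suc l)) (idx u) (H l (idx u))"
      using hops[OF that(1)] that(3) by (auto simp: hops_ok_def)
    then show ?thesis using inp_weight_pos[OF i(1) H_less[OF that(1) i(1)]] i H_less[OF that(1) i(1)]
      by (auto simp: good_hop_def idx_nth)
  qed
  interpret hierarchy G s "\<lambda>l u. E l (idx u)" "\<lambda>l u. vs ! H l (idx u)" L "\<lambda>u. vs ! q (idx u)"
  proof
    show "s \<in> V" by (rule sV)
    show "E 0 (idx u) = 0" for u using lv by (simp add: levels_def)
    show "E l (idx s) = 0" if "l \<le> L" for l using net[OF that] ks by (simp add: net_def partial_net_def)
  next
    fix l u y assume "l \<le> L" "u \<in> V" "y \<in> V" "E l (idx y) = 0"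
    then have "E l (idx u) \<le> dd (idx u) (idx y)" using net[of l] idx[of u] idx[of y]
      unfolding net_def partial_net_def by blast
    then show "E l (idx u) \<le> d u y" using idx \<open>u \<in> V\<close> \<open>y \<in> V\<close> by (simp add: dd_def)
  next
    fix l u assume l: "l \<le> L" "u \<in> V"
    then obtain y where "y < n" "E l y = 0" "dd (idx u) y = E l (idx u)"
      using net[of l] idx[of u] by (auto simp: net_def partial_net_def)
    then show "\<exists>y\<in>V. E l (idx y) = 0 \<and> d u y = E l (idx u)"
      using l idx[of u] by (intro bexI[of _ "vs ! y"]) (auto simp: idx_nth vs_V dd_def)
    show "E l (idx u) < 4 ^ l" using net[OF l(1)] idx[OF l(2)] by (simp add: net_def)
  next
    fix l x y assume *: "l \<le> L" "x \<in> V" "y \<in> V" "E l (idx x) = 0" "E l (idx y) = 0" "x \<noteq> y"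
    then have "idx x \<noteq> idx y" using idx by metis
    then have "4 ^ l \<le> dd (idx x) (idx y)" using net[OF *(1)] idx * by (auto simp: net_def partial_net_def)
    then show "4 ^ l \<le> d x y" using idx * by (simp add: dd_def)
  next
    fix l u assume *: "l < L" "u \<in> V"
    show "vs ! H l (idx u) = u" if "E (Suc l) (idx u) = 0"
      using hops[OF *(1)] idx[OF *(2)] that by (simp add: hops_ok_def)
    show "{u, vs ! H l (idx u)} \<in> edges G"
      "w {u, vs ! H l (idx u)} + E (Suc l) (idx (vs ! H l (idx u))) = E (Suc l) (idx u)"
      if "E (Suc l) (idx u) \<noteq> 0" using h_hop[OF * that] by auto
  next
    show "gdiameter G < 4 ^ L" using diam_less_W L by simp
  next
    fix l u assume *: "u \<in> V" "u \<noteq> s" "l < L" "u \<in> trail V (\<lambda>u. E l (idx u)) (\<lambda>u. vs ! H l (idx u))"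
      "\<And>l'. l < l' \<Longrightarrow> l' < L \<Longrightarrow> u \<notin> trail V (\<lambda>u. E l' (idx u)) (\<lambda>u. vs ! H l' (idx u))"
    then show "vs ! q (idx u) = vs ! H l (idx u)" using q[of "idx u" l] idx[of u] by simp
  qed
  \<comment> \<open>A node other than the sink lies on some trail, so its pointer is a next hop and
    thus a valid number.\<close>
  have q_less: "q i < n" if i: "i < n" "vs ! i \<noteq> s" for i
  proof -
    note l = lev[OF vs_V[OF i(1)] i(2)]
    have "q i = H (lev (vs ! i)) i"
      using l(1,2) l(3) i(1) by (intro q) (auto simp: not_le[symmetric])
    then show ?thesis using H_less l(1) i(1) by simp
  qed
  have "T = {{vs ! i, vs ! q i} | i. i < n \<and> vs ! i \<noteq> s}"
  proof (rule set_eqI)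
    fix e
    show "e \<in> T \<longleftrightarrow> e \<in> {{vs ! i, vs ! q i} | i. i < n \<and> vs ! i \<noteq> s}"
    proof
      assume "e \<in> T"
      then obtain u where "u \<in> V" "u \<noteq> s" "e = {u, vs ! q (idx u)}" by (auto simp: T_def)
      then show "e \<in> {{vs ! i, vs ! q i} | i. i < n \<and> vs ! i \<noteq> s}" using idx[of u] by (auto intro!: exI[of _ "idx u"])
    next
      assume "e \<in> {{vs ! i, vs ! q i} | i. i < n \<and> vs ! i \<noteq> s}"
      then obtain i where "i < n" "vs ! i \<noteq> s" "e = {vs ! i, vs ! q i}" by auto
      then show "e \<in> T" by (auto simp: T_def idx_nth vs_V intro!: image_eqI[of _ _ "vs ! i"])
    qed
  qed
  then have "parent_tree q vs s T" using q_less by (simp add: parent_tree_def)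
  then show ?thesis using oblivious[OF db] by blast
qed

lemma tree_prog_correct:
  assumes "doubling_bound G \<rho>"
  shows "\<exists>t M T. exec tree_prog (initial_memory xs) t M \<and> t \<le> com_time (input_size xs + 3) tree_prog \<and>
    parent_tree (M 1) vs s T \<and> oblivious_spanning_tree G s T
    (448 * 2 powr (10 * \<rho>) * (max 1 (log 2 (real (gdiameter G)))) ^ 3 * log 2 (real (card V)))"
proof -
  let ?B = "input_size xs + 3" and ?M = "initial_memory xs"
  have "x < 2 ^ ?B" if "x \<in> set xs" for x
  proof -
    have "x \<le> sum_list xs" using that by (rule member_le_sum_list) simp
    also have "\<dots> < 2 ^ input_size xs" using sum_list_Suc_le[of xs] by simp
    also have "\<dots> \<le> 2 ^ ?B" by (rule power_increasing) auto
    finally show ?thesis .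
  qed
  then have "bounded ?B ?M" by (auto simp: bounded_def initial_memory_def)
  moreover have "wp ?B tree_prog (\<lambda>M. \<exists>L E H. levels L E H (M 1) \<and> W < 4 ^ L) ?M"
    by (rule tree_prog) (auto simp: inp_def initial_memory_def)
  ultimately obtain t M L E H where "exec tree_prog ?M t M" "t \<le> com_time ?B tree_prog"
    "levels L E H (M 1)" "W < 4 ^ L"
    unfolding wp_def by auto
  then show ?thesis using oblivious_tree[OF _ _ assms] by blast
qed

end

theorem theorem1:
  "\<exists>(c::real) > 0. \<exists>(prog::com) (p::nat poly).
     \<forall>(G::nat wgraph) (s::nat) (\<rho>::real) (vs::nat list) (xs::nat list).
       weighted_graph G \<longrightarrow> connected_graph G \<longrightarrow> s \<in> verts G \<longrightarrow>
       has_doubling_dimension G \<rho> \<longrightarrow> encodes_instance xs vs G s \<longrightarrow>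
       (\<exists>t M T.
          exec prog (initial_memory xs) t M \<and> t \<le> poly p (input_size xs) \<and>
          parent_tree (M 1) vs s T \<and>
          oblivious_spanning_tree G s T
            (c * 2 powr (10 * \<rho>) * (max 1 (log 2 (real (gdiameter G)))) ^ 3
               * log 2 (real (card (verts G)))))"
proof -
  obtain p where p: "\<And>B. com_time B tree_prog = poly p B" using com_time_poly by metis
  \<comment> \<open>The shift \<open>[:3, 1:]\<close> accounts for running with
    \<open>B = input_size xs + 3\<close>.\<close>
  have time: "com_time (S + 3) tree_prog = poly (pcompose p [:3, 1:]) S" for S
    by (simp add: p poly_pcompose add.commute)
  show ?thesis
  proof (intro exI[of _ "448::real"] conjI exI[of _ tree_prog] exI[of _ "pcompose p [:3, 1:]"] allI impI)
    fix G :: "nat wgraph" and s \<rho> vs xs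
    assume G: "weighted_graph G" "connected_graph G" and dim: "has_doubling_dimension G \<rho>"
      and enc: "encodes_instance xs vs G s"
    obtain k where "encoded_instance G s vs xs k"
      using G enc by (auto simp: encodes_instance_def encoded_instance_def graph_def encoded_instance_axioms_def)
    then interpret encoded_instance G s vs xs k .
    show "\<exists>t M T. exec tree_prog (initial_memory xs) t M \<and> t \<le> poly (pcompose p [:3, 1:]) (input_size xs) \<and>
        parent_tree (M 1) vs s T \<and> oblivious_spanning_tree G s T
        (448 * 2 powr (10 * \<rho>) * (max 1 (log 2 (real (gdiameter G)))) ^ 3 * log 2 (real (card (verts G))))"
      using tree_prog_correct[of \<rho>] dim unfolding time by (simp add: has_doubling_dimension_def)
  qed simp
qed

end
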